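(* Let $C\subset\mathbb P^2$ be a reduced projective plane curve over $\mathbb C$ and let $C_1$ be an irreducible component of $C$ with $\deg C_1\geq 2$. Let $l_0\in T_C$ be a line and let $P_1,P_2\in C_1\cap l_0$ be any two distinct points. Then there is a loop $l_t\in T_C$, $t\in[0,1]$, starting and ending at $l_0$, such that the monodromy along the loop $l_t$ is the transposition of the points $P_1,P_2$ and the identity permutation of the other points of $C\cap l_0$.
   Context: $T_C$ is the set of lines $l\subset\mathbb P^2$ meeting $C$ transversally (equivalently, $l\cap C$ consists of exactly $n=\deg C$ distinct points), regarded as a subset of the dual plane $\hat{\mathbb P}^2$. The other components of $C$ may have any degree (lines are allowed). Let $l_t\in T_C$, $t\in[0,1]$, be a loop (a continuous closed path in $T_C$, $l_1=l_0$) and let $l_0\cap C=\{P_1,\dots,P_n\}$. The movement of the line along the loop defines $n$ continuous paths $\psi_i(t)\in l_t\cap C$, $i=1,\dots,n$, with $\psi_i(0)=P_i$ and $l_t\cap C=\{\psi_1(t),\dots,\psi_n(t)\}$ for all $t$. The induced permutation $P_i=\psi_i(0)\mapsto\psi_i(1)\in l_0\cap C$ of the points $P_1,\dots,P_n$ is called the monodromy along the loop $l_t$. *)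

theory Defs
  imports
    "HOL-Analysis.Analysis"
    "HOL-Computational_Algebra.Polynomial"
    "HOL-Computational_Algebra.Squarefree"
    "HOL-Combinatorics.Transposition"
begin

section \<open>The complex projective plane\<close>

definition same_direction :: "complex ^ 3 \<Rightarrow> complex ^ 3 \<Rightarrow> bool" where
  "same_direction u v \<longleftrightarrow> u \<noteq> 0 \<and> v \<noteq> 0 \<and> (\<exists>c. c \<noteq> 0 \<and> u = c *s v)"

lemma part_equivp_same_direction: "part_equivp same_direction"
proof (rule part_equivpI)
  show "\<exists>v. same_direction v v"
    unfolding same_direction_def
    by (rule exI[of _ "1 :: complex ^ 3"]) (auto intro!: exI[of _ 1])
  show "symp same_direction"
  proof (rule sympI)
    fix u v assume "same_direction u v"
    then obtain c where c: "u \<noteq> 0" "v \<noteq> 0" "c \<noteq> 0" "u = c *s v"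
      by (auto simp: same_direction_def)
    then have "v = inverse c *s u"
      by (simp add: vector_smult_assoc)
    with c show "same_direction v u"
      unfolding same_direction_def by (metis inverse_nonzero_iff_nonzero)
  qed
  show "transp same_direction"
  proof (rule transpI)
    fix u v w assume "same_direction u v" "same_direction v w"
    then show "same_direction u w"
      unfolding same_direction_def
      by (metis mult_eq_0_iff vector_smult_assoc)
  qed
qed

quotient_type proj_plane = "complex ^ 3" / partial: same_direction
  morphisms rep_proj_plane proj_point
  by (rule part_equivp_same_direction)

text \<open>
  Only \<^term>\<open>proj_point v\<close> with \<^prop>\<open>v \<noteq> 0\<close> is meaningful. Since the complement of the origin
  is open in \<open>\<complex>\<^sup>3\<close>, the following is the quotient topology of the punctured space.
\<close>

instantiation proj_plane :: topological_space
begin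

definition open_proj_plane :: "proj_plane set \<Rightarrow> bool" where
  "open_proj_plane U \<longleftrightarrow> open {v. v \<noteq> 0 \<and> proj_point v \<in> U}"

instance
proof
  show "open (UNIV :: proj_plane set)"
    using open_Compl[OF closed_singleton[of "0 :: complex ^ 3"]]
    by (simp add: open_proj_plane_def Compl_eq)
next
  fix S T :: "proj_plane set"
  assume "open S" "open T"
  then have "open ({v. v \<noteq> 0 \<and> proj_point v \<in> S} \<inter> {v. v \<noteq> 0 \<and> proj_point v \<in> T})"
    unfolding open_proj_plane_def by (rule open_Int)
  also have "{v. v \<noteq> 0 \<and> proj_point v \<in> S} \<inter> {v. v \<noteq> 0 \<and> proj_point v \<in> T} =
      {v. v \<noteq> 0 \<and> proj_point v \<in> S \<inter> T}"
    by auto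
  finally show "open (S \<inter> T)"
    unfolding open_proj_plane_def .
next
  fix K :: "proj_plane set set"
  assume "\<forall>S\<in>K. open S"
  then have "open (\<Union>S\<in>K. {v. v \<noteq> 0 \<and> proj_point v \<in> S})"
    unfolding open_proj_plane_def by blast
  also have "(\<Union>S\<in>K. {v. v \<noteq> 0 \<and> proj_point v \<in> S}) = {v. v \<noteq> 0 \<and> proj_point v \<in> \<Union>K}"
    by auto
  finally show "open (\<Union>K)"
    unfolding open_proj_plane_def .
qed

end

text \<open>
  The line \<open>a\<^sub>1 x\<^sub>1 + a\<^sub>2 x\<^sub>2 + a\<^sub>3 x\<^sub>3 = 0\<close> is identified with its coefficient vector up to scaling, so
  that the dual plane is another copy of the projective plane.
\<close>

type_synonym dual_plane = proj_plane

lift_definition incident :: "proj_plane \<Rightarrow> dual_plane \<Rightarrow> bool" is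
  "\<lambda>x a. (\<Sum>i\<in>UNIV. a $ i * x $ i) = 0"
proof -
  fix x y a b :: "complex ^ 3"
  assume "same_direction x y" "same_direction a b"
  then obtain c d where c: "c \<noteq> 0" "x = c *s y" and d: "d \<noteq> 0" "a = d *s b"
    by (auto simp: same_direction_def)
  have "(\<Sum>i\<in>UNIV. a $ i * x $ i) = (d * c) * (\<Sum>i\<in>UNIV. b $ i * y $ i)"
    unfolding sum_distrib_left by (rule sum.cong) (simp_all add: c d algebra_simps)
  with c d show "((\<Sum>i\<in>UNIV. a $ i * x $ i) = 0) = ((\<Sum>i\<in>UNIV. b $ i * y $ i) = 0)"
    by simp
qed

definition line_points :: "dual_plane \<Rightarrow> proj_plane set" where
  "line_points l = {p. incident p l}"

section \<open>Plane curves\<close>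

text \<open>
  The polynomial ring \<open>\<complex>[x\<^sub>1, x\<^sub>2, x\<^sub>3]\<close> is rendered as \<open>\<complex>[x\<^sub>1][x\<^sub>2][x\<^sub>3]\<close>: the outermost variable is
  \<open>x\<^sub>3\<close>, and the coefficient of \<open>x\<^sub>1\<^sup>i x\<^sub>2\<^sup>j x\<^sub>3\<^sup>k\<close> in \<open>F\<close> is \<^term>\<open>coeff (coeff (coeff F k) j) i\<close>.
\<close>

type_synonym poly3 = "complex poly poly poly"

definition eval3 :: "poly3 \<Rightarrow> complex ^ 3 \<Rightarrow> complex" where
  "eval3 F v = poly (poly (poly F [:[:v $ 3:]:]) [:v $ 2:]) (v $ 1)"

definition homogeneous :: "nat \<Rightarrow> poly3 \<Rightarrow> bool" where
  "homogeneous n F \<longleftrightarrow> (\<forall>i j k. coeff (coeff (coeff F k) j) i \<noteq> 0 \<longrightarrow> i + j + k = n)"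

definition zero_locus :: "poly3 \<Rightarrow> proj_plane set" where
  "zero_locus F = {p. \<forall>v. v \<noteq> 0 \<and> proj_point v = p \<longrightarrow> eval3 F v = 0}"

lemma eval3_altdef:
  "eval3 F v = (\<Sum>k\<le>degree F. \<Sum>j\<le>degree (coeff F k). \<Sum>i\<le>degree (coeff (coeff F k) j).
     coeff (coeff (coeff F k) j) i * (v $ 1) ^ i * (v $ 2) ^ j * (v $ 3) ^ k)"
proof -
  have 1: "eval3 F v = (\<Sum>k\<le>degree F. poly (poly (coeff F k) [:v $ 2:]) (v $ 1) * (v $ 3) ^ k)"
    unfolding eval3_def by (subst poly_altdef) (simp add: poly_sum)
  have 2: "poly (poly G [:y:]) x = (\<Sum>j\<le>degree G. poly (coeff G j) x * y ^ j)"
    for G :: "complex poly poly" and x y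
    by (subst poly_altdef) (simp add: poly_sum)
  show ?thesis
    unfolding 1 2 poly_altdef[of "coeff (coeff _ _) _"] by (simp add: sum_distrib_right)
qed

lemma eval3_scale:
  assumes "homogeneous n F"
  shows "eval3 F (c *s v) = c ^ n * eval3 F v"
proof -
  have "coeff (coeff (coeff F k) j) i * (c * v $ 1) ^ i * (c * v $ 2) ^ j * (c * v $ 3) ^ k =
      c ^ n * (coeff (coeff (coeff F k) j) i * (v $ 1) ^ i * (v $ 2) ^ j * (v $ 3) ^ k)" for i j k
  proof (cases "coeff (coeff (coeff F k) j) i = 0")
    case False
    then have "n = i + j + k"
      using assms by (auto simp: homogeneous_def)
    then show ?thesis
      by (simp add: power_mult_distrib power_add algebra_simps)
  qed simp
  then show ?thesis
    by (simp only: eval3_altdef sum_distrib_left vector_smult_component)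
qed

lemma proj_point_eq_iff:
  assumes "u \<noteq> 0" "v \<noteq> 0"
  shows "proj_point u = proj_point v \<longleftrightarrow> (\<exists>c. c \<noteq> 0 \<and> u = c *s v)"
proof -
  have "same_direction w w" if "w \<noteq> 0" for w
    using that by (auto simp: same_direction_def intro!: exI[of _ 1])
  then show ?thesis
    using Quotient3_rel[OF Quotient3_proj_plane, of u v] assms
    by (auto simp: same_direction_def)
qed

lemma proj_point_in_zero_locus_iff:
  assumes "homogeneous n F" "v \<noteq> 0"
  shows "proj_point v \<in> zero_locus F \<longleftrightarrow> eval3 F v = 0"
  using assms by (auto simp: zero_locus_def proj_point_eq_iff eval3_scale)

section \<open>Transversal lines and monodromy\<close>

text \<open>
  For a squarefree form \<open>F\<close> of degree \<open>n\<close>, a line is transversal to the curve \<open>F = 0\<close> if it meets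
  it in exactly \<open>n\<close> distinct points. The finiteness condition excludes lines contained in a curve
  of degree 0, as \<^const>\<open>card\<close> vanishes on infinite sets.
\<close>

definition transversal_lines :: "nat \<Rightarrow> proj_plane set \<Rightarrow> dual_plane set" where
  "transversal_lines n C = {l. finite (line_points l \<inter> C) \<and> card (line_points l \<inter> C) = n}"

text \<open>
  The paths are indexed by their initial points: \<^term>\<open>\<psi> P\<close> is the motion of the intersection
  point \<open>P\<close> of \<open>C\<close> with the line at time 0.
\<close>

definition point_motions ::
    "proj_plane set \<Rightarrow> (real \<Rightarrow> dual_plane) \<Rightarrow> (proj_plane \<Rightarrow> real \<Rightarrow> proj_plane) \<Rightarrow> bool" where
  "point_motions C l \<psi> \<longleftrightarrow>
     (\<forall>P \<in> line_points (l 0) \<inter> C. path (\<psi> P) \<and> \<psi> P 0 = P) \<and>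
     (\<forall>t \<in> {0..1}. line_points (l t) \<inter> C = (\<lambda>P. \<psi> P t) ` (line_points (l 0) \<inter> C))"

text \<open>
  The values of \<open>\<sigma>\<close> outside the intersection of \<open>C\<close> with the initial line are irrelevant.
\<close>

definition has_monodromy ::
    "proj_plane set \<Rightarrow> (real \<Rightarrow> dual_plane) \<Rightarrow> (proj_plane \<Rightarrow> proj_plane) \<Rightarrow> bool" where
  "has_monodromy C l \<sigma> \<longleftrightarrow>
     (\<exists>\<psi>. point_motions C l \<psi> \<and> (\<forall>P \<in> line_points (l 0) \<inter> C. \<psi> P 1 = \<sigma> P))"

end

theory Submission
  imports
    Defs
    "HOL-Complex_Analysis.Complex_Analysis"
    "HOL-Computational_Algebra.Computational_Algebra"
    "HOL-Computational_Algebra.Field_as_Ring"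
begin

text \<open>
  Write a point near \<open>P\<^sub>1\<close> on \<open>C\<^sub>1\<close> as a holomorphic arc. The lines joining two neighbouring points of the
  arc are close to a tangent line, and for a generic tangent line they meet \<open>C\<close> in these two points
  and in points close to the simple intersections of the tangent with \<open>C\<close>. Rotating the two points
  about their midpoint by a half turn therefore gives a loop whose monodromy is their transposition.
  That the generic tangent of \<open>C\<^sub>1\<close> has only one multiple intersection with \<open>C\<close>, of order two, follows
  since a moving tangent line turns about its point of contact, hence about every multiple point it
  keeps.

  It remains to bring \<open>P\<^sub>1\<close> and \<open>P\<^sub>2\<close> into such a position. First the line moves parallel to itself until
  \<open>P\<^sub>1\<close> has become a generic point \<open>R\<close> of the arc. Then it turns about \<open>R\<close>; since the curve \<open>C\<^sub>1\<close> is
  irreducible, it stays connected after removing the finitely many non-transversal lines through \<open>R\<close>,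
  and so the second point can be moved next to \<open>R\<close>. Conjugating the half turn with this motion gives
  the required loop.
\<close>

text \<open>Every line is carried by a frame \<open>(u, w)\<close> with \<open>w\<close> off
  \<open>C\<close>. Then \<open>restrict_line F u w\<close> has degree exactly \<open>n\<close>, its
  roots are the intersection points and transversality is squarefreeness, so monodromy becomes the
  motion of roots of polynomials with continuous coefficients. Genericity rests on one dichotomy: in
  a one-parameter algebraic family, infinitely many squarefree members (supplied by continuity of
  roots around a single one) leave only finitely many bad ones. The obstacle in finding a simple
  tangent is that a second multiple point, chosen separately on each tangent, need not depend
  continuously on it. Hence a sequence of tangents, compactness, and contact estimates uniform near
  the limit, since the second point might otherwise merge with the point of contact. The obstacle in
  moving the second point is that every line through \<open>R\<close> already has \<open>R\<close>
  as an intersection point. Placing \<open>R\<close> at infinity lowers the degree by one and leaves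
  exactly the other points of \<open>C_1\<close>.\<close>

no_notation fps_nth (infixl "$" 75)

section \<open>Specialising the inner variable\<close>

text \<open>A \<open>complex poly poly\<close> is read as a family of polynomials in the outer
  variable whose parameter is the inner variable; plain \<open>poly\<close> would substitute for the
  outer one.\<close>

definition specialize :: "complex poly poly \<Rightarrow> complex \<Rightarrow> complex poly" where
  "specialize p a = map_poly (\<lambda>c. poly c a) p"

lemma coeff_specialize [simp]: "coeff (specialize p a) j = poly (coeff p j) a"
  by (simp add: specialize_def coeff_map_poly)

lemma poly_specialize: "poly (specialize p a) z = poly (poly p [:z:]) a"
  by (induction p) (simp_all add: specialize_def map_poly_pCons)

lemma poly_specialize_mult [simp]:
  "poly (specialize (p * q) a) z = poly (specialize p a) z * poly (specialize q a) z"
  by (simp add: poly_specialize)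

lemma poly_specialize_smult [simp]:
  "poly (specialize (smult c p) a) z = poly c a * poly (specialize p a) z"
  by (simp add: poly_specialize)

lemma poly_specialize_diff [simp]:
  "poly (specialize (p - q) a) z = poly (specialize p a) z - poly (specialize q a) z"
  by (simp add: poly_specialize)

lemma specialize_pderiv: "specialize (pderiv p) a = pderiv (specialize p a)"
  by (rule poly_eqI) (simp add: coeff_pderiv)

lemma poly_eq_0_if_infinite_roots:
  fixes p :: "'a :: idom poly"
  assumes "infinite A" "\<And>a. a \<in> A \<Longrightarrow> poly p a = 0"
  shows "p = 0"
proof (rule ccontr)
  assume "p \<noteq> 0"
  then have "finite {x. poly p x = 0}" by (rule poly_roots_finite)
  moreover have "A \<subseteq> {x. poly p x = 0}" using assms(2) by auto
  ultimately show False using assms(1) finite_subset by blast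
qed

lemma specialize_eq_0_if_infinite:
  assumes "infinite A" "\<And>a. a \<in> A \<Longrightarrow> specialize p a = 0"
  shows "p = 0"
proof (rule poly_eqI)
  fix j
  have "poly (coeff p j) a = 0" if "a \<in> A" for a
    using assms(2)[OF that] by (metis coeff_0 coeff_specialize)
  then show "coeff p j = coeff 0 j"
    using poly_eq_0_if_infinite_roots[OF assms(1)] by simp
qed

section \<open>Elimination by pseudo-division\<close>

text \<open>A gcd over the fraction field with denominators cleared: the pseudo-remainder of an
  element of \<open>I\<close> by \<open>M\<close> lies in \<open>I\<close> and has smaller degree,
  hence is zero. In the applications \<open>I\<close> consists of polynomials vanishing on given
  points.\<close>

lemma min_degree_element:
  fixes I :: "'a :: idom poly set"
  assumes "p0 \<in> I" "p0 \<noteq> 0"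
    and ideal: "\<And>p q c r. p \<in> I \<Longrightarrow> q \<in> I \<Longrightarrow> smult c p - q * r \<in> I"
  obtains M where "M \<in> I" "M \<noteq> 0" "\<And>p. p \<in> I \<Longrightarrow> p \<noteq> 0 \<Longrightarrow> degree M \<le> degree p"
    "\<And>p. p \<in> I \<Longrightarrow> \<exists>c q. c \<noteq> 0 \<and> smult c p = M * q"
proof -
  define M where "M = (ARG_MIN degree p. p \<in> I \<and> p \<noteq> 0)"
  have M: "M \<in> I \<and> M \<noteq> 0"
    unfolding M_def by (rule arg_min_natI[of _ p0]) (use assms in auto)
  have min: "degree M \<le> degree p" if "p \<in> I" "p \<noteq> 0" for p
    unfolding M_def by (rule arg_min_nat_le) (use that in auto)
  have "\<exists>c q. c \<noteq> 0 \<and> smult c p = M * q" if p: "p \<in> I" for p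
  proof -
    obtain a q where aq: "a \<noteq> 0" "smult a p = M * q + pseudo_mod p M"
      using pseudo_mod(1)[of M p] M by blast
    then have "pseudo_mod p M = smult a p - M * q" by simp
    then have "pseudo_mod p M \<in> I" using ideal[OF p] M by auto
    then have "pseudo_mod p M = 0"
      using min[of "pseudo_mod p M"] pseudo_mod(2)[of M p] M by fastforce
    then show ?thesis using aq by auto
  qed
  then show thesis using that M min by blast
qed

text \<open>Stands in for the discriminant of a one-parameter family of polynomials.\<close>

lemma finite_degenerate_parameters:
  fixes p :: "complex poly poly"
  assumes inf: "infinite {a. poly (coeff p n) a \<noteq> 0 \<and> rsquarefree (specialize p a)}"
  shows "finite {a. \<not> (poly (coeff p n) a \<noteq> 0 \<and> rsquarefree (specialize p a))}"
proof -
  define B where "B = {a. \<not> rsquarefree (specialize p a)}"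
  have cn: "coeff p n \<noteq> 0" using inf by auto
  have "finite B"
  proof (rule ccontr)
    assume infB: "infinite B"
    \<comment> \<open>\<open>I\<close> collects the polynomials vanishing at every multiple root
      over \<open>B\<close>. It contains \<open>p\<close> and \<open>pderiv p\<close>, so the
      minimal \<open>M\<close> is a common factor of both up to factors in the parameter
      alone.\<close>
    define I where "I = {A. \<forall>a\<in>B. \<forall>z. poly (specialize p a) z = 0 \<and>
        poly (specialize (pderiv p) a) z = 0 \<longrightarrow> poly (specialize A a) z = 0}"
    have I: "p \<in> I" "pderiv p \<in> I" by (auto simp: I_def)
    obtain M where M: "M \<in> I" "M \<noteq> 0"
        "\<And>p. p \<in> I \<Longrightarrow> \<exists>c q. c \<noteq> 0 \<and> smult c p = M * q"
    proof (rule min_degree_element[of p I])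
      show "p \<noteq> 0" using cn by auto
    qed (use I in \<open>auto simp: I_def\<close>)
    obtain c q where c: "c \<noteq> 0" "smult c p = M * q" using M(3)[OF I(1)] by blast
    obtain c' q' where c': "c' \<noteq> 0" "smult c' (pderiv p) = M * q'" using M(3)[OF I(2)] by blast
    have deg: "degree M > 0"
    proof (rule ccontr)
      assume "\<not> degree M > 0"
      then obtain r where r: "M = [:r:]" using degree_eq_zeroE by blast
      have "poly r a = 0" if a: "a \<in> B" for a
      proof -
        obtain z where "poly (specialize p a) z = 0" "poly (specialize (pderiv p) a) z = 0"
          using a by (auto simp: B_def rsquarefree_roots specialize_pderiv)
        then have "poly (specialize M a) z = 0" using M(1) a by (auto simp: I_def)
        then show ?thesis by (simp add: r poly_specialize)
      qed
      then have "r = 0" using poly_eq_0_if_infinite_roots[OF infB] by blast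
      with M(2) r show False by simp
    qed
    \<comment> \<open>Away from these zeros, a root of the nonconstant specialised \<open>M\<close>
      is a common root of \<open>p\<close> and its derivative; one squarefree parameter there is a
      contradiction.\<close>
    have "finite {a. poly (c * c' * lead_coeff M) a = 0}"
      using c(1) c'(1) M(2) by (intro poly_roots_finite) auto
    then obtain a where a: "rsquarefree (specialize p a)" "poly (c * c' * lead_coeff M) a \<noteq> 0"
      using inf by (smt (verit) Collect_mono_iff finite_subset mem_Collect_eq)
    have "degree (specialize M a) > 0"
      using a(2) deg le_degree[of "specialize M a" "degree M"] by auto
    then obtain z where z: "poly (specialize M a) z = 0"
      using fundamental_theorem_of_algebra[of "specialize M a"] by (auto simp: constant_degree)
    have "poly (specialize (smult c p) a) z = 0" "poly (specialize (smult c' (pderiv p)) a) z = 0"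
      unfolding c c' by (simp_all add: z)
    then show False using a by (auto simp: rsquarefree_roots specialize_pderiv)
  qed
  moreover have "finite {a. poly (coeff p n) a = 0}" using cn by (rule poly_roots_finite)
  ultimately show ?thesis
    by (rule finite_subset[rotated, OF finite_UnI]) (auto simp: B_def)
qed

section \<open>Polynomials in three variables as functions\<close>

lemma eval3_0 [simp]: "eval3 0 v = 0"
  and eval3_1 [simp]: "eval3 1 v = 1"
  and eval3_add [simp]: "eval3 (F + G) v = eval3 F v + eval3 G v"
  and eval3_diff [simp]: "eval3 (F - G) v = eval3 F v - eval3 G v"
  and eval3_mult [simp]: "eval3 (F * G) v = eval3 F v * eval3 G v"
  and eval3_power [simp]: "eval3 (F ^ k) v = eval3 F v ^ k"
  and eval3_smult: "eval3 (smult r F) v = poly (poly r [:v $ 2:]) (v $ 1) * eval3 F v"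
  and eval3_const: "eval3 [:[:[:c:]:]:] v = c"
  and eval3_const_poly: "eval3 [:r:] v = poly (poly r [:v $ 2:]) (v $ 1)"
  by (simp_all add: eval3_def)

lemma eval3_sum [simp]: "eval3 (sum f A) v = (\<Sum>i\<in>A. eval3 (f i) v)"
  by (induction A rule: infinite_finite_induct) simp_all

lemma eval3_eq_0_imp_0:
  assumes "\<And>v. eval3 F v = 0"
  shows "F = 0"
proof (rule poly_eq_0_if_infinite_roots)
  have "inj (\<lambda>z :: complex. [:[:z:]:])" by (auto simp: inj_def)
  then show "infinite (range (\<lambda>z :: complex. [:[:z:]:]))"
    using infinite_UNIV_char_0 finite_imageD by blast
  fix z3 :: "complex poly poly" assume "z3 \<in> range (\<lambda>z. [:[:z:]:])"
  then obtain z where z: "z3 = [:[:z:]:]" by auto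
  have "specialize (poly F z3) x = 0" for x
  proof -
    have "poly (specialize (poly F z3) x) y = 0" for y
      using assms[of "vector [x, y, z]"] by (simp add: eval3_def z poly_specialize)
    then show ?thesis by (meson infinite_UNIV_char_0 poly_eq_0_if_infinite_roots)
  qed
  then show "poly F z3 = 0"
    by (metis infinite_UNIV_char_0 specialize_eq_0_if_infinite)
qed

lemma eval3_eqI:
  assumes "\<And>v. eval3 F v = eval3 G v"
  shows "F = G"
  using eval3_eq_0_imp_0[of "F - G"] assms by simp

section \<open>Linear changes of coordinates\<close>

text \<open>Fixed by its values alone: \<open>eval3_eqI\<close> makes such a polynomial unique and
  \<open>eval3_linear_subst\<close> shows that it exists. The algebraic laws then follow by
  evaluation.\<close>

definition linear_subst :: "complex ^ 3 ^ 3 \<Rightarrow> poly3 \<Rightarrow> poly3" where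
  "linear_subst M F = (SOME F'. \<forall>v. eval3 F' v = eval3 F (M *v v))"

lemma eval3_linear_subst: "eval3 (linear_subst M F) v = eval3 F (M *v v)"
proof -
  define X where "X i = [:[:[:0, M $ i $ 1:]:]:] + [:[:0, [:M $ i $ 2:]:]:] + [:0, [:[:M $ i $ 3:]:]:]" for i
  have X: "eval3 (X i) v = (M *v v) $ i" for i v
    by (simp add: X_def eval3_def matrix_vector_mult_def sum_3 algebra_simps)
  define F' where "F' = (\<Sum>k\<le>degree F. \<Sum>j\<le>degree (coeff F k). \<Sum>i\<le>degree (coeff (coeff F k) j).
     [:[:[:coeff (coeff (coeff F k) j) i:]:]:] * X 1 ^ i * X 2 ^ j * X 3 ^ k)"
  have "eval3 F' v = eval3 F (M *v v)" for v
    unfolding F'_def eval3_sum eval3_mult eval3_power X eval3_const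
    by (simp add: eval3_altdef)
  then have "\<exists>F'. \<forall>v. eval3 F' v = eval3 F (M *v v)" by blast
  from someI_ex[OF this] show ?thesis unfolding linear_subst_def by blast
qed

lemma linear_subst_mult: "linear_subst M (F * G) = linear_subst M F * linear_subst M G"
  by (rule eval3_eqI) (simp add: eval3_linear_subst)

lemma linear_subst_linear_subst: "linear_subst N (linear_subst M F) = linear_subst (M ** N) F"
  by (rule eval3_eqI) (simp add: eval3_linear_subst matrix_vector_mul_assoc)

lemma linear_subst_id: "linear_subst (mat 1) F = F"
  by (rule eval3_eqI) (simp add: eval3_linear_subst)

lemma linear_subst_1 [simp]: "linear_subst M 1 = 1"
  by (rule eval3_eqI) (simp add: eval3_linear_subst)

lemma linear_subst_dvd: "F dvd G \<Longrightarrow> linear_subst M F dvd linear_subst M G"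
  by (auto simp: linear_subst_mult elim!: dvdE)

text \<open>The inverse matrix gives the inverse substitution, so the substitution is a ring
  automorphism and preserves units.\<close>

lemma irreducible_linear_subst:
  assumes "invertible M" "irreducible G"
  shows "irreducible (linear_subst M G)"
proof -
  obtain N where N: "M ** N = mat 1" "N ** M = mat 1"
    using assms(1) by (auto simp: invertible_def)
  have NM: "linear_subst N (linear_subst M F) = F" "linear_subst M (linear_subst N F) = F" for F
    by (simp_all add: linear_subst_linear_subst N linear_subst_id)
  have unit: "is_unit (linear_subst N F) \<longleftrightarrow> is_unit F" for F
    using linear_subst_dvd[of F 1 N] linear_subst_dvd[of "linear_subst N F" 1 M] NM by auto
  show ?thesis
  proof (rule irreducibleI)
    show "linear_subst M G \<noteq> 0"
      using assms(2) NM(1)[of G] linear_subst_mult[of N 0 0] by (auto simp: irreducible_def)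
    show "\<not> is_unit (linear_subst M G)"
      using unit[of "linear_subst M G"] assms(2) by (simp add: NM irreducible_not_unit)
    fix a b assume "linear_subst M G = a * b"
    then have "G = linear_subst N a * linear_subst N b"
      using NM(1)[of G] by (simp add: linear_subst_mult)
    then show "is_unit a \<or> is_unit b"
      using assms(2) unit by (metis irreducibleD)
  qed
qed

section \<open>Restriction to a parametrised line\<close>

text \<open>Pull-back of \<open>F\<close> along the parametrisation \<open>u + s *s w\<close>. The
  explicit sum makes it visible that the coefficients are continuous and holomorphic in
  \<open>u\<close> and \<open>w\<close>.\<close>

definition restrict_line :: "poly3 \<Rightarrow> complex ^ 3 \<Rightarrow> complex ^ 3 \<Rightarrow> complex poly" where
  "restrict_line F u w = (\<Sum>k\<le>degree F. \<Sum>j\<le>degree (coeff F k). \<Sum>i\<le>degree (coeff (coeff F k) j).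
     smult (coeff (coeff (coeff F k) j) i) ([:u $ 1, w $ 1:] ^ i * [:u $ 2, w $ 2:] ^ j * [:u $ 3, w $ 3:] ^ k))"

lemma poly_restrict_line [simp]: "poly (restrict_line F u w) s = eval3 F (u + s *s w)"
  unfolding restrict_line_def eval3_altdef poly_sum by (simp add: algebra_simps)

lemma restrict_line_mult: "restrict_line (F * G) u w = restrict_line F u w * restrict_line G u w"
  by (simp add: poly_eq_poly_eq_iff[symmetric] fun_eq_iff)

lemma coeff_mult_top:
  fixes p q :: "'a :: comm_semiring_0 poly"
  assumes "degree p \<le> m" "degree q \<le> n"
  shows "coeff (p * q) (m + n) = coeff p m * coeff q n"
proof (cases "degree p = m \<and> degree q = n")
  case True
  then show ?thesis using coeff_mult_degree_sum[of p q] by auto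
next
  case False
  then have less: "degree p < m \<or> degree q < n" using assms by auto
  then have "degree (p * q) < m + n" using degree_mult_le[of p q] assms by linarith
  then show ?thesis using less by (auto simp: coeff_eq_0)
qed

lemma degree_mult_le_add:
  fixes p q :: "'a :: comm_semiring_0 poly"
  assumes "degree p \<le> m" "degree q \<le> n"
  shows "degree (p * q) \<le> m + n"
  using degree_mult_le[of p q] assms by linarith

lemma degree_linear_power: "degree ([:a, b:] ^ k) \<le> k" for a b :: complex
  using degree_power_le[of "[:a, b:]" k] by (simp split: if_splits)

lemma top_coeff_linear_power: "coeff ([:a, b:] ^ k) k = b ^ k" for a b :: complex
proof (induction k)
  case (Suc k)
  have "degree [:a, b:] \<le> 1" by simp
  from coeff_mult_top[OF this degree_linear_power[of a b k]] Suc show ?case by simp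
qed simp

text \<open>In a monomial of degree \<open>n\<close> each factor is linear in the parameter, so the
  top coefficient arises by replacing every factor by its slope. Geometrically, \<open>w\<close> is
  the point at infinity of the parametrised line; if the curve misses it, the degree is exactly
  \<open>n\<close>.\<close>

lemma restrict_line_top:
  assumes "homogeneous n F"
  shows "degree (restrict_line F u w) \<le> n" "coeff (restrict_line F u w) n = eval3 F w"
proof -
  have *: "degree ([:u $ 1, w $ 1:] ^ i * [:u $ 2, w $ 2:] ^ j * [:u $ 3, w $ 3:] ^ k) \<le> i + j + k \<and>
    coeff ([:u $ 1, w $ 1:] ^ i * [:u $ 2, w $ 2:] ^ j * [:u $ 3, w $ 3:] ^ k) (i + j + k) =
      w $ 1 ^ i * w $ 2 ^ j * w $ 3 ^ k" for i j k
  proof -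
    note d = degree_linear_power degree_mult_le_add[OF degree_linear_power degree_linear_power]
    show ?thesis
      using degree_mult_le_add[OF d(2,1), of "u $ 1" "w $ 1" i "u $ 2" "w $ 2" j "u $ 3" "w $ 3" k]
        coeff_mult_top[OF d(2,1), of "u $ 1" "w $ 1" i "u $ 2" "w $ 2" j "u $ 3" "w $ 3" k]
        coeff_mult_top[OF d(1,1), of "u $ 1" "w $ 1" i "u $ 2" "w $ 2" j]
      by (simp only: top_coeff_linear_power)
  qed
  show "degree (restrict_line F u w) \<le> n"
    unfolding restrict_line_def
  proof (intro degree_sum_le)
    fix k j i
    show "degree (smult (coeff (coeff (coeff F k) j) i)
       ([:u $ 1, w $ 1:] ^ i * [:u $ 2, w $ 2:] ^ j * [:u $ 3, w $ 3:] ^ k)) \<le> n"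
      using assms *[of i j k] by (cases "coeff (coeff (coeff F k) j) i = 0") (auto simp: homogeneous_def)
  qed auto
  show "coeff (restrict_line F u w) n = eval3 F w"
    unfolding restrict_line_def eval3_altdef coeff_sum
  proof (intro sum.cong refl)
    fix k j i
    show "coeff (smult (coeff (coeff (coeff F k) j) i)
       ([:u $ 1, w $ 1:] ^ i * [:u $ 2, w $ 2:] ^ j * [:u $ 3, w $ 3:] ^ k)) n =
       coeff (coeff (coeff F k) j) i * w $ 1 ^ i * w $ 2 ^ j * w $ 3 ^ k"
      using assms *[of i j k] by (cases "coeff (coeff (coeff F k) j) i = 0") (auto simp: homogeneous_def)
  qed
qed

lemma continuous_on_coeff_mult:
  fixes P Q :: "'x :: topological_space \<Rightarrow> complex poly"
  assumes "\<And>j. continuous_on S (\<lambda>x. coeff (P x) j)" "\<And>j. continuous_on S (\<lambda>x. coeff (Q x) j)"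
  shows "continuous_on S (\<lambda>x. coeff (P x * Q x) j)"
  unfolding coeff_mult by (intro continuous_intros assms)

lemma continuous_on_coeff_power:
  fixes P :: "'x :: topological_space \<Rightarrow> complex poly"
  assumes "\<And>j. continuous_on S (\<lambda>x. coeff (P x) j)"
  shows "continuous_on S (\<lambda>x. coeff (P x ^ k) j)"
proof (induction k arbitrary: j)
  case (Suc k)
  then show ?case using continuous_on_coeff_mult[OF assms, of "\<lambda>x. P x ^ k"] by simp
qed simp

lemma continuous_on_coeff_restrict_line:
  fixes u w :: "'x :: topological_space \<Rightarrow> complex ^ 3"
  assumes "continuous_on S u" "continuous_on S w"
  shows "continuous_on S (\<lambda>x. coeff (restrict_line F (u x) (w x)) j)"
proof -
  have lin: "continuous_on S (\<lambda>x. coeff [:u x $ i, w x $ i:] j)" for i j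
  proof -
    have "coeff [:a, b:] j = (if j = 0 then a else if j = 1 then b else 0)" for a b :: complex
      by (auto simp: coeff_pCons split: nat.splits)
    then show ?thesis
      using continuous_on_component[OF assms(1)] continuous_on_component[OF assms(2)]
      by (cases "j = 0"; cases "j = 1") simp_all
  qed
  show ?thesis
    unfolding restrict_line_def coeff_sum coeff_smult
    by (intro continuous_intros continuous_on_coeff_mult continuous_on_coeff_power lin)
qed

lemma holomorphic_on_coeff_mult:
  fixes P Q :: "complex \<Rightarrow> complex poly"
  assumes "\<And>j. (\<lambda>x. coeff (P x) j) holomorphic_on S" "\<And>j. (\<lambda>x. coeff (Q x) j) holomorphic_on S"
  shows "(\<lambda>x. coeff (P x * Q x) j) holomorphic_on S"
  unfolding coeff_mult by (intro holomorphic_intros assms)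

lemma holomorphic_on_coeff_power:
  fixes P :: "complex \<Rightarrow> complex poly"
  assumes "\<And>j. (\<lambda>x. coeff (P x) j) holomorphic_on S"
  shows "(\<lambda>x. coeff (P x ^ k) j) holomorphic_on S"
proof (induction k arbitrary: j)
  case (Suc k)
  then show ?case using holomorphic_on_coeff_mult[OF assms, of "\<lambda>x. P x ^ k"] by simp
qed simp

lemma holomorphic_on_coeff_restrict_line:
  fixes u w :: "complex \<Rightarrow> complex ^ 3"
  assumes "\<And>i. (\<lambda>x. u x $ i) holomorphic_on S" "\<And>i. (\<lambda>x. w x $ i) holomorphic_on S"
  shows "(\<lambda>x. coeff (restrict_line F (u x) (w x)) j) holomorphic_on S"
proof -
  have lin: "(\<lambda>x. coeff [:u x $ i, w x $ i:] j) holomorphic_on S" for i j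
  proof -
    have "coeff [:a, b:] j = (if j = 0 then a else if j = 1 then b else 0)" for a b :: complex
      by (auto simp: coeff_pCons split: nat.splits)
    then show ?thesis using assms by (cases "j = 0"; cases "j = 1") simp_all
  qed
  show ?thesis
    unfolding restrict_line_def coeff_sum coeff_smult
    by (intro holomorphic_intros holomorphic_on_coeff_mult holomorphic_on_coeff_power lin)
qed

text \<open>Turns a pencil of lines into an algebraic family, so that
  \<open>finite_degenerate_parameters\<close> applies to it.\<close>

lemma pencil_polynomial:
  assumes "homogeneous n F"
  obtains p :: "complex poly poly" where
    "degree p \<le> n" "\<And>a. specialize p a = restrict_line F (u + a *s u') (w + a *s w')"
proof -
  define X where "X i = [:[:u $ i, u' $ i:], [:w $ i, w' $ i:]:]" for i
  define p where "p = (\<Sum>k\<le>degree F. \<Sum>j\<le>degree (coeff F k). \<Sum>i\<le>degree (coeff (coeff F k) j).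
     [:[:coeff (coeff (coeff F k) j) i:]:] * X 1 ^ i * X 2 ^ j * X 3 ^ k)"
  have "poly (specialize p a) s = eval3 F (u + a *s u' + s *s (w + a *s w'))" for a s
    unfolding p_def poly_specialize poly_sum eval3_altdef X_def by (simp add: algebra_simps)
  then have p: "specialize p a = restrict_line F (u + a *s u') (w + a *s w')" for a
    by (simp add: poly_eq_poly_eq_iff[symmetric] fun_eq_iff)
  have "degree p \<le> n"
  proof (rule degree_le, intro allI impI)
    fix j assume "n < j"
    then have "poly (coeff p j) a = 0" for a
      using restrict_line_top(1)[OF assms, of "u + a *s u'" "w + a *s w'"] p[of a]
      by (metis coeff_specialize coeff_eq_0 le_less_trans)
    then show "coeff p j = 0" using poly_all_0_iff_0 by blast
  qed
  with p show thesis using that by blast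
qed

section \<open>Irreducibility as minimality of degree\<close>

text \<open>A prime \<open>G\<close> must divide the minimal polynomial that vanishes on infinitely
  many of its points. The pairs \<open>(a, z)\<close> are points in the chart where the first
  coordinate is 1; the cone over them allows working in \<open>poly3\<close>, where \<open>G\<close>
  is prime. Degrees are those in the outermost variable.\<close>

lemma degree_le_if_vanishing_on_cone:
  fixes G :: poly3 and A :: "complex poly poly"
  assumes irr: "irreducible G" and inf: "infinite (fst ` Z)"
    and G: "\<And>a z c. (a, z) \<in> Z \<Longrightarrow> eval3 G (vector [c, c * a, c * z]) = 0"
    and A: "A \<noteq> 0" "\<And>a z. (a, z) \<in> Z \<Longrightarrow> poly (specialize A a) z = 0"
  shows "degree G \<le> degree A"
proof -
  \<comment> \<open>\<open>L\<close> bounds the total degree of \<open>A\<close>, and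
    \<open>H\<close> is the homogenisation of \<open>A\<close> to degree \<open>L\<close>.\<close>
  define L where "L = degree A + (\<Sum>j\<le>degree A. degree (coeff A j))"
  have L: "i + j \<le> L" if "j \<le> degree A" "i \<le> degree (coeff A j)" for i j
    using that member_le_sum[of j "{..degree A}" "\<lambda>j. degree (coeff A j)"] by (auto simp: L_def)
  define H :: poly3 where "H = (\<Sum>j\<le>degree A. \<Sum>i\<le>degree (coeff A j).
      monom (monom (monom (coeff (coeff A j) i) (L - (i + j))) i) j)"
  have "degree H \<le> degree A"
    unfolding H_def by (intro degree_sum_le) (auto intro: order_trans[OF degree_monom_le])
  have H: "eval3 H (vector [c, c * a, c * z]) = c ^ L * poly (specialize A a) z" for a z c
  proof -
    have "eval3 (monom (monom (monom b (L - (i + j))) i) j) (vector [c, c * a, c * z]) =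
        c ^ L * (b * a ^ i * z ^ j)" if "i + j \<le> L" for i j b
    proof -
      have "c ^ L = c ^ (L - (i + j)) * c ^ i * c ^ j"
        using that by (simp add: power_add[symmetric])
      then show ?thesis
        by (simp add: eval3_def poly_monom power_mult_distrib algebra_simps)
    qed
    then have "eval3 H (vector [c, c * a, c * z]) =
       (\<Sum>j\<le>degree A. \<Sum>i\<le>degree (coeff A j). c ^ L * (coeff (coeff A j) i * a ^ i * z ^ j))"
      unfolding H_def eval3_sum using L by (intro sum.cong refl) auto
    also have "\<dots> = c ^ L * poly (poly A [:z:]) a"
      by (subst poly_altdef[of A])
         (simp add: poly_sum poly_altdef[of "coeff _ _"] sum_distrib_left sum_distrib_right mult.assoc)
    finally show ?thesis by (simp add: poly_specialize)
  qed
  have "H \<noteq> 0"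
  proof
    assume "H = 0"
    then have "poly (specialize A a) z = 0" for a z using H[of 1 a z] by simp
    then have "specialize A a = 0" for a by (metis poly_all_0_iff_0)
    then show False using A(1) specialize_eq_0_if_infinite infinite_UNIV_char_0 by metis
  qed
  define I where "I = {B. \<forall>(a, z)\<in>Z. \<forall>c. eval3 B (vector [c, c * a, c * z]) = 0}"
  have "H \<in> I" using A(2) by (auto simp: I_def H)
  obtain M where M: "M \<in> I" "M \<noteq> 0" "\<And>p. p \<in> I \<Longrightarrow> p \<noteq> 0 \<Longrightarrow> degree M \<le> degree p"
      "\<And>p. p \<in> I \<Longrightarrow> \<exists>c q. c \<noteq> 0 \<and> smult c p = M * q"
  proof (rule min_degree_element[OF \<open>H \<in> I\<close> \<open>H \<noteq> 0\<close>])
    show "smult c p - q * r \<in> I" if "p \<in> I" "q \<in> I" for p q r :: poly3 and c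
      using that by (force simp: I_def eval3_smult)
  qed blast
  \<comment> \<open>A polynomial free of the last variable would vanish at \<open>(c, c * a)\<close>
    for every nonzero \<open>c\<close> and infinitely many \<open>a\<close>, hence
    identically.\<close>
  have deg: "degree M > 0"
  proof (rule ccontr)
    assume "\<not> degree M > 0"
    then obtain r where r: "M = [:r:]" using degree_eq_zeroE by blast
    have "specialize r c = 0" if c: "c \<noteq> 0" for c
    proof (rule poly_eq_0_if_infinite_roots)
      show "infinite ((*) c ` fst ` Z)"
        using inf c by (subst finite_image_iff) (auto simp: inj_on_def)
      fix y assume "y \<in> (*) c ` fst ` Z"
      then obtain a z where az: "(a, z) \<in> Z" "y = c * a" by auto
      with M(1) have "eval3 M (vector [c, c * a, c * z]) = 0" by (auto simp: I_def)
      then show "poly (specialize r c) y = 0"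
        by (simp add: r eval3_const_poly poly_specialize az)
    qed
    moreover have "infinite (UNIV - {0 :: complex})" by (simp add: infinite_UNIV_char_0)
    ultimately have "r = 0" by (intro specialize_eq_0_if_infinite[of "UNIV - {0}"]) auto
    with M(2) r show False by simp
  qed
  have "G \<in> I" using G by (auto simp: I_def)
  then obtain c q where c: "c \<noteq> 0" "smult c G = M * q" using M(4) by blast
  have "prime_elem G" using irr by (rule irreducible_imp_prime_elem)
  moreover have "G dvd M * q" using c(2) dvd_smult[of G G c] by simp
  ultimately have "G dvd M \<or> G dvd q" using prime_elem_dvd_multD by blast
  then have "G dvd M"
  proof
    \<comment> \<open>Cancelling \<open>G\<close> leaves \<open>M\<close> as a factor of the nonzero
      constant \<open>[:c:]\<close>, against its positive degree.\<close>
    assume "G dvd q"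
    then obtain q' where q': "q = G * q'" by (elim dvdE)
    have "G * [:c:] = G * (M * q')" using c(2) q' by (simp add: algebra_simps)
    then have e: "M * q' = [:c:]"
      using mult_left_cancel[of G "[:c:]" "M * q'"] \<open>prime_elem G\<close>[unfolded prime_elem_def] by metis
    then have "q' \<noteq> 0" using c(1) by auto
    then have "degree (M * q') = degree M + degree q'" using M(2) by (simp add: degree_mult_eq)
    with e deg show ?thesis by simp
  qed
  then have "degree G \<le> degree M" using M(2) dvd_imp_degree_le by blast
  also have "\<dots> \<le> degree A"
    using M(3)[OF \<open>H \<in> I\<close> \<open>H \<noteq> 0\<close>] \<open>degree H \<le> degree A\<close> by simp
  finally show ?thesis .
qed

section \<open>Continuity of roots\<close>

abbreviation roots :: "complex poly \<Rightarrow> complex set" where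
  "roots p \<equiv> {z. poly p z = 0}"

text \<open>Each linear factor has norm at least \<open>e\<close> at \<zeta>. Used in the
  contrapositive: a small value forces a nearby root.\<close>

lemma poly_ge_if_roots_far:
  fixes p :: "complex poly"
  assumes "\<And>z. poly p z = 0 \<Longrightarrow> e \<le> dist \<zeta> z" "e \<ge> 0" "p \<noteq> 0"
  shows "norm (lead_coeff p) * e ^ degree p \<le> norm (poly p \<zeta>)"
proof -
  obtain root where root: "smult (lead_coeff p) (\<Prod>i<degree p. [:- root i, 1:]) = p"
    by (rule complex_poly_decompose')
  have poly: "poly p z = lead_coeff p * (\<Prod>i<degree p. z - root i)" for z
    by (subst root[symmetric]) (simp add: poly_prod)
  have "e \<le> norm (\<zeta> - root i)" if "i < degree p" for i
  proof -
    have "poly p (root i) = 0" unfolding poly using that by auto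
    then show ?thesis using assms(1) by (simp add: dist_norm)
  qed
  then have "(\<Prod>i<degree p. e) \<le> (\<Prod>i<degree p. norm (\<zeta> - root i))"
    using assms(2) by (intro prod_mono) auto
  then show ?thesis
    unfolding poly[of \<zeta>] norm_mult prod_norm[symmetric] by (intro mult_left_mono) auto
qed

lemma degree_eq_sum_order:
  fixes p :: "complex poly"
  assumes "p \<noteq> 0"
  shows "degree p = (\<Sum>z\<in>roots p. order z p)"
proof -
  have "degree p = degree (\<Prod>z\<in>roots p. [:- z, 1:] ^ order z p)"
    using complex_poly_decompose[of p] assms by (metis degree_smult_eq leading_coeff_0_iff)
  also have "\<dots> = (\<Sum>z\<in>roots p. order z p)"
    by (subst degree_prod_eq_sum_degree) (auto simp: degree_power_eq)
  finally show ?thesis .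
qed

lemma card_roots_rsquarefree:
  fixes p :: "complex poly"
  assumes "rsquarefree p"
  shows "card (roots p) = degree p"
proof -
  have "p \<noteq> 0" using assms by (simp add: rsquarefree_def)
  then have "order z p = 1" if "z \<in> roots p" for z
    using rsquarefree_root_order assms that by blast
  then show ?thesis using degree_eq_sum_order[OF \<open>p \<noteq> 0\<close>] by simp
qed

lemma rsquarefree_if_card:
  fixes p :: "complex poly"
  assumes "p \<noteq> 0" "degree p \<le> card (roots p)"
  shows "rsquarefree p"
proof -
  have fin: "finite (roots p)" using assms(1) by (rule poly_roots_finite)
  have ge: "1 \<le> order z p" if "z \<in> roots p" for z
    using that assms(1) by (simp add: order_root Suc_le_eq)
  have "order z p = 1" if z: "z \<in> roots p" for z
  proof (rule ccontr)
    assume "order z p \<noteq> 1"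
    then have "(\<Sum>z\<in>roots p. 1) < (\<Sum>z\<in>roots p. order z p)"
      using fin ge z by (intro sum_strict_mono_ex1) (force simp: le_less)+
    then show False using degree_eq_sum_order[OF assms(1)] assms(2) by simp
  qed
  moreover have "order z p = 0" if "z \<notin> roots p" for z
    using that order_root by blast
  ultimately show ?thesis using assms(1) unfolding rsquarefree_def by blast
qed

text \<open>Known distinct roots in the number of the degree leave no room for further roots or
  multiplicities.\<close>

lemma roots_eq_image_if_inj:
  fixes p :: "complex poly"
  assumes "p \<noteq> 0" "degree p \<le> card R" "inj_on f R" "finite R" "f ` R \<subseteq> roots p"
  shows "roots p = f ` R" "rsquarefree p" "degree p = card R"
proof -
  have fin: "finite (roots p)" using assms(1) by (rule poly_roots_finite)
  have "card (roots p) \<le> degree p"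
    using assms(1) by (rule card_poly_roots_bound)
  then show *: "roots p = f ` R"
    using card_subset_eq[OF fin assms(5)] card_mono[OF fin assms(5)] assms(2,3)
    by (simp add: card_image)
  then have "card (roots p) = card R" using assms(3) by (simp add: card_image)
  then show "rsquarefree p" "degree p = card R"
    using assms(1,2) rsquarefree_if_card[OF assms(1)] card_roots_rsquarefree[of p] by auto
qed

lemma tendsto_poly_coeffs:
  fixes P :: "'x \<Rightarrow> complex poly"
  assumes "\<And>j. ((\<lambda>x. coeff (P x) j) \<longlongrightarrow> coeff p j) F"
    and "eventually (\<lambda>x. degree (P x) \<le> n) F" "degree p \<le> n" "(z \<longlongrightarrow> \<zeta>) F"
  shows "((\<lambda>x. poly (P x) (z x)) \<longlongrightarrow> poly p \<zeta>) F"
proof -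
  have eq: "poly q x = (\<Sum>j\<le>n. coeff q j * x ^ j)" if "degree q \<le> n" for q :: "complex poly" and x
    unfolding poly_altdef using that
    by (intro sum.mono_neutral_left) (auto simp: coeff_eq_0)
  have "((\<lambda>x. \<Sum>j\<le>n. coeff (P x) j * z x ^ j) \<longlongrightarrow> (\<Sum>j\<le>n. coeff p j * \<zeta> ^ j)) F"
    by (intro tendsto_intros assms)
  moreover have "eventually (\<lambda>x. (\<Sum>j\<le>n. coeff (P x) j * z x ^ j) = poly (P x) (z x)) F"
    using assms(2) by eventually_elim (simp add: eq)
  ultimately show ?thesis
    using eq[OF assms(3)] by (simp add: filterlim_cong)
qed

text \<open>At the limit the value at \<zeta> is 0, hence below the bound of
  \<open>poly_ge_if_roots_far\<close>; this strict inequality persists nearby and forces a root in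
  the ball.\<close>

lemma eventually_root_near:
  fixes P :: "'x \<Rightarrow> complex poly"
  assumes "\<And>j. ((\<lambda>x. coeff (P x) j) \<longlongrightarrow> coeff p j) F"
    and "eventually (\<lambda>x. degree (P x) \<le> n) F" "degree p = n" "p \<noteq> 0"
    and "poly p \<zeta> = 0" "e > 0"
  shows "eventually (\<lambda>x. coeff (P x) n \<noteq> 0 \<and> (\<exists>z. poly (P x) z = 0 \<and> dist \<zeta> z < e)) F"
proof -
  have "((\<lambda>x. norm (coeff (P x) n) * e ^ n - norm (poly (P x) \<zeta>)) \<longlongrightarrow>
      norm (coeff p n) * e ^ n - norm (poly p \<zeta>)) F"
    by (intro tendsto_intros assms tendsto_poly_coeffs[where n = n]) (use assms in auto)
  moreover have "norm (coeff p n) * e ^ n - norm (poly p \<zeta>) > 0"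
    using assms by auto
  ultimately have 1: "eventually (\<lambda>x. norm (coeff (P x) n) * e ^ n - norm (poly (P x) \<zeta>) > 0) F"
    by (rule order_tendstoD)
  have 2: "eventually (\<lambda>x. coeff (P x) n \<noteq> 0) F"
    using assms(1)[of n] assms(3,4) by (intro tendsto_imp_eventually_ne) auto
  from 1 2 assms(2) show ?thesis
  proof eventually_elim
    case (elim x)
    then have deg: "degree (P x) = n" using le_degree[of "P x" n] by linarith
    have "\<exists>z. poly (P x) z = 0 \<and> dist \<zeta> z < e"
    proof (rule ccontr)
      assume "\<not> ?thesis"
      then have "norm (lead_coeff (P x)) * e ^ degree (P x) \<le> norm (poly (P x) \<zeta>)"
        using elim(2) assms(6) by (intro poly_ge_if_roots_far) (force simp: not_less)+
      then show False using elim(1) deg by simp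
    qed
    then show ?case using elim(2) by blast
  qed
qed

lemma separating_radius:
  fixes R :: "complex set"
  assumes "finite R"
  obtains e where "e > 0" "\<And>x y z. x \<in> R \<Longrightarrow> y \<in> R \<Longrightarrow> dist x z < e \<Longrightarrow> dist y z < e \<Longrightarrow> x = y"
proof -
  define D where "D = insert 1 ((\<lambda>(x, y). dist x y) ` {(x, y) \<in> R \<times> R. x \<noteq> y})"
  have "finite {(x, y) \<in> R \<times> R. x \<noteq> y}"
    using assms by (auto intro: finite_subset[of _ "R \<times> R"])
  then have D: "finite D" "D \<noteq> {}" by (auto simp: D_def)
  have "Min D > 0" using Min_in[OF D] by (auto simp: D_def)
  moreover have "x = y" if "x \<in> R" "y \<in> R" "dist x z < Min D / 2" "dist y z < Min D / 2" for x y z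
  proof (rule ccontr)
    assume "x \<noteq> y"
    then have "dist x y \<in> D" using that by (auto simp: D_def)
    then have "Min D \<le> dist x y" using D by simp
    then show False using dist_triangle2[of x y z] that by linarith
  qed
  ultimately show thesis using that[of "Min D / 2"] by auto
qed

text \<open>Every ball around a root captures a root of a nearby polynomial, and there is no room for
  further ones.\<close>

lemma eventually_roots_near:
  fixes P :: "'x \<Rightarrow> complex poly"
  assumes lim: "\<And>j. ((\<lambda>x. coeff (P x) j) \<longlongrightarrow> coeff p j) F"
    and deg: "eventually (\<lambda>x. degree (P x) \<le> n) F" "degree p = n" "rsquarefree p"
    and e: "e > 0" "\<And>x y z. x \<in> roots p \<Longrightarrow> y \<in> roots p \<Longrightarrow> dist x z < e \<Longrightarrow> dist y z < e \<Longrightarrow> x = y"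
  shows "eventually (\<lambda>x. degree (P x) = n \<and> rsquarefree (P x) \<and>
    (\<exists>f. inj_on f (roots p) \<and> roots (P x) = f ` roots p \<and>
      (\<forall>\<zeta>\<in>roots p. \<forall>z\<in>roots (P x). dist \<zeta> z < e \<longleftrightarrow> z = f \<zeta>))) F"
proof -
  have p0: "p \<noteq> 0" using deg(3) by (simp add: rsquarefree_def)
  then have fin: "finite (roots p)" by (rule poly_roots_finite)
  have card: "card (roots p) = n" using card_roots_rsquarefree deg by blast
  have "eventually (\<lambda>x. \<forall>\<zeta>\<in>roots p. \<exists>z. poly (P x) z = 0 \<and> dist \<zeta> z < e) F"
  proof (rule eventually_ball_finite[OF fin], rule ballI)
    fix \<zeta> assume "\<zeta> \<in> roots p"
    then have "poly p \<zeta> = 0" by simp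
    show "eventually (\<lambda>x. \<exists>z. poly (P x) z = 0 \<and> dist \<zeta> z < e) F"
      by (rule eventually_mono[OF eventually_root_near[OF lim deg(1,2) p0 \<open>poly p \<zeta> = 0\<close> e(1)]]) simp
  qed
  moreover have "eventually (\<lambda>x. coeff (P x) n \<noteq> 0) F"
    using lim[of n] p0 deg(2) by (intro tendsto_imp_eventually_ne) auto
  ultimately show ?thesis using deg(1)
  proof eventually_elim
    case (elim x)
    then have "\<exists>f. \<forall>\<zeta>\<in>roots p. poly (P x) (f \<zeta>) = 0 \<and> dist \<zeta> (f \<zeta>) < e"
      by (intro bchoice) auto
    then obtain f where f: "\<And>\<zeta>. \<zeta> \<in> roots p \<Longrightarrow> poly (P x) (f \<zeta>) = 0 \<and> dist \<zeta> (f \<zeta>) < e"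
      by blast
    have inj: "inj_on f (roots p)"
      using f e(2) by (intro inj_onI) metis
    have 1: "roots (P x) = f ` roots p" "rsquarefree (P x)" "degree (P x) = n"
    proof -
      have "P x \<noteq> 0" "degree (P x) \<le> card (roots p)" using elim card by auto
      moreover have "f ` roots p \<subseteq> roots (P x)" using f by blast
      moreover have "degree (P x) = n" using elim le_degree[of "P x" n] by linarith
      ultimately show "roots (P x) = f ` roots p" "rsquarefree (P x)" "degree (P x) = n"
        using roots_eq_image_if_inj(1,2)[OF _ _ inj fin] by blast+
    qed
    have "dist \<zeta> z < e \<longleftrightarrow> z = f \<zeta>" if z: "\<zeta> \<in> roots p" "z \<in> roots (P x)" for \<zeta> z
    proof
      assume "dist \<zeta> z < e"
      moreover obtain \<zeta>' where "\<zeta>' \<in> roots p" "z = f \<zeta>'" using 1(1) z by blast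
      ultimately show "z = f \<zeta>" using e(2) f z(1) by metis
    qed (use f z in auto)
    with 1 inj show ?case by blast
  qed
qed

text \<open>The branch belonging to \<zeta> picks the only root within a separating radius
  \<open>e\<close> of \<zeta>.\<close>

lemma local_root_sections:
  fixes P :: "'x :: topological_space \<Rightarrow> complex poly"
  assumes cont: "\<And>j. continuous_on S (\<lambda>x. coeff (P x) j)"
    and deg: "\<And>x. x \<in> S \<Longrightarrow> degree (P x) = n" "\<And>x. x \<in> S \<Longrightarrow> rsquarefree (P x)"
    and x0: "x0 \<in> S"
  obtains U r where "open U" "x0 \<in> U"
    "\<And>\<zeta>. \<zeta> \<in> roots (P x0) \<Longrightarrow> continuous_on (S \<inter> U) (r \<zeta>)"
    "\<And>\<zeta>. \<zeta> \<in> roots (P x0) \<Longrightarrow> r \<zeta> x0 = \<zeta>"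
    "\<And>x. x \<in> S \<inter> U \<Longrightarrow> roots (P x) = (\<lambda>\<zeta>. r \<zeta> x) ` roots (P x0)"
    "\<And>x. x \<in> S \<inter> U \<Longrightarrow> inj_on (\<lambda>\<zeta>. r \<zeta> x) (roots (P x0))"
proof -
  define p where "p = P x0"
  have nz: "P x \<noteq> 0" if "x \<in> S" for x using deg(2)[OF that] by (simp add: rsquarefree_def)
  have "finite (roots p)" unfolding p_def using nz[OF x0] by (rule poly_roots_finite)
  then obtain e where e: "e > 0" "\<And>x y z. x \<in> roots p \<Longrightarrow> y \<in> roots p \<Longrightarrow> dist x z < e \<Longrightarrow> dist y z < e \<Longrightarrow> x = y"
    using separating_radius by metis
  have lim: "((\<lambda>x. coeff (P x) j) \<longlongrightarrow> coeff (P x1) j) (at x1 within S)" if "x1 \<in> S" for x1 j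
    using cont that by (auto simp: continuous_on_def)
  have degev: "eventually (\<lambda>x. degree (P x) \<le> n) (at x1 within S)" for x1
    using deg(1) by (auto simp: eventually_at_filter)
  define Q where "Q x f \<longleftrightarrow> inj_on f (roots p) \<and> roots (P x) = f ` roots p \<and>
      (\<forall>\<zeta>\<in>roots p. \<forall>z\<in>roots (P x). dist \<zeta> z < e \<longleftrightarrow> z = f \<zeta>)" for x f
  have "eventually (\<lambda>x. \<exists>f. Q x f) (at x0 within S)"
    using eventually_mono[OF eventually_roots_near[of P p "at x0 within S" n e, OF _ degev]]
      lim[OF x0] deg[OF x0] e
    unfolding Q_def p_def by (smt (verit))
  then obtain U where U: "open U" "x0 \<in> U" "\<And>x. x \<in> U \<Longrightarrow> x \<noteq> x0 \<Longrightarrow> x \<in> S \<Longrightarrow> \<exists>f. Q x f"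
    by (auto simp: eventually_at_topological)
  have Q0: "Q x0 (\<lambda>\<zeta>. \<zeta>)"
  proof -
    have "dist \<zeta> z < e \<longleftrightarrow> z = \<zeta>" if "\<zeta> \<in> roots p" "z \<in> roots p" for \<zeta> z
      using e(2)[of \<zeta> z z] that e(1) by fastforce
    then show ?thesis unfolding Q_def p_def by simp
  qed
  define r where "r \<zeta> x = (THE z. z \<in> roots (P x) \<and> dist \<zeta> z < e)" for \<zeta> x
  have rf: "r \<zeta> x = f \<zeta>" if "Q x f" "\<zeta> \<in> roots p" for x f \<zeta>
    unfolding r_def using that by (intro the_equality) (auto simp: Q_def)
  have ex: "\<exists>f. Q x f" if "x \<in> S \<inter> U" for x
    using U(3) Q0 that by (cases "x = x0") auto
  have rprop: "poly (P x) (r \<zeta> x) = 0 \<and> dist \<zeta> (r \<zeta> x) < e \<and>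
      (\<forall>z. poly (P x) z = 0 \<longrightarrow> dist \<zeta> z < e \<longrightarrow> z = r \<zeta> x)"
    if x: "x \<in> S \<inter> U" and \<zeta>: "\<zeta> \<in> roots p" for x \<zeta>
  proof -
    obtain f where f: "Q x f" using ex x by blast
    then have "f \<zeta> \<in> roots (P x)" using \<zeta> unfolding Q_def by blast
    then show ?thesis
      unfolding rf[OF f \<zeta>] using f \<zeta> unfolding Q_def by blast
  qed
  show thesis
  proof (rule that[of U r])
    show "r \<zeta> x0 = \<zeta>" if "\<zeta> \<in> roots (P x0)" for \<zeta>
      using rf[OF Q0] that by (simp add: p_def)
    fix x assume x: "x \<in> S \<inter> U"
    then obtain f where f: "Q x f" using ex by blast
    then have eq: "r \<zeta> x = f \<zeta>" if "\<zeta> \<in> roots p" for \<zeta> using rf that by blast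
    show "roots (P x) = (\<lambda>\<zeta>. r \<zeta> x) ` roots (P x0)"
      using f eq unfolding Q_def p_def by (simp add: image_def)
    show "inj_on (\<lambda>\<zeta>. r \<zeta> x) (roots (P x0))"
    proof -
      have "inj_on f (roots p)" using f unfolding Q_def by blast
      then show ?thesis
        using inj_on_cong[of "roots p" "\<lambda>\<zeta>. r \<zeta> x" f, OF eq] unfolding p_def by blast
    qed
  next
    fix \<zeta> assume \<zeta>: "\<zeta> \<in> roots (P x0)"
    show "continuous_on (S \<inter> U) (r \<zeta>)"
      unfolding continuous_on_def
    proof (intro ballI tendstoI)
      fix x1 d :: _ assume x1: "x1 \<in> S \<inter> U" and d: "d > (0 :: real)"
      have 1: "r \<zeta> x1 \<in> roots (P x1)" "dist \<zeta> (r \<zeta> x1) < e"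
        using rprop[OF x1] \<zeta> by (auto simp: p_def)
      \<comment> \<open>The ball of radius \<open>d'\<close> about the current root stays inside the
        \<open>e\<close>-ball about \<zeta>, so a root found in it is the value of the same
        branch.\<close>
      define d' where "d' = min d (e - dist \<zeta> (r \<zeta> x1))"
      have "eventually (\<lambda>x. \<exists>z. poly (P x) z = 0 \<and> dist (r \<zeta> x1) z < d') (at x1 within S)"
      proof (rule eventually_mono)
        show "eventually (\<lambda>x. coeff (P x) n \<noteq> 0 \<and> (\<exists>z. poly (P x) z = 0 \<and> dist (r \<zeta> x1) z < d'))
            (at x1 within S)"
          by (rule eventually_root_near[OF lim degev deg(1) nz])
             (use x1 1 d in \<open>auto simp: d'_def\<close>)
      qed blast
      then have "eventually (\<lambda>x. \<exists>z. poly (P x) z = 0 \<and> dist (r \<zeta> x1) z < d') (at x1 within S \<inter> U)"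
        by (rule filter_leD[rotated]) (simp add: at_le)
      moreover have "eventually (\<lambda>x. x \<in> S \<inter> U) (at x1 within S \<inter> U)"
        by (simp add: eventually_at_filter)
      ultimately show "eventually (\<lambda>x. dist (r \<zeta> x) (r \<zeta> x1) < d) (at x1 within S \<inter> U)"
      proof eventually_elim
        case (elim x)
        then obtain z where z: "poly (P x) z = 0" "dist (r \<zeta> x1) z < d'" by blast
        then have "dist \<zeta> z < e" using dist_triangle[of \<zeta> z "r \<zeta> x1"] by (auto simp: d'_def)
        then have "r \<zeta> x = z" using rprop[OF elim(2)] z(1) \<zeta> unfolding p_def by blast
        then show ?case using z(2) by (simp add: d'_def dist_commute)
      qed
    qed
  qed (use U in auto)
qed

section \<open>Lifting paths of polynomials\<close>

text \<open>The analogue of \<open>point_motions\<close> for polynomials, on an arbitrary interval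
  so that motions can be glued.\<close>

definition root_motion :: "(real \<Rightarrow> complex poly) \<Rightarrow> real \<Rightarrow> real \<Rightarrow> (complex \<Rightarrow> real \<Rightarrow> complex) \<Rightarrow> bool" where
  "root_motion P a b r \<longleftrightarrow>
    (\<forall>\<zeta>\<in>roots (P a). continuous_on {a..b} (r \<zeta>) \<and> r \<zeta> a = \<zeta>) \<and>
    (\<forall>t\<in>{a..b}. roots (P t) = (\<lambda>\<zeta>. r \<zeta> t) ` roots (P a))"

lemma root_motionI:
  assumes "\<And>\<zeta>. \<zeta> \<in> roots (P a) \<Longrightarrow> continuous_on {a..b} (r \<zeta>)" "\<And>\<zeta>. \<zeta> \<in> roots (P a) \<Longrightarrow> r \<zeta> a = \<zeta>"
    and "\<And>t. t \<in> {a..b} \<Longrightarrow> roots (P t) = (\<lambda>\<zeta>. r \<zeta> t) ` roots (P a)"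
  shows "root_motion P a b r"
  using assms unfolding root_motion_def by blast

lemma root_motionD:
  assumes "root_motion P a b r"
  shows "\<zeta> \<in> roots (P a) \<Longrightarrow> continuous_on {a..b} (r \<zeta>)" "\<zeta> \<in> roots (P a) \<Longrightarrow> r \<zeta> a = \<zeta>"
    "t \<in> {a..b} \<Longrightarrow> roots (P t) = (\<lambda>\<zeta>. r \<zeta> t) ` roots (P a)"
  using assms unfolding root_motion_def by blast+

lemma root_motion_join:
  assumes r: "root_motion P a b r" and s: "root_motion P b c s" and "a \<le> b" "b \<le> c"
  shows "root_motion P a c (\<lambda>\<zeta> t. if t \<le> b then r \<zeta> t else s (r \<zeta> b) t)"
proof -
  have ab: "roots (P b) = (\<lambda>\<zeta>. r \<zeta> b) ` roots (P a)"
    using assms(3) by (intro root_motionD(3)[OF r]) simp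
  show ?thesis
  proof (rule root_motionI)
    fix \<zeta> assume \<zeta>: "\<zeta> \<in> roots (P a)"
    have b: "r \<zeta> b \<in> roots (P b)" unfolding ab using \<zeta> by blast
    have "continuous_on ({a..b} \<union> {b..c}) (\<lambda>t. if t \<le> b then r \<zeta> t else s (r \<zeta> b) t)"
      using root_motionD(1)[OF r \<zeta>] root_motionD(1,2)[OF s b]
      by (intro continuous_on_cases) auto
    then show "continuous_on {a..c} (\<lambda>t. if t \<le> b then r \<zeta> t else s (r \<zeta> b) t)"
      using assms(3,4) by (simp add: ivl_disj_un_two_touch)
    show "(if a \<le> b then r \<zeta> a else s (r \<zeta> b) a) = \<zeta>"
      using root_motionD(2)[OF r \<zeta>] assms(3) by simp
  next
    fix t assume t: "t \<in> {a..c}"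
    show "roots (P t) = (\<lambda>\<zeta>. if t \<le> b then r \<zeta> t else s (r \<zeta> b) t) ` roots (P a)"
    proof (cases "t \<le> b")
      case True
      then show ?thesis using root_motionD(3)[OF r, of t] t by simp
    next
      case False
      then have "roots (P t) = (\<lambda>\<zeta>. s \<zeta> t) ` roots (P b)"
        using t by (intro root_motionD(3)[OF s]) simp
      then show ?thesis using False unfolding ab image_image by simp
    qed
  qed
qed

text \<open>Existence passes to the union of adjacent intervals and holds on short intervals by
  \<open>local_root_sections\<close>; bisection in the form of \<open>Bolzano\<close> gives the
  whole interval.\<close>

lemma root_motion_exists:
  fixes P :: "real \<Rightarrow> complex poly"
  assumes cont: "\<And>j. continuous_on {0..1} (\<lambda>x. coeff (P x) j)"
    and deg: "\<And>x. x \<in> {0..1} \<Longrightarrow> degree (P x) = n" "\<And>x. x \<in> {0..1} \<Longrightarrow> rsquarefree (P x)"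
  obtains r where "root_motion P 0 1 r"
proof -
  have "0 \<le> (0 :: real) \<longrightarrow> (1 :: real) \<le> 1 \<longrightarrow> (\<exists>r. root_motion P 0 1 r)"
  proof (rule Bolzano[where P = "\<lambda>a b. 0 \<le> a \<longrightarrow> b \<le> 1 \<longrightarrow> (\<exists>r. root_motion P a b r)"])
    fix a b c :: real
    assume *: "0 \<le> a \<longrightarrow> b \<le> 1 \<longrightarrow> (\<exists>r. root_motion P a b r)" "0 \<le> b \<longrightarrow> c \<le> 1 \<longrightarrow> (\<exists>r. root_motion P b c r)"
      and abc: "a \<le> b" "b \<le> c"
    show "0 \<le> a \<longrightarrow> c \<le> 1 \<longrightarrow> (\<exists>r. root_motion P a c r)"
    proof (intro impI)
      assume "0 \<le> a" "c \<le> 1"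
      then obtain r s where "root_motion P a b r" "root_motion P b c s"
        using * abc by auto
      from root_motion_join[OF this abc] show "\<exists>r. root_motion P a c r" by blast
    qed
  next
    fix x :: real assume x: "0 \<le> x" "x \<le> 1"
    then have x1: "x \<in> {0..1}" by simp
    obtain U r where U: "open U" "x \<in> U"
      and r: "\<And>\<zeta>. \<zeta> \<in> roots (P x) \<Longrightarrow> continuous_on ({0..1} \<inter> U) (r \<zeta>)"
        "\<And>y. y \<in> {0..1} \<inter> U \<Longrightarrow> roots (P y) = (\<lambda>\<zeta>. r \<zeta> y) ` roots (P x)"
        "\<And>y. y \<in> {0..1} \<inter> U \<Longrightarrow> inj_on (\<lambda>\<zeta>. r \<zeta> y) (roots (P x))"
      by (rule local_root_sections[OF cont deg x1]) auto
    obtain d where d: "d > 0" "ball x d \<subseteq> U" using U openE by blast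
    have "\<exists>r. root_motion P a b r"
      if ab: "a \<le> x \<and> x \<le> b \<and> b - a < d" "0 \<le> a" "b \<le> 1" for a b
    proof -
      have sub: "{a..b} \<subseteq> {0..1} \<inter> U" using ab d(2) by (force simp: dist_real_def)
      have a: "a \<in> {0..1} \<inter> U" using sub ab by auto
      \<comment> \<open>The local branches are labelled by the roots at \<open>x\<close>, a motion
        on \<open>{a..b}\<close> by the roots at \<open>a\<close>; \<open>g\<close> translates the
        labels.\<close>
      define g where "g = the_inv_into (roots (P x)) (\<lambda>\<zeta>. r \<zeta> a)"
      have g: "g \<zeta> \<in> roots (P x)" "r (g \<zeta>) a = \<zeta>" if "\<zeta> \<in> roots (P a)" for \<zeta>
      proof -
        have "\<zeta> \<in> (\<lambda>\<zeta>. r \<zeta> a) ` roots (P x)" using that by (simp only: r(2)[OF a])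
        then show "g \<zeta> \<in> roots (P x)" "r (g \<zeta>) a = \<zeta>"
          unfolding g_def using the_inv_into_into[OF r(3)[OF a] _ order_refl] f_the_inv_into_f[OF r(3)[OF a]]
          by blast+
      qed
      have im: "g ` roots (P a) = roots (P x)"
        unfolding g_def r(2)[OF a] by (rule the_inv_into_onto[OF r(3)[OF a]])
      have "roots (P t) = (\<lambda>\<zeta>. r (g \<zeta>) t) ` roots (P a)" if "t \<in> {a..b}" for t
        unfolding r(2)[OF subsetD[OF sub that]] im[symmetric] by (simp add: image_image)
      then have "root_motion P a b (\<lambda>\<zeta>. r (g \<zeta>))"
        by (intro root_motionI continuous_on_subset[OF r(1) sub] g)
      then show ?thesis by blast
    qed
    then show "\<exists>d>0. \<forall>a b. a \<le> x \<and> x \<le> b \<and> b - a < d \<longrightarrow>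
        0 \<le> a \<longrightarrow> b \<le> 1 \<longrightarrow> (\<exists>r. root_motion P a b r)"
      using d(1) by blast
  qed simp
  then show thesis using that by auto
qed

lemma root_motion_inj:
  assumes "root_motion P 0 1 r" "t \<in> {0..1}"
    and "\<And>x. x \<in> {0..1} \<Longrightarrow> degree (P x) = n" "\<And>x. x \<in> {0..1} \<Longrightarrow> rsquarefree (P x)"
  shows "inj_on (\<lambda>\<zeta>. r \<zeta> t) (roots (P 0))"
proof (rule eq_card_imp_inj_on)
  have "P 0 \<noteq> 0" using assms(4)[of 0] by (simp add: rsquarefree_def)
  then show "finite (roots (P 0))" by (rule poly_roots_finite)
  show "card ((\<lambda>\<zeta>. r \<zeta> t) ` roots (P 0)) = card (roots (P 0))"
    unfolding root_motionD(3)[OF assms(1,2), symmetric]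
    using card_roots_rsquarefree[OF assms(4)] assms(2,3) by simp
qed

text \<open>The times at which \<open>q\<close> follows its own branch and those at which it follows
  another one are two closed sets. They cover the interval and are disjoint by
  \<open>root_motion_inj\<close>, so connectedness leaves only the first.\<close>

lemma root_motion_unique:
  assumes r: "root_motion P 0 1 r"
    and deg: "\<And>x. x \<in> {0..1} \<Longrightarrow> degree (P x) = n" "\<And>x. x \<in> {0..1} \<Longrightarrow> rsquarefree (P x)"
    and q: "continuous_on {0..1} q" "\<And>t. t \<in> {0..1} \<Longrightarrow> poly (P t) (q t) = 0"
    and t: "t \<in> {0..1}"
  shows "q t = r (q 0) t"
proof -
  have P0: "P 0 \<noteq> 0" using deg(2)[of 0] by (simp add: rsquarefree_def)
  have q0: "q 0 \<in> roots (P 0)" using q(2)[of 0] by simp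
  have cl: "closedin (top_of_set {0..1}) {t \<in> {0..1}. q t = r \<zeta> t}" if "\<zeta> \<in> roots (P 0)" for \<zeta>
  proof -
    have "continuous_on {0..1} (\<lambda>t. q t - r \<zeta> t)"
      by (intro continuous_intros q(1) root_motionD(1)[OF r that])
    from continuous_closedin_preimage_constant[OF this, of 0] show ?thesis by simp
  qed
  define A where "A = {t \<in> {0..1}. q t = r (q 0) t}"
  define B where "B = (\<Union>\<zeta>\<in>roots (P 0) - {q 0}. {t \<in> {0..1}. q t = r \<zeta> t})"
  have "closedin (top_of_set {0..1}) A" unfolding A_def using cl q0 by blast
  moreover have "closedin (top_of_set {0..1}) B"
    unfolding B_def using cl P0 by (intro closedin_Union) (auto intro: poly_roots_finite)
  moreover have "A \<union> B = {0..1}"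
  proof -
    have "t \<in> A \<union> B" if "t \<in> {0..1}" for t
    proof -
      have "q t \<in> (\<lambda>\<zeta>. r \<zeta> t) ` roots (P 0)"
        unfolding root_motionD(3)[OF r that, symmetric] using q(2)[OF that] by simp
      then show ?thesis using that by (auto simp: A_def B_def)
    qed
    moreover have "A \<union> B \<subseteq> {0..1}" by (auto simp: A_def B_def)
    ultimately show ?thesis by blast
  qed
  moreover have "A \<inter> B = {}"
  proof -
    have "\<zeta> = q 0" if "t \<in> {0..1}" "r (q 0) t = r \<zeta> t" "\<zeta> \<in> roots (P 0)" for t \<zeta>
      using inj_onD[OF root_motion_inj[OF r that(1) deg] that(2) q0 that(3)] by simp
    then show ?thesis by (auto simp: A_def B_def)
  qed
  moreover have "0 \<in> A" using root_motionD(2)[OF r q0] by (simp add: A_def)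
  moreover have "connected {0..1 :: real}" by simp
  ultimately have "B = {}" unfolding connected_closedin_eq by blast
  then have "t \<in> A" using \<open>A \<union> B = {0..1}\<close> t by simp
  then show ?thesis by (simp add: A_def)
qed

section \<open>Holomorphic dependence of simple roots\<close>

text \<open>The implicit function theorem for a root already known to be continuous: its difference
  quotient can be computed directly.\<close>

lemma holomorphic_on_simple_root:
  fixes P :: "complex \<Rightarrow> complex poly"
  assumes hol: "\<And>j. (\<lambda>a. coeff (P a) j) holomorphic_on U" and U: "open U"
    and deg: "\<And>a. a \<in> U \<Longrightarrow> degree (P a) \<le> n"
    and r: "continuous_on U r" "\<And>a. a \<in> U \<Longrightarrow> poly (P a) (r a) = 0"
      "\<And>a. a \<in> U \<Longrightarrow> poly (pderiv (P a)) (r a) \<noteq> 0"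
  shows "r holomorphic_on U"
proof -
  have "\<exists>D. (r has_field_derivative D) (at a0)" if a0: "a0 \<in> U" for a0
  proof -
    define z0 where "z0 = r a0"
    \<comment> \<open>The polynomial quotient of \<open>poly (P a) z - poly (P a) z0\<close> by
      \<open>z - z0\<close>. At the base point it is the derivative, hence nonzero, and
      \<open>r a - z0 = - poly (P a) z0 / S a (r a)\<close>.\<close>
    define S where "S a z = (\<Sum>j\<le>n. coeff (P a) j * (\<Sum>i<j. z ^ i * z0 ^ (j - Suc i)))" for a z
    have eval: "poly (P a) z = (\<Sum>j\<le>n. coeff (P a) j * z ^ j)" if "a \<in> U" for a z
      unfolding poly_altdef using deg[OF that]
      by (intro sum.mono_neutral_left) (auto simp: coeff_eq_0)
    have S: "poly (P a) z - poly (P a) z0 = (z - z0) * S a z" if "a \<in> U" for a z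
      unfolding eval[OF that] S_def sum_subtractf[symmetric] right_diff_distrib[symmetric]
        power_diff_sumr2 by (simp add: sum_distrib_left mult_ac)
    have contS: "isCont (S a0) z0"
      unfolding S_def by (intro continuous_intros)
    have S0: "S a0 z0 = poly (pderiv (P a0)) z0"
    proof (rule DERIV_unique)
      show "((\<lambda>z. poly (P a0) z) has_field_derivative poly (pderiv (P a0)) z0) (at z0)"
        by (rule poly_DERIV)
      show "((\<lambda>z. poly (P a0) z) has_field_derivative S a0 z0) (at z0)"
        unfolding CARAT_DERIV using S[OF a0] contS by (intro exI[of _ "S a0"]) (simp add: mult.commute)
    qed
    have rc: "(r \<longlongrightarrow> z0) (at a0)"
      using r(1) a0 U by (auto simp: z0_def continuous_on_eq_continuous_at isCont_def)
    have cc: "((\<lambda>a. coeff (P a) j) \<longlongrightarrow> coeff (P a0) j) (at a0)" for j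
      using holomorphic_on_imp_continuous_on[OF hol] a0 U
      by (auto simp: continuous_on_eq_continuous_at isCont_def)
    have Slim: "((\<lambda>a. S a (r a)) \<longlongrightarrow> S a0 z0) (at a0)"
      unfolding S_def by (intro tendsto_intros rc cc)
    have S0': "S a0 z0 \<noteq> 0" using S0 r(3)[OF a0] by (simp add: z0_def)
    have ev: "eventually (\<lambda>a. a \<in> U) (at a0)" using a0 U by (rule eventually_at_in_open'[rotated])
    have "(\<lambda>a. poly (P a) z0) holomorphic_on U"
    proof (rule holomorphic_transform)
      show "(\<lambda>a. \<Sum>j\<le>n. coeff (P a) j * z0 ^ j) holomorphic_on U"
        by (intro holomorphic_intros hol)
    qed (simp add: eval)
    then obtain D where "((\<lambda>a. poly (P a) z0) has_field_derivative D) (at a0)"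
      using holomorphic_on_imp_differentiable_at[OF _ U a0] by (auto simp: field_differentiable_def)
    then have "((\<lambda>a. (poly (P a) z0 - poly (P a0) z0) / (a - a0)) \<longlongrightarrow> D) (at a0)"
      by (simp add: has_field_derivative_iff)
    then have "((\<lambda>a. - ((poly (P a) z0 - poly (P a0) z0) / (a - a0)) / S a (r a)) \<longlongrightarrow> - D / S a0 z0) (at a0)"
      by (intro tendsto_intros Slim S0')
    moreover have "eventually (\<lambda>a. - ((poly (P a) z0 - poly (P a0) z0) / (a - a0)) / S a (r a) =
        (r a - r a0) / (a - a0)) (at a0)"
      using ev tendsto_imp_eventually_ne[OF Slim S0']
    proof eventually_elim
      case (elim a)
      have "- (poly (P a) z0 - poly (P a0) z0) = (r a - z0) * S a (r a)"
        using S[OF elim(1), of "r a"] r(2)[OF elim(1)] r(2)[OF a0] by (simp add: z0_def)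
      then have "- (poly (P a) z0 - poly (P a0) z0) / S a (r a) = r a - z0"
        using elim(2) by simp
      then have "r a - r a0 = - (poly (P a) z0 - poly (P a0) z0) / S a (r a)" by (simp add: z0_def)
      then show ?case by (simp add: divide_divide_eq_left mult.commute minus_divide_left)
    qed
    ultimately have "((\<lambda>a. (r a - r a0) / (a - a0)) \<longlongrightarrow> - D / S a0 z0) (at a0)"
      by (rule Lim_transform_eventually)
    then show ?thesis by (auto simp: has_field_derivative_iff)
  qed
  then show ?thesis using U by (auto simp: holomorphic_on_open)
qed

section \<open>Lines spanned by two vectors\<close>

lemma proj_point_cases:
  obtains v where "v \<noteq> 0" "p = proj_point v"
proof -
  have "same_direction (rep_proj_plane p) (rep_proj_plane p)"
    by (rule Quotient3_rep_reflp[OF Quotient3_proj_plane])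
  then have "rep_proj_plane p \<noteq> 0" by (simp add: same_direction_def)
  then show thesis using that Quotient3_abs_rep[OF Quotient3_proj_plane, of p] by metis
qed

lemma incident_proj_point:
  assumes "v \<noteq> 0" "a \<noteq> 0"
  shows "incident (proj_point v) (proj_point a) \<longleftrightarrow> (\<Sum>i\<in>UNIV. a $ i * v $ i) = 0"
proof -
  have "same_direction v v" "same_direction a a"
    using assms by (auto simp: same_direction_def intro!: exI[of _ 1])
  then show ?thesis by (rule incident.abs_eq)
qed

lemma continuous_on_proj_point: "continuous_on (- {0}) proj_point"
proof -
  have "open (proj_point -` B \<inter> - {0})" if "open B" for B
  proof -
    have "proj_point -` B \<inter> - {0} = {v. v \<noteq> 0 \<and> proj_point v \<in> B}" by auto
    then show ?thesis using that by (simp add: open_proj_plane_def)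
  qed
  then show ?thesis by (subst continuous_on_open_vimage) auto
qed

lemma path_proj_point:
  assumes "continuous_on {0..1} f" "\<And>t. t \<in> {0..1} \<Longrightarrow> f t \<noteq> 0"
  shows "path (\<lambda>t. proj_point (f t))"
  unfolding path_def
  by (rule continuous_on_compose2[OF continuous_on_proj_point assms(1)]) (use assms(2) in auto)

text \<open>The coefficient vector of the line joining the points \<open>u\<close> and
  \<open>w\<close>; its pairing with a third vector is the determinant of the three.\<close>

definition cross_product :: "complex ^ 3 \<Rightarrow> complex ^ 3 \<Rightarrow> complex ^ 3" where
  "cross_product u w = vector [u $ 2 * w $ 3 - u $ 3 * w $ 2,
     u $ 3 * w $ 1 - u $ 1 * w $ 3, u $ 1 * w $ 2 - u $ 2 * w $ 1]"

lemma cross_product_nth [simp]: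
  "cross_product u w $ 1 = u $ 2 * w $ 3 - u $ 3 * w $ 2"
  "cross_product u w $ 2 = u $ 3 * w $ 1 - u $ 1 * w $ 3"
  "cross_product u w $ 3 = u $ 1 * w $ 2 - u $ 2 * w $ 1"
  by (simp_all add: cross_product_def)

lemma cross_product_combination:
  "cross_product (a *s u + b *s w) (c *s u + d *s w) = (a * d - b * c) *s cross_product u w"
  by (simp add: vec_eq_iff forall_3 algebra_simps)

lemma continuous_on_cross_product [continuous_intros]:
  assumes "continuous_on S u" "continuous_on S w"
  shows "continuous_on S (\<lambda>x. cross_product (u x) (w x))"
proof -
  have *: "cross_product (u x) (w x) = (\<chi> i. cross_product (u x) (w x) $ i)" for x by simp
  have "continuous_on S (\<lambda>x. cross_product (u x) (w x) $ i)" for i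
    using exhaust_3[of i] by (elim disjE; simp; intro continuous_intros assms)
  then show ?thesis by (subst *) (rule continuous_on_vec_lambda)
qed

lemma orthogonal_cross_product_iff:
  assumes "cross_product u w \<noteq> 0"
  shows "(\<Sum>i\<in>UNIV. cross_product u w $ i * v $ i) = 0 \<longleftrightarrow> (\<exists>c d. v = c *s u + d *s w)"
proof
  assume "\<exists>c d. v = c *s u + d *s w"
  then show "(\<Sum>i\<in>UNIV. cross_product u w $ i * v $ i) = 0"
    by (auto simp: sum_3 algebra_simps)
next
  assume 0: "(\<Sum>i\<in>UNIV. cross_product u w $ i * v $ i) = 0"
  define x y z where xyz: "x = cross_product u w $ 1" "y = cross_product u w $ 2" "z = cross_product u w $ 3"
  have e: "x * v $ 1 + y * v $ 2 + z * v $ 3 = 0" using 0 by (simp add: sum_3 xyz)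
  consider "x \<noteq> 0" | "y \<noteq> 0" | "z \<noteq> 0"
    using assms by (auto simp: vec_eq_iff forall_3 xyz)
  then obtain D p q where D: "D \<noteq> 0" "D *s v = p *s u + q *s w"
  proof cases
    case 1
    \<comment> \<open>Cramer's rule in the second and third coordinates; the first one then follows
      from \<open>e\<close>. The other two cases are cyclic.\<close>
    have "x *s v = (v $ 2 * w $ 3 - v $ 3 * w $ 2) *s u + (u $ 2 * v $ 3 - u $ 3 * v $ 2) *s w"
      using e by (simp add: vec_eq_iff forall_3 xyz) algebra
    with 1 show ?thesis using that by blast
  next
    case 2
    have "y *s v = (v $ 3 * w $ 1 - v $ 1 * w $ 3) *s u + (u $ 3 * v $ 1 - u $ 1 * v $ 3) *s w"
      using e by (simp add: vec_eq_iff forall_3 xyz) algebra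
    with 2 show ?thesis using that by blast
  next
    case 3
    have "z *s v = (v $ 1 * w $ 2 - v $ 2 * w $ 1) *s u + (u $ 1 * v $ 2 - u $ 2 * v $ 1) *s w"
      using e by (simp add: vec_eq_iff forall_3 xyz) algebra
    with 3 show ?thesis using that by blast
  qed
  have "v = (1 / D) *s (D *s v)" using D(1) by (simp add: vector_smult_assoc)
  also have "\<dots> = (p / D) *s u + (q / D) *s w"
    unfolding D(2) by (simp add: vector_add_ldistrib vector_smult_assoc)
  finally show "\<exists>c d. v = c *s u + d *s w" by blast
qed

definition columns3 :: "complex ^ 3 \<Rightarrow> complex ^ 3 \<Rightarrow> complex ^ 3 \<Rightarrow> complex ^ 3 ^ 3" where
  "columns3 u v w = (\<chi> i j. if j = 1 then u $ i else if j = 2 then v $ i else w $ i)"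

lemma columns3_mult: "columns3 u v w *v x = x $ 1 *s u + x $ 2 *s v + x $ 3 *s w"
  by (simp add: vec_eq_iff columns3_def matrix_vector_mult_def sum_3 algebra_simps)

lemma invertible_columns3:
  assumes "(\<Sum>i\<in>UNIV. cross_product u v $ i * w $ i) \<noteq> 0"
  shows "invertible (columns3 u v w)"
proof -
  have "det (columns3 u v w) = (\<Sum>i\<in>UNIV. cross_product u v $ i * w $ i)"
    by (simp add: det_3 columns3_def sum_3 algebra_simps)
  then show ?thesis using assms by (simp add: invertible_det_nz)
qed

definition line_through :: "complex ^ 3 \<Rightarrow> complex ^ 3 \<Rightarrow> dual_plane" where
  "line_through u w = proj_point (cross_product u w)"

lemma line_points_line_through:
  assumes "cross_product u w \<noteq> 0"
  shows "line_points (line_through u w) = {proj_point (c *s u + d *s w) |c d. c *s u + d *s w \<noteq> 0}"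
proof -
  have *: "proj_point v \<in> line_points (line_through u w) \<longleftrightarrow> (\<exists>c d. v = c *s u + d *s w)" if "v \<noteq> 0" for v
    unfolding line_through_def line_points_def
    using incident_proj_point[OF that assms] orthogonal_cross_product_iff[OF assms] by simp
  show ?thesis
  proof (intro equalityI subsetI)
    fix p assume p: "p \<in> line_points (line_through u w)"
    obtain v where "v \<noteq> 0" "p = proj_point v" by (rule proj_point_cases)
    with p * show "p \<in> {proj_point (c *s u + d *s w) |c d. c *s u + d *s w \<noteq> 0}" by blast
  next
    fix p assume "p \<in> {proj_point (c *s u + d *s w) |c d. c *s u + d *s w \<noteq> 0}"
    with * show "p \<in> line_points (line_through u w)" by blast
  qed
qed

lemma line_through_combination:
  assumes "a * d - b * c \<noteq> 0" "cross_product u w \<noteq> 0"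
  shows "line_through (a *s u + b *s w) (c *s u + d *s w) = line_through u w"
proof -
  have "(a * d - b * c) *s cross_product u w \<noteq> 0" using assms by simp
  then show ?thesis
    unfolding line_through_def cross_product_combination
    using proj_point_eq_iff[OF _ assms(2)] assms(1) by blast
qed

lemma parallel_if_cross_product_eq_0:
  assumes "cross_product a b = 0" "b \<noteq> 0"
  obtains k where "a = k *s b"
proof -
  have 1: "a $ 2 * b $ 3 = a $ 3 * b $ 2" "a $ 3 * b $ 1 = a $ 1 * b $ 3" "a $ 1 * b $ 2 = a $ 2 * b $ 1"
    using assms(1) by (simp_all add: vec_eq_iff forall_3)
  obtain i where i: "b $ i \<noteq> 0" using assms(2) by (auto simp: vec_eq_iff)
  have "a = (a $ i / b $ i) *s b"
    using exhaust_3[of i] i 1 by (elim disjE) (simp_all add: vec_eq_iff forall_3 field_simps)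
  then show thesis by (rule that)
qed

text \<open>The expansion of the double cross product of \<open>a\<close> with \<open>u\<close> and
  \<open>w\<close> has coefficients that vanish by incidence, so \<open>a\<close> is proportional to
  \<open>cross_product u w\<close>.\<close>

lemma line_eq_line_through:
  assumes "u \<noteq> 0" "w \<noteq> 0" "cross_product u w \<noteq> 0"
    and "proj_point u \<in> line_points l" "proj_point w \<in> line_points l"
  shows "l = line_through u w"
proof -
  obtain a where a: "a \<noteq> 0" "l = proj_point a" by (rule proj_point_cases)
  have 1: "a $ 1 * u $ 1 + a $ 2 * u $ 2 + a $ 3 * u $ 3 = 0" "a $ 1 * w $ 1 + a $ 2 * w $ 2 + a $ 3 * w $ 3 = 0"
    using assms a by (auto simp: line_points_def incident_proj_point sum_3)
  have "cross_product a (cross_product u w) =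
      (a $ 1 * w $ 1 + a $ 2 * w $ 2 + a $ 3 * w $ 3) *s u - (a $ 1 * u $ 1 + a $ 2 * u $ 2 + a $ 3 * u $ 3) *s w"
    by (simp add: vec_eq_iff forall_3 algebra_simps)
  then have "cross_product a (cross_product u w) = 0" unfolding 1 by simp
  then obtain k where k: "a = k *s cross_product u w"
    using parallel_if_cross_product_eq_0 assms(3) by metis
  with a(1) have "k \<noteq> 0" by auto
  then show ?thesis
    unfolding line_through_def a(2) k using assms(3) by (subst proj_point_eq_iff) auto
qed

lemma frame_point_nonzero:
  assumes "cross_product u w \<noteq> 0"
  shows "u + s *s w \<noteq> 0"
proof
  assume "u + s *s w = 0"
  then have "cross_product (1 *s u + s *s w) (0 *s u + 1 *s w) = 0"
    by (simp add: vec_eq_iff forall_3)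
  then show False using assms unfolding cross_product_combination by simp
qed

lemma inj_frame_points:
  assumes "cross_product u w \<noteq> 0"
  shows "inj (\<lambda>s. proj_point (u + s *s w))"
proof (rule injI)
  fix s t assume "proj_point (u + s *s w) = proj_point (u + t *s w)"
  then obtain c where c: "u + s *s w = c *s (u + t *s w)"
    using proj_point_eq_iff[OF frame_point_nonzero frame_point_nonzero] assms by blast
  have "cross_product (1 *s u + s *s w) (1 *s u + t *s w) = cross_product (u + s *s w) (u + t *s w)"
    by simp
  also have "\<dots> = 0" unfolding c by (simp add: vec_eq_iff forall_3 algebra_simps)
  finally show "s = t" using assms unfolding cross_product_combination by simp
qed

text \<open>The parametrisation misses only the point \<open>w\<close> of the line, and that point
  is off the curve.\<close>

lemma line_points_frame:
  assumes "homogeneous n F" "cross_product u w \<noteq> 0" "eval3 F w \<noteq> 0"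
  shows "line_points (line_through u w) \<inter> zero_locus F =
    (\<lambda>s. proj_point (u + s *s w)) ` roots (restrict_line F u w)"
proof (intro equalityI subsetI)
  fix p assume p: "p \<in> line_points (line_through u w) \<inter> zero_locus F"
  then obtain c d where cd: "p = proj_point (c *s u + d *s w)" "c *s u + d *s w \<noteq> 0"
    using line_points_line_through[OF assms(2)] by auto
  have F0: "eval3 F (c *s u + d *s w) = 0"
    using p cd proj_point_in_zero_locus_iff[OF assms(1)] by auto
  have "c \<noteq> 0"
  proof
    assume "c = 0"
    then have "d \<noteq> 0" "d ^ n * eval3 F w = 0"
      using cd F0 eval3_scale[OF assms(1), of d w] by auto
    then show False using assms(3) by simp
  qed
  then have e: "c *s u + d *s w = c *s (u + (d / c) *s w)"
    by (simp add: vector_add_ldistrib vector_smult_assoc)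
  then have "p = proj_point (u + (d / c) *s w)"
    using cd \<open>c \<noteq> 0\<close> frame_point_nonzero[OF assms(2)] by (auto simp: proj_point_eq_iff)
  moreover have "eval3 F (u + (d / c) *s w) = 0"
    using F0 \<open>c \<noteq> 0\<close> unfolding e eval3_scale[OF assms(1)] by simp
  ultimately show "p \<in> (\<lambda>s. proj_point (u + s *s w)) ` roots (restrict_line F u w)" by simp
next
  fix p assume "p \<in> (\<lambda>s. proj_point (u + s *s w)) ` roots (restrict_line F u w)"
  then obtain s where s: "p = proj_point (u + s *s w)" "eval3 F (u + s *s w) = 0" by auto
  have nz: "u + s *s w \<noteq> 0" by (rule frame_point_nonzero[OF assms(2)])
  have "p \<in> line_points (line_through u w)"
    unfolding line_points_line_through[OF assms(2)] s(1) mem_Collect_eq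
    using nz by (intro exI[of _ 1] exI[of _ s]) simp
  then show "p \<in> line_points (line_through u w) \<inter> zero_locus F"
    using s nz proj_point_in_zero_locus_iff[OF assms(1) nz] by simp
qed

text \<open>The bridge from geometry to algebra: counting intersection points becomes counting
  distinct roots of a polynomial of degree \<open>n\<close>.\<close>

lemma transversal_frame_iff:
  assumes "homogeneous n F" "cross_product u w \<noteq> 0" "eval3 F w \<noteq> 0"
  shows "line_through u w \<in> transversal_lines n (zero_locus F) \<longleftrightarrow> rsquarefree (restrict_line F u w)"
proof -
  have deg: "degree (restrict_line F u w) = n" "restrict_line F u w \<noteq> 0"
    using restrict_line_top[OF assms(1), of u w] assms(3) le_degree[of "restrict_line F u w" n] by auto
  have inj: "inj_on (\<lambda>s. proj_point (u + s *s w)) (roots (restrict_line F u w))"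
    using inj_frame_points[OF assms(2)] inj_on_subset by blast
  have "finite (roots (restrict_line F u w))" using deg(2) by (rule poly_roots_finite)
  then have "line_through u w \<in> transversal_lines n (zero_locus F) \<longleftrightarrow>
      card (roots (restrict_line F u w)) = n"
    unfolding transversal_lines_def mem_Collect_eq line_points_frame[OF assms]
    using inj by (simp add: card_image)
  also have "\<dots> \<longleftrightarrow> rsquarefree (restrict_line F u w)"
    using deg rsquarefree_if_card[of "restrict_line F u w"] card_roots_rsquarefree[of "restrict_line F u w"]
    by (metis order_refl)
  finally show ?thesis .
qed

section \<open>Monodromy\<close>

lemma has_monodromy_cong:
  assumes "has_monodromy C l \<sigma>" "\<And>P. P \<in> line_points (l 0) \<inter> C \<Longrightarrow> \<sigma> P = \<tau> P"
  shows "has_monodromy C l \<tau>"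
  using assms unfolding has_monodromy_def by metis

lemma has_monodromyI:
  assumes "\<And>P. P \<in> line_points (l 0) \<inter> C \<Longrightarrow> path (\<psi> P) \<and> \<psi> P 0 = P \<and> \<psi> P 1 = \<sigma> P"
    and "\<And>t. t \<in> {0..1} \<Longrightarrow> line_points (l t) \<inter> C = (\<lambda>P. \<psi> P t) ` (line_points (l 0) \<inter> C)"
  shows "has_monodromy C l \<sigma>"
  unfolding has_monodromy_def point_motions_def using assms by blast

lemma has_monodromyE:
  assumes "has_monodromy C l \<sigma>"
  obtains \<psi> where "\<And>P. P \<in> line_points (l 0) \<inter> C \<Longrightarrow> path (\<psi> P) \<and> \<psi> P 0 = P \<and> \<psi> P 1 = \<sigma> P"
    "\<And>t. t \<in> {0..1} \<Longrightarrow> line_points (l t) \<inter> C = (\<lambda>P. \<psi> P t) ` (line_points (l 0) \<inter> C)"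
proof -
  obtain \<psi> where 1: "point_motions C l \<psi>" "\<forall>P \<in> line_points (l 0) \<inter> C. \<psi> P 1 = \<sigma> P"
    using assms unfolding has_monodromy_def by blast
  show thesis
    by (rule that[of \<psi>]; (intro conjI)?; insert 1; unfold point_motions_def; blast)
qed

lemma has_monodromy_image:
  assumes "has_monodromy C l \<sigma>"
  shows "line_points (l 1) \<inter> C = \<sigma> ` (line_points (l 0) \<inter> C)"
proof -
  obtain \<psi> where \<psi>: "\<And>P. P \<in> line_points (l 0) \<inter> C \<Longrightarrow> path (\<psi> P) \<and> \<psi> P 0 = P \<and> \<psi> P 1 = \<sigma> P"
    "\<And>t. t \<in> {0..1} \<Longrightarrow> line_points (l t) \<inter> C = (\<lambda>P. \<psi> P t) ` (line_points (l 0) \<inter> C)"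
    using has_monodromyE[OF assms] by blast
  have "line_points (l 1) \<inter> C = (\<lambda>P. \<psi> P 1) ` (line_points (l 0) \<inter> C)"
    by (rule \<psi>(2)) simp
  also have "\<dots> = \<sigma> ` (line_points (l 0) \<inter> C)"
    by (intro image_cong refl) (use \<psi>(1) in blast)
  finally show ?thesis .
qed

lemma has_monodromy_join:
  assumes l: "has_monodromy C l \<sigma>" and l': "has_monodromy C l' \<tau>"
    and eq: "pathfinish l = pathstart l'"
  shows "has_monodromy C (l +++ l') (\<tau> \<circ> \<sigma>)"
proof -
  obtain \<psi> where \<psi>: "\<And>P. P \<in> line_points (l 0) \<inter> C \<Longrightarrow> path (\<psi> P) \<and> \<psi> P 0 = P \<and> \<psi> P 1 = \<sigma> P"
      "\<And>t. t \<in> {0..1} \<Longrightarrow> line_points (l t) \<inter> C = (\<lambda>P. \<psi> P t) ` (line_points (l 0) \<inter> C)"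
    using has_monodromyE[OF l] by blast
  obtain \<phi> where \<phi>: "\<And>P. P \<in> line_points (l' 0) \<inter> C \<Longrightarrow> path (\<phi> P) \<and> \<phi> P 0 = P \<and> \<phi> P 1 = \<tau> P"
      "\<And>t. t \<in> {0..1} \<Longrightarrow> line_points (l' t) \<inter> C = (\<lambda>P. \<phi> P t) ` (line_points (l' 0) \<inter> C)"
    using has_monodromyE[OF l'] by blast
  have im: "line_points (l' 0) \<inter> C = \<sigma> ` (line_points (l 0) \<inter> C)"
    using has_monodromy_image[OF l] eq by (simp add: pathfinish_def pathstart_def)
  define \<omega> where "\<omega> P = \<psi> P +++ \<phi> (\<sigma> P)" for P
  have start: "(l +++ l') 0 = l 0" by (simp add: joinpaths_def)
  have "path (\<omega> P) \<and> \<omega> P 0 = P \<and> \<omega> P 1 = (\<tau> \<circ> \<sigma>) P" if P: "P \<in> line_points (l 0) \<inter> C" for P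
  proof -
    have "\<sigma> P \<in> line_points (l' 0) \<inter> C" unfolding im using P by blast
    then show ?thesis
      unfolding \<omega>_def using \<psi>(1)[OF P] \<phi>(1)
      by (simp add: path_join_eq pathfinish_def pathstart_def) (simp add: joinpaths_def)
  qed
  moreover have "line_points ((l +++ l') t) \<inter> C = (\<lambda>P. \<omega> P t) ` (line_points (l 0) \<inter> C)"
    if t: "t \<in> {0..1}" for t
  proof (cases "t \<le> 1 / 2")
    case True
    then show ?thesis using \<psi>(2)[of "2 * t"] t by (simp add: \<omega>_def joinpaths_def)
  next
    case False
    then show ?thesis using \<phi>(2)[of "2 * t - 1"] t
      by (simp add: \<omega>_def joinpaths_def im image_image)
  qed
  ultimately show ?thesis
    by (intro has_monodromyI[of _ _ \<omega>]) (unfold start)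
qed

lemma has_monodromy_reversepath:
  assumes l: "has_monodromy C l \<sigma>"
    and card: "finite (line_points (l 0) \<inter> C)" "card (line_points (l 1) \<inter> C) = card (line_points (l 0) \<inter> C)"
    and \<tau>: "\<And>P. P \<in> line_points (l 0) \<inter> C \<Longrightarrow> \<tau> (\<sigma> P) = P"
  shows "has_monodromy C (reversepath l) \<tau>"
proof -
  obtain \<psi> where \<psi>: "\<And>P. P \<in> line_points (l 0) \<inter> C \<Longrightarrow> path (\<psi> P) \<and> \<psi> P 0 = P \<and> \<psi> P 1 = \<sigma> P"
      "\<And>t. t \<in> {0..1} \<Longrightarrow> line_points (l t) \<inter> C = (\<lambda>P. \<psi> P t) ` (line_points (l 0) \<inter> C)"
    using has_monodromyE[OF l] by blast
  have im: "line_points (l 1) \<inter> C = \<sigma> ` (line_points (l 0) \<inter> C)"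
    by (rule has_monodromy_image[OF l])
  define \<omega> where "\<omega> Q = reversepath (\<psi> (\<tau> Q))" for Q
  have start: "reversepath l 0 = l 1" by (simp add: reversepath_def)
  have "path (\<omega> Q) \<and> \<omega> Q 0 = Q \<and> \<omega> Q 1 = \<tau> Q" if Q: "Q \<in> line_points (l 1) \<inter> C" for Q
  proof -
    obtain P where P: "P \<in> line_points (l 0) \<inter> C" "Q = \<sigma> P"
      using Q unfolding im by blast
    have e: "\<omega> Q = reversepath (\<psi> P)" using \<tau>[OF P(1)] by (simp only: \<omega>_def P(2))
    have "reversepath (\<psi> P) 0 = \<psi> P 1" "reversepath (\<psi> P) 1 = \<psi> P 0"
      by (simp_all add: reversepath_def)
    then show ?thesis using \<psi>(1)[OF P(1)] \<tau>[OF P(1)] P(2) unfolding e path_reversepath by metis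
  qed
  moreover have "line_points (reversepath l t) \<inter> C = (\<lambda>Q. \<omega> Q t) ` (line_points (l 1) \<inter> C)"
    if t: "t \<in> {0..1}" for t
  proof -
    have "line_points (reversepath l t) \<inter> C = (\<lambda>P. \<psi> P (1 - t)) ` (line_points (l 0) \<inter> C)"
      unfolding reversepath_def using t by (intro \<psi>(2)) simp
    also have "\<dots> = (\<lambda>P. \<omega> (\<sigma> P) t) ` (line_points (l 0) \<inter> C)"
      by (intro image_cong refl) (simp add: \<omega>_def reversepath_def \<tau>)
    finally show ?thesis unfolding im image_image .
  qed
  ultimately show ?thesis
    by (intro has_monodromyI[of _ _ \<omega>]) (unfold start)
qed

text \<open>Equal cardinality of the fibres makes \<sigma> injective, so going back along
  \<open>k\<close> inverts it, and a conjugate of a transposition is the transposition of the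
  preimages.\<close>

lemma has_monodromy_conjugate_transposition:
  assumes k: "has_monodromy C k \<sigma>" and l: "has_monodromy C l (Transposition.transpose (\<sigma> P) (\<sigma> Q))"
    and loop: "pathstart l = pathfinish k" "pathfinish l = pathfinish k"
    and card: "finite (line_points (k 0) \<inter> C)" "card (line_points (k 1) \<inter> C) = card (line_points (k 0) \<inter> C)"
    and PQ: "P \<in> line_points (k 0) \<inter> C" "Q \<in> line_points (k 0) \<inter> C"
  shows "has_monodromy C (k +++ (l +++ reversepath k)) (Transposition.transpose P Q)"
proof -
  define X where "X = line_points (k 0) \<inter> C"
  have inj: "inj_on \<sigma> X"
    using card has_monodromy_image[OF k] unfolding X_def by (intro eq_card_imp_inj_on) auto
  define \<tau> where "\<tau> = the_inv_into X \<sigma>"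
  have \<tau>: "\<tau> (\<sigma> R) = R" if "R \<in> X" for R
    unfolding \<tau>_def using inj that by (rule the_inv_into_f_f)
  have "has_monodromy C (reversepath k) \<tau>"
    using \<tau> by (intro has_monodromy_reversepath[OF k card]) (simp add: X_def)
  then have "has_monodromy C (k +++ (l +++ reversepath k)) ((\<tau> \<circ> Transposition.transpose (\<sigma> P) (\<sigma> Q)) \<circ> \<sigma>)"
    using loop by (intro has_monodromy_join k l) auto
  then show ?thesis
  proof (rule has_monodromy_cong)
    fix R assume "R \<in> line_points ((k +++ (l +++ reversepath k)) 0) \<inter> C"
    then have R: "R \<in> X" by (simp add: X_def joinpaths_def)
    have "P \<in> X" "Q \<in> X" using PQ by (auto simp: X_def)
    then show "((\<tau> \<circ> Transposition.transpose (\<sigma> P) (\<sigma> Q)) \<circ> \<sigma>) R = Transposition.transpose P Q R"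
      using R inj \<tau> by (auto simp: Transposition.transpose_def inj_on_eq_iff)
  qed
qed

text \<open>The common passage from root motions to monodromy for the parallel shift, the turn about
  a point and the half turn. The permutation is prescribed through the parameters in the first and
  the last frame.\<close>

lemma framed_path:
  fixes u w :: "real \<Rightarrow> complex ^ 3"
  assumes F: "homogeneous n F" and cont: "continuous_on {0..1} u" "continuous_on {0..1} w"
    and frame: "\<And>t. t \<in> {0..1} \<Longrightarrow> cross_product (u t) (w t) \<noteq> 0"
    and w: "\<And>t. t \<in> {0..1} \<Longrightarrow> eval3 F (w t) \<noteq> 0"
    and simple: "\<And>t. t \<in> {0..1} \<Longrightarrow> rsquarefree (restrict_line F (u t) (w t))"
  shows "path (\<lambda>t. line_through (u t) (w t))"
    and "path_image (\<lambda>t. line_through (u t) (w t)) \<subseteq> transversal_lines n (zero_locus F)"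
    and "\<exists>r. root_motion (\<lambda>t. restrict_line F (u t) (w t)) 0 1 r"
    and "root_motion (\<lambda>t. restrict_line F (u t) (w t)) 0 1 r \<Longrightarrow>
      (\<And>\<zeta>. eval3 F (u 0 + \<zeta> *s w 0) = 0 \<Longrightarrow>
        \<sigma> (proj_point (u 0 + \<zeta> *s w 0)) = proj_point (u 1 + r \<zeta> 1 *s w 1)) \<Longrightarrow>
      has_monodromy (zero_locus F) (\<lambda>t. line_through (u t) (w t)) \<sigma>"
proof -
  show "path (\<lambda>t. line_through (u t) (w t))"
    unfolding line_through_def using frame by (intro path_proj_point continuous_intros cont)
  show "path_image (\<lambda>t. line_through (u t) (w t)) \<subseteq> transversal_lines n (zero_locus F)"
    unfolding path_image_def using transversal_frame_iff[OF F frame w] simple by auto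
  have deg: "degree (restrict_line F (u t) (w t)) = n" if "t \<in> {0..1}" for t
    using restrict_line_top[OF F, of "u t" "w t"] w[OF that] le_degree[of "restrict_line F (u t) (w t)" n]
    by auto
  show "\<exists>r. root_motion (\<lambda>t. restrict_line F (u t) (w t)) 0 1 r"
    using root_motion_exists[OF continuous_on_coeff_restrict_line[OF cont] deg simple] by metis
  assume r: "root_motion (\<lambda>t. restrict_line F (u t) (w t)) 0 1 r"
    and \<sigma>: "\<And>\<zeta>. eval3 F (u 0 + \<zeta> *s w 0) = 0 \<Longrightarrow>
        \<sigma> (proj_point (u 0 + \<zeta> *s w 0)) = proj_point (u 1 + r \<zeta> 1 *s w 1)"
  have pts: "line_points (line_through (u t) (w t)) \<inter> zero_locus F =
      (\<lambda>s. proj_point (u t + s *s w t)) ` roots (restrict_line F (u t) (w t))" if "t \<in> {0..1}" for t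
    using line_points_frame[OF F frame[OF that] w[OF that]] .
  define R where "R = roots (restrict_line F (u 0) (w 0))"
  \<comment> \<open>Reads off the frame parameter of a starting point, since motions are indexed by
    points and root paths by parameters.\<close>
  define g where "g = the_inv_into R (\<lambda>s. proj_point (u 0 + s *s w 0))"
  have inj: "inj_on (\<lambda>s. proj_point (u 0 + s *s w 0)) R"
    using inj_frame_points[OF frame[of 0]] inj_on_subset by auto
  have g: "g (proj_point (u 0 + s *s w 0)) = s" if "s \<in> R" for s
    unfolding g_def using inj that by (rule the_inv_into_f_f)
  define \<psi> where "\<psi> P t = proj_point (u t + r (g P) t *s w t)" for P t
  have pts0: "line_points (line_through (u 0) (w 0)) \<inter> zero_locus F =
      (\<lambda>s. proj_point (u 0 + s *s w 0)) ` R" using pts[of 0] by (simp add: R_def)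
  have "path (\<psi> P) \<and> \<psi> P 0 = P \<and> \<psi> P 1 = \<sigma> P"
    if "P \<in> line_points (line_through (u 0) (w 0)) \<inter> zero_locus F" for P
  proof -
    obtain s where s: "s \<in> R" "P = proj_point (u 0 + s *s w 0)" using \<open>P \<in> _\<close> pts0 by auto
    have gP: "g P = s" using g s by simp
    have rs: "continuous_on {0..1} (r s)" "r s 0 = s"
      using root_motionD(1,2)[OF r] s(1) by (simp_all add: R_def)
    have "continuous_on {0..1} (\<lambda>t. r s t *s w t)"
      unfolding vector_scalar_mult_def
      by (intro continuous_on_vec_lambda continuous_intros rs continuous_on_component cont)
    then have "path (\<psi> P)"
      unfolding \<psi>_def gP by (intro path_proj_point continuous_intros cont frame_point_nonzero frame)
    then show ?thesis using rs(2) s \<sigma>[of s] unfolding \<psi>_def gP by (simp add: R_def)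
  qed
  moreover have "line_points (line_through (u t) (w t)) \<inter> zero_locus F =
      (\<lambda>P. \<psi> P t) ` (line_points (line_through (u 0) (w 0)) \<inter> zero_locus F)" if t: "t \<in> {0..1}" for t
    unfolding pts[OF t] root_motionD(3)[OF r t] pts0 image_image \<psi>_def
    using g by (intro image_cong) (auto simp: R_def)
  ultimately show "has_monodromy (zero_locus F) (\<lambda>t. line_through (u t) (w t)) \<sigma>"
    by (rule has_monodromyI[of _ _ \<psi>])
qed

section \<open>Irreducible families have connected root sets\<close>

lemma coeff_linear_mult:
  "coeff ([:- z, 1:] * p) j = (case j of 0 \<Rightarrow> 0 | Suc i \<Rightarrow> coeff p i) - z * coeff p j" for z :: complex
  by (simp add: coeff_pCons split: nat.splits)

text \<open>Expanded, the right side is the sum of all products of the \<open>norm (f i)\<close>,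
  which dominates each elementary symmetric function.\<close>

lemma norm_coeff_prod_linear_le:
  fixes f :: "'i \<Rightarrow> complex"
  assumes "finite I"
  shows "norm (coeff (\<Prod>i\<in>I. [:- f i, 1:]) j) \<le> (\<Prod>i\<in>I. 1 + norm (f i))"
  using assms
proof (induction I arbitrary: j)
  case empty
  then show ?case by (cases j) auto
next
  case (insert x I)
  define p where "p = (\<Prod>i\<in>I. [:- f i, 1:])"
  define B where "B = (\<Prod>i\<in>I. 1 + norm (f i))"
  have IH: "norm (coeff p j) \<le> B" for j using insert by (simp add: p_def B_def)
  have B: "0 \<le> B" unfolding B_def by (intro prod_nonneg) (simp add: add_nonneg_nonneg)
  have 1: "norm (case j of 0 \<Rightarrow> 0 | Suc i \<Rightarrow> coeff p i) \<le> B"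
    using IH B by (cases j) auto
  have "norm (coeff ([:- f x, 1:] * p) j) \<le> norm (case j of 0 \<Rightarrow> 0 | Suc i \<Rightarrow> coeff p i) + norm (f x * coeff p j)"
    unfolding coeff_linear_mult by (rule norm_triangle_ineq4)
  also have "\<dots> \<le> B + norm (f x) * B"
    using 1 IH[of j] by (intro add_mono) (auto simp: norm_mult intro: mult_left_mono)
  finally show ?case
    unfolding prod.insert[OF insert(1,2)] p_def[symmetric] B_def[symmetric] by (simp add: algebra_simps)
qed

lemma holomorphic_on_coeff_prod_linear:
  fixes f :: "'i \<Rightarrow> complex \<Rightarrow> complex"
  assumes "finite I" "\<And>i. i \<in> I \<Longrightarrow> f i holomorphic_on B"
  shows "(\<lambda>a. coeff (\<Prod>i\<in>I. [:- f i a, 1:]) j) holomorphic_on B"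
  using assms
proof (induction I arbitrary: j)
  case empty
  then show ?case by simp
next
  case (insert x I)
  have IH: "(\<lambda>a. coeff (\<Prod>i\<in>I. [:- f i a, 1:]) j) holomorphic_on B" for j
    using insert by blast
  have "(\<lambda>a. (case j of 0 \<Rightarrow> 0 | Suc l \<Rightarrow> coeff (\<Prod>i\<in>I. [:- f i a, 1:]) l)
      - f x a * coeff (\<Prod>i\<in>I. [:- f i a, 1:]) j) holomorphic_on B"
    by (cases j) (auto intro!: holomorphic_intros IH insert.prems)
  then show ?case
    unfolding prod.insert[OF insert(1,2)] coeff_linear_mult .
qed

lemma norm_poly_le:
  fixes p :: "complex poly"
  obtains b :: "real poly" where "\<And>x. norm (poly p x) \<le> poly b (norm x)"
proof -
  have "\<exists>b. \<forall>x. norm (poly p x) \<le> poly b (norm x)"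
  proof (induction p)
    case 0
    show ?case by (intro exI[of _ 0]) simp
  next
    case (pCons a p)
    then obtain b where b: "\<And>x. norm (poly p x) \<le> poly b (norm x)" by blast
    have "norm (poly (pCons a p) x) \<le> poly (pCons (norm a) b) (norm x)" for x
      using norm_triangle_ineq[of a "x * poly p x"] mult_left_mono[OF b[of x] norm_ge_zero[of x]]
      by (simp add: norm_mult)
    then show ?case by blast
  qed
  then show thesis using that by blast
qed

lemma poly_le_power:
  fixes b :: "real poly"
  obtains K N where "\<And>x. 1 \<le> x \<Longrightarrow> poly b x \<le> K * x ^ N"
proof -
  have "poly b x \<le> (\<Sum>i\<le>degree b. \<bar>coeff b i\<bar>) * x ^ degree b" if "1 \<le> x" for x
    unfolding poly_altdef sum_distrib_right
  proof (rule sum_mono)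
    fix i assume "i \<in> {..degree b}"
    then have "x ^ i \<le> x ^ degree b" using that by (intro power_increasing) auto
    moreover have "0 \<le> x ^ i" using that by simp
    ultimately show "coeff b i * x ^ i \<le> \<bar>coeff b i\<bar> * x ^ degree b"
      by (intro mult_mono) auto
  qed
  then show thesis using that by blast
qed

lemma entire_poly_bounded_imp_poly:
  assumes "h holomorphic_on UNIV" "\<And>a. norm (h a) \<le> poly b (norm a)"
  obtains p where "\<And>a. poly p a = h a"
proof -
  obtain K N where "\<And>x. 1 \<le> x \<Longrightarrow> poly b x \<le> K * x ^ N" using poly_le_power by blast
  then have "norm (h a) \<le> K * norm a ^ N" if "1 \<le> norm a" for a
    using assms(2)[of a] that by (meson order_trans)
  then have "h a = (\<Sum>k\<le>N. (deriv ^^ k) h 0 / fact k * a ^ k)" for a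
    using Liouville_polynomial[OF assms(1)] by blast
  then have "poly (\<Sum>k\<le>N. monom ((deriv ^^ k) h 0 / fact k) k) a = h a" for a
    by (simp add: poly_sum poly_monom)
  then show thesis by (rule that)
qed

text \<open>Cauchy's root bound multiplied by the leading coefficient: the right side stays bounded
  where the leading coefficient tends to 0 and roots may escape to infinity.\<close>

lemma root_bound:
  fixes p :: "complex poly"
  assumes "poly p z = 0" "p \<noteq> 0"
  shows "norm (lead_coeff p) * (1 + norm z) \<le> 2 * norm (lead_coeff p) + (\<Sum>i<degree p. norm (coeff p i))"
proof (cases "norm z \<le> 1")
  case True
  then have "norm (lead_coeff p) * (1 + norm z) \<le> norm (lead_coeff p) * 2"
    by (intro mult_left_mono) auto
  moreover have "0 \<le> (\<Sum>i<degree p. norm (coeff p i))" by (intro sum_nonneg) simp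
  ultimately show ?thesis by simp
next
  case False
  then have z: "1 \<le> norm z" by simp
  have "degree p \<noteq> 0" using assms by (metis degree_eq_zeroE mult_zero_right pCons_0_0 poly_pCons add.right_neutral poly_0)
  then obtain m where m: "degree p = Suc m" by (cases "degree p") auto
  have "0 = (\<Sum>i\<le>degree p. coeff p i * z ^ i)" using assms by (simp add: poly_altdef)
  also have "\<dots> = lead_coeff p * z ^ degree p + (\<Sum>i<degree p. coeff p i * z ^ i)"
    by (simp add: lessThan_Suc_atMost[symmetric])
  finally have "lead_coeff p * z ^ degree p = - (\<Sum>i<degree p. coeff p i * z ^ i)"
    by (simp add: eq_neg_iff_add_eq_0)
  then have "norm (lead_coeff p) * norm z ^ degree p = norm (\<Sum>i<degree p. coeff p i * z ^ i)"
    by (metis norm_minus_cancel norm_mult norm_power)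
  also have "\<dots> \<le> (\<Sum>i<degree p. norm (coeff p i) * norm z ^ m)"
  proof (rule sum_norm_le)
    fix i assume "i \<in> {..<degree p}"
    then have "norm z ^ i \<le> norm z ^ m" using z m by (intro power_increasing) auto
    then show "norm (coeff p i * z ^ i) \<le> norm (coeff p i) * norm z ^ m"
      by (simp add: norm_mult norm_power mult_left_mono)
  qed
  finally have "(norm (lead_coeff p) * norm z) * norm z ^ m \<le> (\<Sum>i<degree p. norm (coeff p i)) * norm z ^ m"
    by (simp only: m power_Suc sum_distrib_right mult.assoc)
  moreover have "0 < norm z ^ m" using z by (intro zero_less_power) linarith
  ultimately have "norm (lead_coeff p) * norm z \<le> (\<Sum>i<degree p. norm (coeff p i))"
    by simp
  then show ?thesis using norm_ge_zero[of "lead_coeff p"] unfolding distrib_left by linarith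
qed

lemma path_component_graph:
  fixes f :: "complex \<Rightarrow> complex"
  assumes "convex B" "continuous_on B f" "a \<in> B" "b \<in> B" "\<And>x. x \<in> B \<Longrightarrow> (x, f x) \<in> X"
  shows "path_component X (a, f a) (b, f b)"
proof -
  define \<gamma> where "\<gamma> t = (linepath a b t, f (linepath a b t))" for t
  have B: "linepath a b t \<in> B" if "t \<in> {0..1}" for t
    using linepath_in_convex_hull[of a B b t] assms that by (auto simp: hull_same)
  have "path \<gamma>"
    unfolding \<gamma>_def path_def
    by (intro continuous_intros continuous_on_compose2[OF assms(2)]) (use B in auto)
  moreover have "path_image \<gamma> \<subseteq> X" using B assms(5) by (auto simp: \<gamma>_def path_image_def)
  moreover have "pathstart \<gamma> = (a, f a)" "pathfinish \<gamma> = (b, f b)"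
    by (simp_all add: \<gamma>_def pathstart_def pathfinish_def linepath_def)
  ultimately show ?thesis unfolding path_component_def by blast
qed

text \<open>If the roots in one path component of the curve were only part of all roots, then the product
  of the corresponding linear factors, cleared of denominators, would be a polynomial that vanishes
  on that component and has too small a degree.\<close>

lemma path_connected_root_set:
  fixes g :: "complex poly poly" and D :: "complex set"
  assumes D: "finite D"
    and lead: "\<And>a. a \<notin> D \<Longrightarrow> poly (lead_coeff g) a \<noteq> 0"
    and simple: "\<And>a. a \<notin> D \<Longrightarrow> rsquarefree (specialize g a)"
    and min: "\<And>A Z. A \<noteq> 0 \<Longrightarrow> infinite (fst ` Z) \<Longrightarrow>
      (\<And>a z. (a, z) \<in> Z \<Longrightarrow> a \<notin> D \<and> poly (specialize g a) z = 0 \<and> poly (specialize A a) z = 0) \<Longrightarrow>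
      degree g \<le> degree A"
  shows "path_connected {(a, z). a \<notin> D \<and> poly (specialize g a) z = 0}"
proof -
  define X where "X = {(a, z). a \<notin> D \<and> poly (specialize g a) z = 0}"
  define m where "m = degree g"
  define U where "U = - D"
  have U: "open U" unfolding U_def using D by (simp add: finite_imp_closed open_Compl)
  have connU: "connected U" unfolding U_def using D
    by (intro connected_open_diff_countable[of UNIV, simplified Compl_eq_Diff_UNIV[symmetric]])
       (auto intro: countable_finite)
  have deg: "degree (specialize g a) = m" if "a \<in> U" for a
  proof -
    have "degree (specialize g a) \<le> m"
      by (rule degree_le) (simp add: m_def coeff_eq_0)
    moreover have "m \<le> degree (specialize g a)"
      using lead that by (intro le_degree) (simp add: m_def U_def)
    ultimately show ?thesis by simp
  qed
  have simpleU: "rsquarefree (specialize g a)" if "a \<in> U" for a using simple that by (simp add: U_def)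
  have fin: "finite (roots (specialize g a))" if "a \<in> U" for a
    using simpleU[OF that] by (intro poly_roots_finite) (simp add: rsquarefree_def)
  have "path_component X x0 x1" if x0: "x0 \<in> X" and x1: "x1 \<in> X" for x0 x1
  proof (rule ccontr)
    assume not: "\<not> path_component X x0 x1"
    \<comment> \<open>The part of the fibre over \<open>a\<close> that lies in the path component of
      \<open>x0\<close>; \<open>Q a\<close> below is the corresponding monic factor.\<close>
    define E where "E a = {z. path_component X x0 (a, z)}" for a
    have E: "E a \<subseteq> roots (specialize g a)" for a
      using path_component_mem(2) by (fastforce simp: E_def X_def)
    have finE: "finite (E a)" if "a \<in> U" for a using finite_subset[OF E fin[OF that]] .
    define Q where "Q a = (\<Prod>z\<in>E a. [:- z, 1:])" for a
    \<comment> \<open>Over a small ball the root branches are paths inside the curve, so they carry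
      \<open>E a1\<close> bijectively to \<open>E a\<close> and make the coefficients of
      \<open>Q\<close> holomorphic.\<close>
    have local: "\<exists>B. open B \<and> a1 \<in> B \<and> (\<forall>a\<in>B. card (E a) = card (E a1)) \<and>
        (\<forall>j. (\<lambda>a. coeff (Q a) j) holomorphic_on B)" if a1: "a1 \<in> U" for a1
    proof -
      have cont: "continuous_on U (\<lambda>a. coeff (specialize g a) j)" for j
        by (simp add: continuous_intros)
      obtain V r where V: "open V" "a1 \<in> V"
        and rc: "\<And>\<zeta>. \<zeta> \<in> roots (specialize g a1) \<Longrightarrow> continuous_on (U \<inter> V) (r \<zeta>)"
        and ra1: "\<And>\<zeta>. \<zeta> \<in> roots (specialize g a1) \<Longrightarrow> r \<zeta> a1 = \<zeta>"
        and rr: "\<And>x. x \<in> U \<inter> V \<Longrightarrow> roots (specialize g x) = (\<lambda>\<zeta>. r \<zeta> x) ` roots (specialize g a1)"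
        and rinj: "\<And>x. x \<in> U \<inter> V \<Longrightarrow> inj_on (\<lambda>\<zeta>. r \<zeta> x) (roots (specialize g a1))"
        using local_root_sections[OF cont deg simpleU a1] by blast
      obtain d where d: "d > 0" "ball a1 d \<subseteq> U \<inter> V"
        using openE[of "U \<inter> V" a1] U V a1 by blast
      have root: "poly (specialize g a) (r \<zeta> a) = 0" if "a \<in> ball a1 d" "\<zeta> \<in> roots (specialize g a1)" for a \<zeta>
        using rr[of a] that d(2) by blast
      have hol: "r \<zeta> holomorphic_on ball a1 d" if \<zeta>: "\<zeta> \<in> roots (specialize g a1)" for \<zeta>
      proof (rule holomorphic_on_simple_root[where n = m])
        show "(\<lambda>a. coeff (specialize g a) j) holomorphic_on ball a1 d" for j
          by (simp add: holomorphic_intros)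
        show "degree (specialize g a) \<le> m" if "a \<in> ball a1 d" for a using deg[of a] that d(2) by auto
        show "continuous_on (ball a1 d) (r \<zeta>)" using rc[OF \<zeta>] d(2) continuous_on_subset by blast
        show "poly (specialize g a) (r \<zeta> a) = 0" if "a \<in> ball a1 d" for a using root[OF that \<zeta>] .
        show "poly (pderiv (specialize g a)) (r \<zeta> a) \<noteq> 0" if "a \<in> ball a1 d" for a
          using root[OF that \<zeta>] simpleU[of a] that d(2) unfolding rsquarefree_roots by blast
      qed simp
      have comp: "path_component X (a1, \<zeta>) (a, r \<zeta> a)"
        if a: "a \<in> ball a1 d" and \<zeta>: "\<zeta> \<in> roots (specialize g a1)" for a \<zeta>
      proof -
        have "path_component X (a1, r \<zeta> a1) (a, r \<zeta> a)"
        proof (rule path_component_graph)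
          show "continuous_on (ball a1 d) (r \<zeta>)" using rc[OF \<zeta>] d(2) continuous_on_subset by blast
          show "(x, r \<zeta> x) \<in> X" if "x \<in> ball a1 d" for x
            using root[OF that \<zeta>] d(2) that by (auto simp: X_def U_def)
        qed (use a d in auto)
        then show ?thesis using ra1[OF \<zeta>] by simp
      qed
      have Ea: "E a = (\<lambda>\<zeta>. r \<zeta> a) ` E a1" if a: "a \<in> ball a1 d" for a
      proof (intro equalityI subsetI)
        fix z assume z: "z \<in> E a"
        then have "z \<in> roots (specialize g a)" using E by blast
        then obtain \<zeta> where \<zeta>: "\<zeta> \<in> roots (specialize g a1)" "z = r \<zeta> a" using rr[of a] a d(2) by blast
        have "path_component X x0 (a1, \<zeta>)"
          using z comp[OF a \<zeta>(1)] unfolding E_def \<zeta>(2)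
          by (metis mem_Collect_eq path_component_sym path_component_trans)
        then show "z \<in> (\<lambda>\<zeta>. r \<zeta> a) ` E a1" using \<zeta>(2) by (simp add: E_def)
      next
        fix z assume "z \<in> (\<lambda>\<zeta>. r \<zeta> a) ` E a1"
        then obtain \<zeta> where \<zeta>: "path_component X x0 (a1, \<zeta>)" "\<zeta> \<in> E a1" "z = r \<zeta> a" by (auto simp: E_def)
        then have "\<zeta> \<in> roots (specialize g a1)" using E by blast
        from path_component_trans[OF \<zeta>(1) comp[OF a this]] show "z \<in> E a" by (simp add: E_def \<zeta>(3))
      qed
      have inj: "inj_on (\<lambda>\<zeta>. r \<zeta> a) (E a1)" if "a \<in> ball a1 d" for a
        using inj_on_subset[OF rinj E, of a] that d(2) by blast
      have "card (E a) = card (E a1)" if "a \<in> ball a1 d" for a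
        unfolding Ea[OF that] using inj[OF that] by (rule card_image)
      moreover have "(\<lambda>a. coeff (Q a) j) holomorphic_on ball a1 d" for j
      proof (rule holomorphic_transform)
        show "(\<lambda>a. coeff (\<Prod>\<zeta>\<in>E a1. [:- r \<zeta> a, 1:]) j) holomorphic_on ball a1 d"
          using finE[OF a1] hol E by (intro holomorphic_on_coeff_prod_linear) blast+
        show "coeff (\<Prod>\<zeta>\<in>E a1. [:- r \<zeta> a, 1:]) j = coeff (Q a) j" if "a \<in> ball a1 d" for a
          unfolding Q_def Ea[OF that] prod.reindex[OF inj[OF that]] by simp
      qed
      moreover have "a1 \<in> ball a1 d" using d(1) by simp
      ultimately show ?thesis using open_ball by blast
    qed
    obtain a0 z0 where az0: "x0 = (a0, z0)" by (cases x0)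
    obtain a1 z1 where az1: "x1 = (a1, z1)" by (cases x1)
    have a0: "a0 \<in> U" and a1: "a1 \<in> U" using x0 x1 by (auto simp: az0 az1 X_def U_def)
    define k where "k = card (E a0)"
    have k: "card (E a) = k" if "a \<in> U" for a
    proof -
      have "card (E a) = card (E a0)"
      proof (rule connected_local_const[OF connU that a0], rule ballI)
        fix a assume "a \<in> U"
        then obtain B where B: "open B" "a \<in> B" "\<forall>a'\<in>B. card (E a') = card (E a)" using local by blast
        have "card (E a) = card (E b)" if "b \<in> B" for b
          by (rule bspec[OF B(3) that, symmetric])
        then show "eventually (\<lambda>b. card (E a) = card (E b)) (at a within U)"
          unfolding eventually_at_topological using B(1,2) by blast
      qed
      then show ?thesis by (simp add: k_def)
    qed
    have "z0 \<in> E a0" using x0 by (simp add: E_def az0 path_component_refl)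
    then have kpos: "k > 0" using finE[OF a0] by (auto simp: k_def card_gt_0_iff)
    have "z1 \<in> roots (specialize g a1)" "z1 \<notin> E a1" using x1 not by (auto simp: E_def az1 X_def)
    then have "card (E a1) < card (roots (specialize g a1))"
      using E fin[OF a1] by (intro psubset_card_mono) auto
    then have km: "k < m"
      using k[OF a1] card_roots_rsquarefree[OF simpleU[OF a1]] deg[OF a1] by simp
    define c where "c = lead_coeff g"
    \<comment> \<open>A polynomial vanishing exactly at the exceptional parameters; as a factor it
      allows extension by zero across them.\<close>
    define W where "W = (\<Prod>d\<in>D. [:- d, 1:])"
    have W: "poly W a = 0 \<longleftrightarrow> a \<in> D" for a
      using D by (auto simp: W_def poly_prod)
    obtain cb where cb: "\<And>x. norm (poly c x) \<le> poly cb (norm x)" using norm_poly_le by blast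
    obtain Wb where Wb: "\<And>x. norm (poly W x) \<le> poly Wb (norm x)" using norm_poly_le by blast
    have "\<exists>gb. \<forall>x. norm (poly (coeff g i) x) \<le> poly gb (norm x)" for i using norm_poly_le[of "coeff g i"] by blast
    then obtain gb where gb: "\<And>i x. norm (poly (coeff g i) x) \<le> poly (gb i) (norm x)" by metis
    \<comment> \<open>The right side of \<open>root_bound\<close>: continuous on the whole plane,
      including \<open>D\<close>, and of polynomial growth.\<close>
    define H where "H a = 2 * norm (poly c a) + (\<Sum>i<m. norm (poly (coeff g i) a))" for a
    have H0: "0 \<le> H a" for a unfolding H_def by (intro add_nonneg_nonneg sum_nonneg) auto
    define Hb where "Hb = smult 2 cb + (\<Sum>i<m. gb i)"
    have Hb: "H a \<le> poly Hb (norm a)" for a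
      unfolding H_def Hb_def poly_add poly_sum poly_smult using cb gb by (intro add_mono sum_mono mult_left_mono) auto
    have bound: "norm (poly c a ^ k * coeff (Q a) j) \<le> H a ^ k" if a: "a \<in> U" for a j
    proof -
      have "norm (coeff (Q a) j) \<le> (\<Prod>z\<in>E a. 1 + norm z)"
        unfolding Q_def using finE[OF a] by (rule norm_coeff_prod_linear_le)
      then have "norm (poly c a ^ k * coeff (Q a) j) \<le> norm (poly c a) ^ k * (\<Prod>z\<in>E a. 1 + norm z)"
        by (simp add: norm_mult norm_power mult_left_mono)
      also have "\<dots> = (\<Prod>z\<in>E a. norm (poly c a) * (1 + norm z))"
        using k[OF a] by (simp add: prod.distrib)
      also have "\<dots> \<le> (\<Prod>z\<in>E a. H a)"
      proof (rule prod_mono)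
        fix z assume "z \<in> E a"
        then have z: "poly (specialize g a) z = 0" using E by blast
        have "specialize g a \<noteq> 0" using simpleU[OF a] by (simp add: rsquarefree_def)
        from root_bound[OF z this] deg[OF a]
        show "0 \<le> norm (poly c a) * (1 + norm z) \<and> norm (poly c a) * (1 + norm z) \<le> H a"
          by (simp add: H_def c_def m_def)
      qed
      also have "\<dots> = H a ^ k" using k[OF a] by simp
      finally show ?thesis .
    qed
    \<comment> \<open>One factor \<open>poly c a\<close> for each of the \<open>k\<close> roots
      keeps the coefficient bounded near \<open>D\<close>, and \<open>W\<close> makes 0 the
      continuous value there. The singularities are removable, and polynomial growth makes
      \<open>h j\<close> a polynomial.\<close>
    define h where "h j a = (if a \<in> D then 0 else poly W a * (poly c a ^ k * coeff (Q a) j))" for j a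
    have hbound: "norm (h j a) \<le> norm (poly W a) * H a ^ k" for j a
      using bound[of a j] H0[of a] by (auto simp: h_def U_def norm_mult intro: mult_left_mono)
    have "\<exists>p. \<forall>a. poly p a = h j a" for j
    proof -
      have "h j field_differentiable (at a)" if "a \<in> U" for a
      proof -
        obtain B where B: "open B" "a \<in> B" "(\<lambda>a. coeff (Q a) j) holomorphic_on B" using local[OF \<open>a \<in> U\<close>] by blast
        have "(\<lambda>a. poly W a * (poly c a ^ k * coeff (Q a) j)) holomorphic_on (B \<inter> U)"
          by (intro holomorphic_intros holomorphic_on_subset[OF B(3)]) auto
        then have "h j holomorphic_on (B \<inter> U)"
          by (rule holomorphic_transform) (simp add: h_def U_def)
        then show ?thesis
          by (rule holomorphic_on_imp_differentiable_at) (use B(1,2) U that in auto)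
      qed
      then have hol: "h j holomorphic_on (UNIV - D)"
        unfolding holomorphic_on_def U_def
        by (auto intro: field_differentiable_at_within)
      have "continuous_on UNIV (h j)"
      proof (rule continuous_at_imp_continuous_on, rule ballI)
        fix a
        show "isCont (h j) a"
        proof (cases "a \<in> D")
          case False
          then show ?thesis
            using \<open>\<And>a. a \<in> U \<Longrightarrow> h j field_differentiable (at a)\<close>
            by (auto simp: U_def intro: field_differentiable_imp_continuous_at)
        next
          case True
          have "((\<lambda>x. norm (poly W x) * H x ^ k) \<longlongrightarrow> norm (poly W a) * H a ^ k) (at a)"
            unfolding H_def by (intro tendsto_intros)
          then have "((\<lambda>x. norm (poly W x) * H x ^ k) \<longlongrightarrow> 0) (at a)"
            using W[of a] True by simp
          then have "(h j \<longlongrightarrow> 0) (at a)"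
            using hbound by (intro Lim_null_comparison[of "h j" "\<lambda>x. norm (poly W x) * H x ^ k"]) auto
          then show ?thesis using True by (simp add: isCont_def h_def)
        qed
      qed
      then have "h j holomorphic_on UNIV"
        by (rule no_isolated_singularity[OF _ hol open_UNIV D])
      moreover have "norm (h j a) \<le> poly (Wb * Hb ^ k) (norm a)" for a
      proof -
        have "norm (poly W a) * H a ^ k \<le> poly Wb (norm a) * poly Hb (norm a) ^ k"
          by (intro mult_mono power_mono zero_le_power Wb Hb H0 order_trans[OF norm_ge_zero Wb])
        then show ?thesis using hbound[of j a] by (simp add: poly_power)
      qed
      ultimately show ?thesis using entire_poly_bounded_imp_poly by metis
    qed
    then obtain p where p: "\<And>j a. poly (p j) a = h j a" by metis
    \<comment> \<open>Over \<open>U\<close> this specialises to a nonzero multiple of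
      \<open>Q a\<close>, so it vanishes on the component although its degree is at most
      \<open>k\<close>.\<close>
    define A where "A = (\<Sum>j\<le>k. monom (p j) j)"
    have coeffA: "coeff A j = (if j \<le> k then p j else 0)" for j
      by (simp add: A_def coeff_sum)
    have Q: "degree (Q a) = k" "lead_coeff (Q a) = 1" if "a \<in> U" for a
    proof -
      show "degree (Q a) = k" using k[OF that] by (simp add: Q_def degree_prod_eq_sum_degree)
      show "lead_coeff (Q a) = 1" unfolding Q_def lead_coeff_prod by simp
    qed
    have spA: "specialize A a = smult (poly W a * poly c a ^ k) (Q a)" if "a \<in> U" for a
    proof (rule poly_eqI)
      fix j
      show "coeff (specialize A a) j = coeff (smult (poly W a * poly c a ^ k) (Q a)) j"
        using that Q(1)[OF that] by (simp add: coeffA p h_def U_def coeff_eq_0)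
    qed
    have "specialize A a0 \<noteq> 0"
      using spA[OF a0] lead[of a0] a0 W[of a0] Q(2)[OF a0] by (auto simp: U_def c_def)
    then have "A \<noteq> 0" by (auto simp: specialize_def)
    have fstZ: "fst ` {x. path_component X x0 x} = U"
    proof (intro equalityI subsetI)
      fix a assume "a \<in> fst ` {x. path_component X x0 x}"
      then show "a \<in> U" using path_component_mem(2) by (fastforce simp: X_def U_def)
    next
      fix a assume "a \<in> U"
      then have "E a \<noteq> {}" using k kpos by force
      then show "a \<in> fst ` {x. path_component X x0 x}" by (force simp: E_def)
    qed
    have "infinite U" unfolding U_def using D by (simp add: infinite_UNIV_char_0 Compl_eq_Diff_UNIV)
    have "m \<le> degree A"
      unfolding m_def
    proof (rule min[OF \<open>A \<noteq> 0\<close>])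
      show "infinite (fst ` {x. path_component X x0 x})" unfolding fstZ by fact
      fix a z assume az: "(a, z) \<in> {x. path_component X x0 x}"
      then have "(a, z) \<in> X" "z \<in> E a" using path_component_mem(2) by (auto simp: E_def)
      moreover from this have "a \<in> U" by (auto simp: X_def U_def)
      ultimately show "a \<notin> D \<and> poly (specialize g a) z = 0 \<and> poly (specialize A a) z = 0"
        using finE by (auto simp: X_def spA Q_def poly_prod)
    qed
    moreover have "degree A \<le> k" by (rule degree_le) (simp add: coeffA)
    ultimately show False using km by simp
  qed
  then show ?thesis unfolding path_connected_component X_def[symmetric] by blast
qed

section \<open>Moving one point in the pencil of lines through another\<close>

lemma rsquarefree_mult_left:
  fixes p q :: "complex poly"
  assumes "rsquarefree (p * q)"
  shows "rsquarefree p"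
  using assms unfolding rsquarefree_roots by (auto simp: pderiv_mult)

lemma eventually_imp_infinite:
  fixes a :: complex
  assumes "eventually P (at a)"
  shows "infinite {x. P x}"
proof
  assume "finite {x. P x}"
  then have "\<not> a islimpt {x. P x}" by (rule islimpt_finite)
  then have "eventually (\<lambda>x. \<not> P x) (at a)" by (simp add: islimpt_iff_eventually)
  with assms have "eventually (\<lambda>x. False) (at a)" by eventually_elim simp
  then show False by simp
qed

text \<open>By continuity of roots all parameters near 0 are good as well. These are infinitely
  many, as \<open>finite_degenerate_parameters\<close> requires.\<close>

lemma finite_degenerate_pencil:
  assumes F: "homogeneous n F" and good: "eval3 F w \<noteq> 0" "rsquarefree (restrict_line F u w)"
  shows "finite {a. \<not> (eval3 F (w + a *s w') \<noteq> 0 \<and> rsquarefree (restrict_line F (u + a *s u') (w + a *s w')))}"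
proof -
  obtain p where p: "degree p \<le> n" "\<And>a. specialize p a = restrict_line F (u + a *s u') (w + a *s w')"
    using pencil_polynomial[OF F, of u u' w w'] by blast
  have cn: "poly (coeff p n) a = eval3 F (w + a *s w')" for a
    using restrict_line_top(2)[OF F] by (metis coeff_specialize p(2))
  have p0: "specialize p 0 = restrict_line F u w" unfolding p(2) by simp
  have "eventually (\<lambda>a. degree (specialize p a) = n \<and> rsquarefree (specialize p a)) (at 0)"
  proof -
    have "degree (restrict_line F u w) = n"
      using restrict_line_top[OF F, of u w] good(1) le_degree[of "restrict_line F u w" n] by auto
    moreover have "finite (roots (specialize p 0))"
      unfolding p0 using good(2) by (intro poly_roots_finite) (simp add: rsquarefree_def)
    moreover obtain e where "e > 0" "\<And>x y z. x \<in> roots (specialize p 0) \<Longrightarrow> y \<in> roots (specialize p 0) \<Longrightarrow>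
        dist x z < e \<Longrightarrow> dist y z < e \<Longrightarrow> x = y"
      using separating_radius[OF \<open>finite (roots (specialize p 0))\<close>] by metis
    moreover have "((\<lambda>x. coeff (specialize p x) j) \<longlongrightarrow> coeff (specialize p 0) j) (at 0)" for j
      unfolding coeff_specialize by (intro tendsto_intros)
    moreover have "eventually (\<lambda>x. degree (specialize p x) \<le> n) (at 0)"
      unfolding p(2) using restrict_line_top(1)[OF F] by simp
    ultimately have "eventually (\<lambda>x. degree (specialize p x) = n \<and> rsquarefree (specialize p x) \<and>
      (\<exists>f. inj_on f (roots (specialize p 0)) \<and> roots (specialize p x) = f ` roots (specialize p 0) \<and>
      (\<forall>\<zeta>\<in>roots (specialize p 0). \<forall>z\<in>roots (specialize p x). dist \<zeta> z < e \<longleftrightarrow> z = f \<zeta>))) (at 0)"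
      using good(2) unfolding p0 by (intro eventually_roots_near) blast+
    then show ?thesis by eventually_elim blast
  qed
  then have "eventually (\<lambda>a. poly (coeff p n) a \<noteq> 0 \<and> rsquarefree (specialize p a)) (at 0)"
  proof eventually_elim
    case (elim a)
    then have "coeff (specialize p a) n \<noteq> 0" by (metis leading_coeff_0_iff rsquarefree_def)
    then show ?case using elim by simp
  qed
  then have "infinite {a. poly (coeff p n) a \<noteq> 0 \<and> rsquarefree (specialize p a)}"
    by (rule eventually_imp_infinite)
  from finite_degenerate_parameters[OF this] show ?thesis unfolding cn p(2) .
qed

lemma poly_specialize_1: "poly (poly (map_poly (\<lambda>c. specialize c 1) G) [:z:]) a = eval3 G (vector [1, a, z])"
proof (induction G)
  case 0
  then show ?case by simp
next
  case (pCons c G)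
  have "specialize 0 1 = 0" by (simp add: specialize_def)
  then show ?case using pCons by (simp add: map_poly_pCons eval3_def poly_specialize)
qed

text \<open>In the basis \<open>w\<close>, \<open>w'\<close>, \<open>u\<close> the parameter
  \<open>a\<close> selects a line through \<open>u\<close> and \<open>z\<close> runs along it with
  \<open>u\<close> at infinity. Since \<open>G\<close> vanishes at \<open>u\<close>, the polynomial
  in \<open>z\<close> has degree \<open>d - 1\<close>, and its roots are the points of
  \<open>G\<close> on the line other than \<open>u\<close>. Irreducibility connects them over the
  good parameters.\<close>

lemma pencil_root_path:
  assumes F: "homogeneous n F" and G: "irreducible G" "G dvd F" "homogeneous d G"
    and indep: "(\<Sum>i\<in>UNIV. cross_product w w' $ i * u $ i) \<noteq> 0"
    and good0: "eval3 F w \<noteq> 0" "rsquarefree (restrict_line F u w)"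
    and good1: "eval3 F (w + w') \<noteq> 0" "rsquarefree (restrict_line F u (w + w'))"
    and u: "eval3 G u = 0"
    and s0: "s0 \<noteq> 0" "eval3 G (u + s0 *s w) = 0"
    and s1: "s1 \<noteq> 0" "eval3 G (u + s1 *s (w + w')) = 0"
  obtains a s :: "real \<Rightarrow> complex" where "continuous_on {0..1} a" "continuous_on {0..1} s"
    "a 0 = 0" "a 1 = 1" "s 0 = s0" "s 1 = s1"
    "\<And>t. t \<in> {0..1} \<Longrightarrow> eval3 F (w + a t *s w') \<noteq> 0"
    "\<And>t. t \<in> {0..1} \<Longrightarrow> rsquarefree (restrict_line F u (w + a t *s w'))"
    "\<And>t. t \<in> {0..1} \<Longrightarrow> eval3 F (u + s t *s (w + a t *s w')) = 0"
proof -
  obtain H where FH: "F = G * H" using G(2) by (elim dvdE)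
  define D where "D = {a. \<not> (eval3 F (w + a *s w') \<noteq> 0 \<and> rsquarefree (restrict_line F u (w + a *s w')))}"
  have D: "finite D" unfolding D_def using finite_degenerate_pencil[OF F good0, where u' = 0 and w' = w'] by simp
  have "invertible (columns3 w w' u)" using indep by (rule invertible_columns3)
  define G' where "G' = linear_subst (columns3 w w' u) G"
  have irr: "irreducible G'" unfolding G'_def using \<open>invertible (columns3 w w' u)\<close> G(1) by (rule irreducible_linear_subst)
  have G': "eval3 G' (vector [x, y, z]) = eval3 G (x *s w + y *s w' + z *s u)" for x y z
    by (simp add: G'_def eval3_linear_subst columns3_mult)
  define g where "g = map_poly (\<lambda>c. specialize c 1) G'"
  have g: "poly (specialize g a) z = eval3 G (w + a *s w' + z *s u)" for a z
    by (simp add: poly_specialize g_def poly_specialize_1 G')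
  have spg: "specialize g a = restrict_line G (w + a *s w') u" for a
    by (simp add: poly_eq_poly_eq_iff[symmetric] fun_eq_iff g)
  \<comment> \<open>The two parameters along a line through \<open>u\<close> are reciprocal:
    \<open>s = 1 / z\<close>.\<close>
  have inv: "eval3 G (w + a *s w' + z *s u) = z ^ d * eval3 G (u + (1 / z) *s (w + a *s w'))" if "z \<noteq> 0" for a z
  proof -
    have "w + a *s w' + z *s u = z *s (u + (1 / z) *s (w + a *s w'))"
      using that by (simp add: vec_eq_iff algebra_simps)
    then show ?thesis by (metis eval3_scale[OF G(3)])
  qed
  have nonroot: "eval3 G (w + a *s w') \<noteq> 0" if "a \<notin> D" for a using that by (auto simp: D_def FH)
  have good: "degree (specialize g a) = d - 1 \<and> rsquarefree (specialize g a)" if a: "a \<notin> D" for a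
  proof -
    define h where "h = restrict_line G u (w + a *s w')"
    have h: "rsquarefree h"
      using a unfolding D_def h_def FH restrict_line_mult by (auto intro: rsquarefree_mult_left)
    have "degree h = d"
      using restrict_line_top[OF G(3), of u "w + a *s w'"] nonroot[OF a] le_degree[of h d]
      by (auto simp: h_def)
    then have cardh: "card (roots h) = d" using card_roots_rsquarefree[OF h] by simp
    have fin: "finite (roots h)" using h by (intro poly_roots_finite) (simp add: rsquarefree_def)
    have "0 \<in> roots h" using u by (simp add: h_def)
    then have card: "card (roots h - {0}) = d - 1" "d > 0"
      using cardh fin card_Diff_singleton[of 0 "roots h"] card_gt_0_iff[of "roots h"] by blast+
    have sub: "inverse ` (roots h - {0}) \<subseteq> roots (specialize g a)"
    proof (rule image_subsetI)
      fix s assume s: "s \<in> roots h - {0}"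
      then have "eval3 G (u + (1 / inverse s) *s (w + a *s w')) = 0"
        unfolding h_def by (simp only: poly_restrict_line inverse_eq_divide div_by_1 divide_divide_eq_right mult_1_left) simp
      then show "inverse s \<in> roots (specialize g a)" using s inv[of "inverse s" a] by (simp add: g)
    qed
    have nz: "specialize g a \<noteq> 0"
      using g[of a 0] nonroot[OF a] by auto
    \<comment> \<open>The coefficient of the \<open>d\<close>-th power is the value of
      \<open>G\<close> at \<open>u\<close>, which is 0.\<close>
    have "degree (specialize g a) \<le> d" "coeff (specialize g a) d = 0"
      using restrict_line_top[OF G(3), of "w + a *s w'" u] u by (auto simp: spg)
    then have "degree (specialize g a) \<noteq> d" using nz by (metis leading_coeff_0_iff)
    then have "degree (specialize g a) \<le> card (roots h - {0})"
      using \<open>degree (specialize g a) \<le> d\<close> card by simp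
    from roots_eq_image_if_inj(2,3)[OF nz this _ _ sub] show ?thesis
      using card(1) fin by (simp add: inj_on_def)
  qed
  have infD: "infinite (- D)" using D by (simp add: infinite_UNIV_char_0 Compl_eq_Diff_UNIV)
  have degg: "degree g = d - 1"
  proof (rule antisym)
    show "degree g \<le> d - 1"
    proof (rule degree_le, intro allI impI)
      fix j assume j: "d - 1 < j"
      have "poly (coeff g j) a = 0" if "a \<in> - D" for a
        using good[of a] that j coeff_eq_0[of "specialize g a" j] by simp
      then show "coeff g j = 0" by (rule poly_eq_0_if_infinite_roots[OF infD])
    qed
    obtain a where a: "a \<notin> D" using infD by (metis ComplI Compl_iff finite.emptyI ex_in_conv)
    have "degree (specialize g a) \<le> degree g" by (rule degree_le) (simp add: coeff_eq_0)
    then show "d - 1 \<le> degree g" using good[OF a] by simp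
  qed
  define X where "X = {(a, z). a \<notin> D \<and> poly (specialize g a) z = 0}"
  have "path_connected X"
    unfolding X_def
  proof (rule path_connected_root_set[OF D])
    show "poly (lead_coeff g) a \<noteq> 0" if "a \<notin> D" for a
      using good[OF that] degg by (metis coeff_specialize leading_coeff_0_iff rsquarefree_def)
    show "rsquarefree (specialize g a)" if "a \<notin> D" for a using good[OF that] by blast
    fix A :: "complex poly poly" and Z
    assume A: "A \<noteq> 0" "infinite (fst ` Z)"
      "\<And>a z. (a, z) \<in> Z \<Longrightarrow> a \<notin> D \<and> poly (specialize g a) z = 0 \<and> poly (specialize A a) z = 0"
    have "degree g \<le> degree G'" unfolding g_def by (rule map_poly_degree_leq)
    also have "\<dots> \<le> degree A"
    proof (rule degree_le_if_vanishing_on_cone[OF irr A(2) _ A(1)])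
      fix a z c assume "(a, z) \<in> Z"
      then have "eval3 G (w + a *s w' + z *s u) = 0" using A(3) g by auto
      moreover have "eval3 G' (vector [c, c * a, c * z]) = eval3 G (c *s (w + a *s w' + z *s u))"
        unfolding G' by (rule arg_cong[where f = "eval3 G"]) (simp add: vec_eq_iff algebra_simps)
      ultimately show "eval3 G' (vector [c, c * a, c * z]) = 0"
        by (simp only: eval3_scale[OF G(3)] mult_zero_right)
    qed (use A(3) in blast)
    finally show "degree g \<le> degree A" .
  qed
  moreover have "(0, 1 / s0) \<in> X"
    using good0 s0 inv[of "1 / s0" 0] by (simp add: X_def D_def g)
  moreover have "(1, 1 / s1) \<in> X"
    using good1 s1 inv[of "1 / s1" 1] by (simp add: X_def D_def g)
  ultimately obtain \<gamma> where \<gamma>: "path \<gamma>" "path_image \<gamma> \<subseteq> X" "pathstart \<gamma> = (0, 1 / s0)" "pathfinish \<gamma> = (1, 1 / s1)"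
    unfolding path_connected_def by metis
  have X: "fst (\<gamma> t) \<notin> D" "eval3 G (w + fst (\<gamma> t) *s w' + snd (\<gamma> t) *s u) = 0" if "t \<in> {0..1}" for t
  proof -
    have "(fst (\<gamma> t), snd (\<gamma> t)) \<in> X" using \<gamma>(2) that by (auto simp: path_image_def)
    then show "fst (\<gamma> t) \<notin> D" "eval3 G (w + fst (\<gamma> t) *s w' + snd (\<gamma> t) *s u) = 0"
      unfolding X_def mem_Collect_eq prod.case g by blast+
  qed
  \<comment> \<open>The value 0 would be the point \<open>w + a *s w'\<close>, which is off the
    curve for good \<open>a\<close>; hence the reciprocal is defined along the path.\<close>
  have nz: "snd (\<gamma> t) \<noteq> 0" if "t \<in> {0..1}" for t
    using X[OF that] nonroot by fastforce
  have cont: "continuous_on {0..1} \<gamma>" using \<gamma>(1) by (simp add: path_def)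
  show thesis
  proof (rule that[of "\<lambda>t. fst (\<gamma> t)" "\<lambda>t. 1 / snd (\<gamma> t)"])
    show "continuous_on {0..1} (\<lambda>t. fst (\<gamma> t))" "continuous_on {0..1} (\<lambda>t. 1 / snd (\<gamma> t))"
      using nz by (auto intro!: continuous_intros cont)
    show "fst (\<gamma> 0) = 0" "fst (\<gamma> 1) = 1" "1 / snd (\<gamma> 0) = s0" "1 / snd (\<gamma> 1) = s1"
      using \<gamma>(3,4) by (simp_all add: pathstart_def pathfinish_def)
    fix t :: real assume t: "t \<in> {0..1}"
    show "eval3 F (w + fst (\<gamma> t) *s w') \<noteq> 0" "rsquarefree (restrict_line F u (w + fst (\<gamma> t) *s w'))"
      using X(1)[OF t] by (auto simp: D_def)
    show "eval3 F (u + (1 / snd (\<gamma> t)) *s (w + fst (\<gamma> t) *s w')) = 0"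
      using X(2)[OF t] inv[OF nz[OF t]] nz[OF t] by (simp add: FH)
  qed
qed

section \<open>An arc on the curve and its tangent lines\<close>

lemma triple_product_nonzero_exists:
  assumes "cross_product u w \<noteq> 0"
  obtains v where "(\<Sum>i\<in>UNIV. cross_product u w $ i * v $ i) \<noteq> 0"
proof -
  \<comment> \<open>With the conjugate vector the pairing is a sum of squared moduli.\<close>
  define v :: "complex ^ 3" where "v = (\<chi> i. cnj (cross_product u w $ i))"
  have "(\<Sum>i\<in>UNIV. cross_product u w $ i * v $ i) =
      of_real (\<Sum>i\<in>UNIV. (cmod (cross_product u w $ i))\<^sup>2)"
    by (simp only: v_def vec_lambda_beta complex_norm_square of_real_sum)
  moreover have "(\<Sum>i\<in>UNIV. (cmod (cross_product u w $ i))\<^sup>2) \<noteq> 0"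
    using assms by (subst sum_nonneg_eq_0_iff) (auto simp: vec_eq_iff)
  ultimately show thesis using that by (metis of_real_eq_0_iff)
qed

text \<open>Move the line to the zero set of the last variable. If \<open>G\<close> vanished on it,
  that variable would divide the irreducible polynomial, leaving a multiple of a linear form,
  against \<open>d \<ge> 2\<close>.\<close>

lemma restrict_line_irreducible_nonzero:
  assumes G: "irreducible G" "homogeneous d G" "d \<ge> 2" and uw: "cross_product u w \<noteq> 0"
  shows "restrict_line G u w \<noteq> 0"
proof
  assume 0: "restrict_line G u w = 0"
  obtain v where v: "(\<Sum>i\<in>UNIV. cross_product u w $ i * v $ i) \<noteq> 0"
    using triple_product_nonzero_exists[OF uw] .
  define G' where "G' = linear_subst (columns3 u w v) G"
  have irr: "irreducible G'"
    unfolding G'_def using invertible_columns3[OF v] G(1) by (rule irreducible_linear_subst)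
  have eval: "eval3 G' x = eval3 G (x $ 1 *s u + x $ 2 *s w + x $ 3 *s v)" for x
    by (simp add: G'_def eval3_linear_subst columns3_mult)
  have "specialize (coeff G' 0) x = 0" if x: "x \<noteq> 0" for x
  proof -
    have "poly (specialize (coeff G' 0) x) y = 0" for y
    proof -
      have "poly (specialize (coeff G' 0) x) y = eval3 G' (vector [x, y, 0])"
        by (simp add: eval3_def poly_specialize poly_0_coeff_0)
      also have "\<dots> = eval3 G (x *s (u + (y / x) *s w))"
        unfolding eval by (rule arg_cong[where f = "eval3 G"]) (use x in \<open>simp add: vec_eq_iff algebra_simps\<close>)
      also have "\<dots> = x ^ d * poly (restrict_line G u w) (y / x)"
        by (simp only: eval3_scale[OF G(2)] poly_restrict_line)
      finally show ?thesis by (simp add: 0)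
    qed
    then show ?thesis using poly_all_0_iff_0 by blast
  qed
  moreover have "infinite (UNIV - {0 :: complex})" by (simp add: infinite_UNIV_char_0)
  ultimately have "coeff G' 0 = 0" by (intro specialize_eq_0_if_infinite[of "UNIV - {0}"]) auto
  then obtain H where H: "G' = [:0, 1:] * H"
    by (cases G' rule: pCons_cases) auto
  have "\<not> is_unit ([:0, 1:] :: poly3)"
    by (auto simp: is_unit_poly_iff)
  then have "is_unit H" using irreducibleD[OF irr H] by blast
  then obtain c where c: "H = [:[:[:c:]:]:]" by (auto simp: is_unit_poly_iff)
  have ev: "eval3 G' x = x $ 3 * c" for x by (simp add: H c eval3_def)
  \<comment> \<open>Doubling the argument multiplies a linear form by 2 but \<open>G\<close> by
    \<open>2 ^ d\<close>.\<close>
  have "2 * c = eval3 G (2 *s v)" using ev[of "vector [0, 0, 2]"] by (simp add: eval)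
  also have "\<dots> = 2 ^ d * c" using ev[of "vector [0, 0, 1]"] by (simp add: eval eval3_scale[OF G(2)])
  finally have "c = 0 \<or> (2 :: complex) ^ d = 2" by auto
  moreover have "(2 :: complex) ^ d \<noteq> 2"
  proof
    assume "(2 :: complex) ^ d = 2"
    then have "(of_nat (2 ^ d) :: complex) = of_nat 2" by simp
    then have "(2 :: nat) ^ d = 2 ^ 1" unfolding of_nat_eq_iff by simp
    then have "d = 1" by (subst (asm) power_inject_exp) auto
    then show False using G(3) by simp
  qed
  ultimately have "H = 0" using c by simp
  then show False using irr H by simp
qed

text \<open>Taylor expansion along \<open>e\<close> with one factor \<open>t\<close> split off. The
  cofactor at \<open>t = 0\<close> is the derivative along \<open>e\<close>; where it is nonzero, a
  point of the curve moved by a small \<open>t\<close> has a value of \<open>F\<close> comparable to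
  \<open>t\<close>.\<close>

lemma eval3_shift:
  fixes F :: poly3
  assumes "homogeneous n F"
  shows "eval3 F (v + t *s e) = eval3 F v + t * (\<Sum>j<n. coeff (restrict_line F v e) (Suc j) * t ^ j)"
proof -
  have "eval3 F (v + t *s e) = poly (restrict_line F v e) t" by simp
  also have "\<dots> = (\<Sum>j\<le>n. coeff (restrict_line F v e) j * t ^ j)"
    unfolding poly_altdef using restrict_line_top(1)[OF assms]
    by (intro sum.mono_neutral_left) (auto simp: coeff_eq_0)
  also have "\<dots> = coeff (restrict_line F v e) 0 + (\<Sum>j<n. coeff (restrict_line F v e) (Suc j) * t ^ Suc j)"
    unfolding lessThan_Suc_atMost[symmetric] sum.lessThan_Suc_shift by simp
  also have "coeff (restrict_line F v e) 0 = eval3 F v"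
    by (simp add: poly_0_coeff_0[symmetric])
  finally show ?thesis by (simp add: sum_distrib_left mult_ac)
qed

text \<open>Second-order Taylor estimate, uniform in the point of contact \<open>y\<close> and not
  only in \<open>z\<close>; the limit argument for tangents depends on this uniformity.\<close>

lemma second_order_contact:
  assumes s: "s holomorphic_on B" "open B" and y1: "y1 \<in> B" and a: "deriv (deriv s) y1 \<noteq> 0"
  obtains h where "h > 0" "ball y1 h \<subseteq> B"
    "\<And>y z. y \<in> ball y1 h \<Longrightarrow> z \<in> ball y1 h \<Longrightarrow>
      norm (deriv (deriv s) y1) / 4 * norm (z - y) ^ 2 \<le> norm (s y + deriv s y * (z - y) - s z)"
    "\<And>y z. y \<in> ball y1 h \<Longrightarrow> z \<in> ball y1 h \<Longrightarrow>
      norm (s y + deriv s y * (z - y) - s z) \<le> norm (deriv (deriv s) y1) * norm (z - y) ^ 2"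
proof -
  define a where "a = deriv (deriv s) y1"
  have ds: "deriv s holomorphic_on B" "deriv (deriv s) holomorphic_on B"
    using s by (auto intro: holomorphic_deriv)
  have "isCont (deriv (deriv s)) y1"
    using holomorphic_on_imp_continuous_on[OF ds(2)] s(2) y1 by (simp add: continuous_on_eq_continuous_at)
  then obtain h1 where h1: "h1 > 0" "\<And>x. dist x y1 < h1 \<Longrightarrow> dist (deriv (deriv s) x) a < norm a / 4"
    using a unfolding continuous_at_eps_delta a_def
    by (metis divide_pos_pos zero_less_norm_iff zero_less_numeral)
  obtain h2 where h2: "h2 > 0" "ball y1 h2 \<subseteq> B" using s(2) y1 openE by blast
  define h where "h = min h1 h2"
  have hB: "ball y1 h \<subseteq> B" using h2 by (auto simp: h_def)
  \<comment> \<open>The second derivative differs from \<open>a\<close> by less than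
    \<open>norm a / 4\<close>. Against the main term with factor \<open>norm a / 2\<close> this
    leaves the lower factor \<open>norm a / 4\<close> and an upper factor of three quarters of
    \<open>norm a\<close>, rounded up.\<close>
  have main: "norm (s z - s y - deriv s y * (z - y) - a / 2 * (z - y) ^ 2) \<le> norm a / 4 * norm (z - y) ^ 2"
    if y: "y \<in> ball y1 h" and z: "z \<in> ball y1 h" for y z
  proof -
    have d1: "(s has_field_derivative deriv s x) (at x)" "(deriv s has_field_derivative deriv (deriv s) x) (at x)"
      if "x \<in> ball y1 h" for x
      using s ds(1) that hB by (auto intro!: holomorphic_derivI)
    have 1: "norm (deriv s x - deriv s y - a * (x - y)) \<le> norm a / 4 * norm (x - y)" if x: "x \<in> ball y1 h" for x
    proof -
      have "norm ((deriv s x - a * x) - (deriv s y - a * y)) \<le> norm a / 4 * norm (x - y)"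
      proof (rule field_differentiable_bound[where S = "ball y1 h"])
        fix w assume w: "w \<in> ball y1 h"
        show "((\<lambda>x. deriv s x - a * x) has_field_derivative deriv (deriv s) w - a) (at w within ball y1 h)"
          by (rule has_field_derivative_at_within) (auto intro!: derivative_eq_intros d1(2)[OF w])
        show "norm (deriv (deriv s) w - a) \<le> norm a / 4"
          using h1(2)[of w] w by (simp add: h_def dist_norm norm_minus_commute)
      qed (use x y in auto)
      then show ?thesis by (simp add: algebra_simps)
    qed
    have seg: "closed_segment y z \<subseteq> ball y1 h"
      using y z by (intro closed_segment_subset convex_ball)
    have "norm ((s z - deriv s y * z - a / 2 * (z - y) ^ 2) - (s y - deriv s y * y - a / 2 * (y - y) ^ 2))
        \<le> norm a / 4 * norm (z - y) * norm (z - y)"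
    proof (rule field_differentiable_bound[where S = "closed_segment y z"])
      fix w assume w: "w \<in> closed_segment y z"
      then have w': "w \<in> ball y1 h" using seg by blast
      show "((\<lambda>x. s x - deriv s y * x - a / 2 * (x - y) ^ 2) has_field_derivative
          (deriv s w - deriv s y - a * (w - y))) (at w within closed_segment y z)"
        by (rule has_field_derivative_at_within) (auto intro!: derivative_eq_intros d1(1)[OF w'] simp: algebra_simps)
      have "norm (w - y) \<le> norm (z - y)" using segment_bound[OF w] by simp
      then show "norm (deriv s w - deriv s y - a * (w - y)) \<le> norm a / 4 * norm (z - y)"
        by (intro order_trans[OF 1[OF w']] mult_left_mono) auto
    qed auto
    then show ?thesis by (simp add: algebra_simps power2_eq_square)
  qed
  show thesis
  proof (rule that[of h])
    fix y z assume yz: "y \<in> ball y1 h" "z \<in> ball y1 h"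
    define q where "q = a / 2 * (z - y) ^ 2"
    define e where "e = s z - s y - deriv s y * (z - y) - q"
    have e: "norm e \<le> norm a / 4 * norm (z - y) ^ 2" using main[OF yz] by (simp add: e_def q_def)
    have q: "norm q = norm a / 2 * norm (z - y) ^ 2" by (simp add: q_def norm_mult norm_power norm_divide)
    have se: "s y + deriv s y * (z - y) - s z = - (q + e)" by (simp add: e_def)
    show "norm (deriv (deriv s) y1) / 4 * norm (z - y) ^ 2 \<le> norm (s y + deriv s y * (z - y) - s z)"
      unfolding se norm_minus_cancel a_def[symmetric] using e q norm_diff_ineq[of q e] by linarith
    have "norm (q + e) \<le> norm a / 2 * norm (z - y) ^ 2 + norm a / 4 * norm (z - y) ^ 2"
      using norm_triangle_ineq[of q e] e q by linarith
    also have "\<dots> \<le> norm a * norm (z - y) ^ 2"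
      by (simp add: algebra_simps)
    finally show "norm (s y + deriv s y * (z - y) - s z) \<le> norm (deriv (deriv s) y1) * norm (z - y) ^ 2"
      unfolding se norm_minus_cancel a_def[symmetric] .
  qed (use h1 h2 hB in \<open>auto simp: h_def\<close>)
qed

text \<open>After splitting off the exact power of \<open>z - y\<close>, letting \<open>z\<close>
  tend to \<open>y\<close> excludes a higher order by the lower bound and a lower order by the upper
  bound.\<close>

lemma order_eq_2_if_quadratic:
  fixes f :: "complex poly"
  assumes "c > 0" "h > 0"
    and lower: "\<And>z. dist y z < h \<Longrightarrow> c * norm (z - y) ^ 2 \<le> norm (poly f z)"
    and upper: "\<And>z. dist y z < h \<Longrightarrow> norm (poly f z) \<le> C * norm (z - y) ^ 2"
  shows "order y f = 2"
proof -
  have ev: "eventually (\<lambda>z. dist y z < h \<and> z \<noteq> y) (at y)"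
    unfolding eventually_at using assms(2) by (auto simp: dist_commute)
  have f0: "f \<noteq> 0"
  proof
    assume "f = 0"
    then have "c * norm ((y + of_real (h / 2)) - y) ^ 2 \<le> 0"
      using lower[of "y + of_real (h / 2)"] assms(2) by (simp add: dist_norm)
    then show False using assms(1,2) by (simp add: mult_le_0_iff)
  qed
  obtain q where q: "f = [:- y, 1:] ^ order y f * q" "\<not> [:- y, 1:] dvd q"
    using order_decomp[OF f0] by blast
  define m where "m = order y f"
  have qy: "poly q y \<noteq> 0" using q(2) by (simp add: poly_eq_0_iff_dvd)
  have f: "norm (poly f z) = norm (z - y) ^ m * norm (poly q z)" for z
    by (subst q(1)) (simp add: m_def norm_mult norm_power poly_power)
  have lim: "((\<lambda>z. norm (poly q z)) \<longlongrightarrow> norm (poly q y)) (at y)"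
    by (intro tendsto_intros)
  have zy: "((\<lambda>z. norm (z - y)) \<longlongrightarrow> 0) (at y)"
    by (auto intro!: tendsto_eq_intros)
  have "\<not> m > 2"
  proof
    assume m: "m > 2"
    have "eventually (\<lambda>z. c \<le> norm (z - y) ^ (m - 2) * norm (poly q z)) (at y)"
      using ev
    proof eventually_elim
      case (elim z)
      have "norm (z - y) ^ m = norm (z - y) ^ 2 * norm (z - y) ^ (m - 2)"
        using power_add[of "norm (z - y)" 2 "m - 2"] m by (simp only: le_add_diff_inverse less_imp_le)
      then have "norm (z - y) ^ 2 * c \<le> norm (z - y) ^ 2 * (norm (z - y) ^ (m - 2) * norm (poly q z))"
        using lower[of z] elim f[of z] by (simp add: mult_ac)
      then show ?case using elim by simp
    qed
    moreover have "((\<lambda>z. norm (z - y) ^ (m - 2) * norm (poly q z)) \<longlongrightarrow> 0 ^ (m - 2) * norm (poly q y)) (at y)"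
      by (intro tendsto_intros zy lim)
    ultimately have "c \<le> 0 ^ (m - 2) * norm (poly q y)"
      by (intro tendsto_lowerbound) auto
    then show False using assms(1) m by (simp add: zero_power)
  qed
  moreover have "\<not> m < 2"
  proof
    assume m: "m < 2"
    have "eventually (\<lambda>z. norm (poly q z) \<le> C * norm (z - y) ^ (2 - m)) (at y)"
      using ev
    proof eventually_elim
      case (elim z)
      have "norm (z - y) ^ 2 = norm (z - y) ^ m * norm (z - y) ^ (2 - m)"
        using power_add[of "norm (z - y)" m "2 - m"] m by (simp only: le_add_diff_inverse less_imp_le)
      then have "norm (z - y) ^ m * norm (poly q z) \<le> norm (z - y) ^ m * (C * norm (z - y) ^ (2 - m))"
        using upper[of z] elim f[of z] by (simp add: mult_ac)
      then show ?case using elim by simp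
    qed
    moreover have "((\<lambda>z. C * norm (z - y) ^ (2 - m)) \<longlongrightarrow> C * 0 ^ (2 - m)) (at y)"
      by (intro tendsto_intros zy)
    ultimately have "norm (poly q y) \<le> C * 0 ^ (2 - m)"
      using lim by (intro tendsto_le[where f = "\<lambda>z. C * norm (z - y) ^ (2 - m)"]) auto
    then show False using qy m by (simp add: zero_power)
  qed
  ultimately show ?thesis by (simp add: m_def)
qed

lemma degree_restrict_line:
  assumes "homogeneous n F" "eval3 F w \<noteq> 0"
  shows "degree (restrict_line F u w) = n"
  using restrict_line_top[OF assms(1), of u w] assms(2) le_degree[of "restrict_line F u w" n] by auto

lemma rsquarefree_restrict_line_shift:
  assumes F: "homogeneous n F" "eval3 F e \<noteq> 0" and simple: "rsquarefree (restrict_line F v e)"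
  shows "rsquarefree (restrict_line F (v + x *s e) e)"
proof (rule rsquarefree_if_card)
  have deg: "degree (restrict_line F w e) = n" for w by (rule degree_restrict_line[OF F])
  show "restrict_line F (v + x *s e) e \<noteq> 0"
    using restrict_line_top(2)[OF F(1), of "v + x *s e" e] F(2) by auto
  have "v + x *s e + t *s e = v + (x + t) *s e" for t by (simp add: vec_eq_iff algebra_simps)
  then have "t \<in> roots (restrict_line F (v + x *s e) e) \<longleftrightarrow> t \<in> (\<lambda>t. t - x) ` roots (restrict_line F v e)" for t
  proof -
    have "t \<in> (\<lambda>t. t - x) ` A \<longleftrightarrow> x + t \<in> A" for A
      by (auto simp: image_iff intro!: bexI[of _ "x + t"])
    then show ?thesis
      using \<open>v + x *s e + t *s e = v + (x + t) *s e\<close> by (simp only: mem_Collect_eq poly_restrict_line)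
  qed
  then have "roots (restrict_line F (v + x *s e) e) = (\<lambda>t. t - x) ` roots (restrict_line F v e)"
    by blast
  then have "card (roots (restrict_line F (v + x *s e) e)) = card (roots (restrict_line F v e))"
    by (simp add: card_image inj_on_def)
  then show "degree (restrict_line F (v + x *s e) e) \<le> card (roots (restrict_line F (v + x *s e) e))"
    using card_roots_rsquarefree[OF simple] deg by simp
qed

lemma coeff_1_nonzero_if_simple:
  assumes F: "homogeneous n F" "eval3 F e \<noteq> 0" and simple: "rsquarefree (restrict_line F v e)"
    and root: "eval3 F (v + x *s e) = 0"
  shows "coeff (restrict_line F (v + x *s e) e) 1 \<noteq> 0"
proof -
  have "poly (restrict_line F (v + x *s e) e) 0 = 0" using root by simp
  then have "poly (pderiv (restrict_line F (v + x *s e) e)) 0 \<noteq> 0"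
    using rsquarefree_restrict_line_shift[OF F simple, of x] unfolding rsquarefree_roots by blast
  then show ?thesis by (simp add: poly_0_coeff_0 coeff_pderiv)
qed

lemma tendsto_coeff_restrict_line:
  assumes "(v \<longlongrightarrow> (l :: complex ^ 3)) A"
  shows "((\<lambda>x. coeff (restrict_line F (v x) e) j) \<longlongrightarrow> coeff (restrict_line F l e) j) A"
proof -
  have "continuous_on UNIV (\<lambda>v. coeff (restrict_line F v e) j)"
    by (intro continuous_on_coeff_restrict_line continuous_intros)
  then have "isCont (\<lambda>v. coeff (restrict_line F v e) j) l" by (simp add: continuous_on_eq_continuous_at)
  from isCont_tendsto_compose[OF this assms] show ?thesis .
qed

lemma tendsto_vector_smult [tendsto_intros]:
  fixes e :: "complex ^ 3"
  assumes "(f \<longlongrightarrow> l) A"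
  shows "((\<lambda>x. f x *s e) \<longlongrightarrow> l *s e) A"
  by (rule vec_tendstoI) (auto intro!: tendsto_intros assms)

text \<open>In the affine coordinates \<open>(y, x)\<close> of \<open>e1 + y *s e3 + x *s e2\<close>
  the arc is the graph of \<open>s\<close>. Along a tangent, \<open>F\<close> is the vertical offset
  from the graph, quadratic by \<open>second_order_contact\<close>, times the cofactor of
  \<open>eval3_shift\<close>, which is nonzero because the vertical line meets the curve
  simply.\<close>

lemma tangent_contact:
  assumes F: "homogeneous n F" "eval3 F e2 \<noteq> 0"
    and s: "s holomorphic_on B" "open B" and y1: "y1 \<in> B" "deriv (deriv s) y1 \<noteq> 0"
    and curve: "\<And>y. y \<in> B \<Longrightarrow> eval3 F (e1 + y *s e3 + s y *s e2) = 0"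
    and simple: "rsquarefree (restrict_line F (e1 + y1 *s e3) e2)"
  obtains h c C where "h > 0" "c > 0" "ball y1 h \<subseteq> B"
    "\<And>y z. y \<in> ball y1 h \<Longrightarrow> z \<in> ball y1 h \<Longrightarrow>
      c * norm (z - y) ^ 2 \<le> norm (eval3 F (e1 + z *s e3 + (s y + deriv s y * (z - y)) *s e2))"
    "\<And>y z. y \<in> ball y1 h \<Longrightarrow> z \<in> ball y1 h \<Longrightarrow>
      norm (eval3 F (e1 + z *s e3 + (s y + deriv s y * (z - y)) *s e2)) \<le> C * norm (z - y) ^ 2"
proof -
  define a where "a = deriv (deriv s) y1"
  obtain h0 where h0: "h0 > 0" "ball y1 h0 \<subseteq> B"
    "\<And>y z. y \<in> ball y1 h0 \<Longrightarrow> z \<in> ball y1 h0 \<Longrightarrow>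
      norm a / 4 * norm (z - y) ^ 2 \<le> norm (s y + deriv s y * (z - y) - s z)"
    "\<And>y z. y \<in> ball y1 h0 \<Longrightarrow> z \<in> ball y1 h0 \<Longrightarrow>
      norm (s y + deriv s y * (z - y) - s z) \<le> norm a * norm (z - y) ^ 2"
    using second_order_contact[OF s y1] unfolding a_def by metis
  define R where "R z = e1 + z *s e3 + s z *s e2" for z
  define K where "K = (\<lambda>(z, t). \<Sum>j<n. coeff (restrict_line F (R z) e2) (Suc j) * t ^ j)"
  have contK: "(K \<longlongrightarrow> K (y1, 0)) (nhds (y1, 0))"
  proof -
    have "isCont s y1"
      using holomorphic_on_imp_continuous_on[OF s(1)] s(2) y1(1) by (simp add: continuous_on_eq_continuous_at)
    have fc: "(fst \<longlongrightarrow> y1) (nhds (y1, 0 :: complex))" "(snd \<longlongrightarrow> (0 :: complex)) (nhds (y1, 0 :: complex))"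
      using tendsto_fst[OF filterlim_ident[of "nhds (y1, 0 :: complex)"]]
        tendsto_snd[OF filterlim_ident[of "nhds (y1, 0 :: complex)"]] by simp_all
    have sc: "((\<lambda>x. s (fst x)) \<longlongrightarrow> s y1) (nhds (y1, 0 :: complex))"
      by (rule isCont_tendsto_compose[OF \<open>isCont s y1\<close> fc(1)])
    have "((\<lambda>x. \<Sum>j<n. coeff (restrict_line F (R (fst x)) e2) (Suc j) * snd x ^ j) \<longlongrightarrow>
        (\<Sum>j<n. coeff (restrict_line F (R y1) e2) (Suc j) * 0 ^ j)) (nhds (y1, 0))"
      unfolding R_def by (intro tendsto_intros tendsto_coeff_restrict_line sc fc)
    then show ?thesis by (simp add: K_def case_prod_beta')
  qed
  have npos: "n > 0"
  proof (rule ccontr)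
    assume "\<not> n > 0"
    then have "degree (restrict_line F (R y1) e2) = 0" using degree_restrict_line[OF F] by simp
    then obtain k where "restrict_line F (R y1) e2 = [:k:]" by (rule degree_eq_zeroE)
    moreover have "poly (restrict_line F (R y1) e2) 0 = 0" using curve[OF y1(1)] by (simp add: R_def)
    ultimately show False using restrict_line_top(2)[OF F(1), of "R y1" e2] F(2) by (cases n) auto
  qed
  have K0: "K (y1, 0) \<noteq> 0"
  proof -
    have "K (y1, 0) = coeff (restrict_line F (R y1) e2) 1"
      using npos by (cases n) (simp_all add: K_def sum.lessThan_Suc_shift del: sum.lessThan_Suc)
    then show ?thesis
      using coeff_1_nonzero_if_simple[OF F simple] curve[OF y1(1)] by (simp add: R_def)
  qed
  define k where "k = norm (K (y1, 0))"
  have k: "k > 0" using K0 by (simp add: k_def)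
  have "eventually (\<lambda>x. dist (K x) (K (y1, 0)) < k / 2) (nhds (y1, 0))"
    using tendstoD[OF contK, of "k / 2"] k by simp
  then obtain h1 where h1: "h1 > 0" "\<And>x. dist x (y1, 0) < h1 \<Longrightarrow> dist (K x) (K (y1, 0)) < k / 2"
    by (auto simp: eventually_nhds_metric)
  \<comment> \<open>The bound 1 gives \<open>norm (z - y) < 2\<close>, so the square is at most
    \<open>4 * h\<close> and the offset at most \<open>4 * h * norm a\<close>. The quotient then
    keeps \<open>(z, t)\<close> within \<open>h1\<close> of \<open>(y1, 0)\<close>.\<close>
  define h where "h = min (min h0 1) (h1 / (2 + 4 * norm a))"
  have den: "2 + 4 * norm a > 0" using norm_ge_zero[of a] by linarith
  have h: "h > 0" using h0(1) h1(1) den by (simp add: h_def)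
  have ev: "eval3 F (e1 + z *s e3 + (s y + deriv s y * (z - y)) *s e2) =
      (s y + deriv s y * (z - y) - s z) * K (z, s y + deriv s y * (z - y) - s z)" if "z \<in> B" for y z
  proof -
    have "e1 + z *s e3 + (s y + deriv s y * (z - y)) *s e2 = R z + (s y + deriv s y * (z - y) - s z) *s e2"
      by (simp add: R_def vec_eq_iff algebra_simps)
    moreover have "eval3 F (R z) = 0" using curve[OF that] by (simp only: R_def)
    ultimately show ?thesis by (simp only: eval3_shift[OF F(1)] K_def prod.case add_0)
  qed
  have main: "k / 2 \<le> norm (K (z, s y + deriv s y * (z - y) - s z)) \<and>
      norm (K (z, s y + deriv s y * (z - y) - s z)) \<le> 2 * k" if yz: "y \<in> ball y1 h" "z \<in> ball y1 h" for y z
  proof -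
    define t where "t = s y + deriv s y * (z - y) - s z"
    have "norm (z - y) < 2 * h"
      using yz dist_triangle2[of z y y1] by (simp add: dist_norm norm_minus_commute)
    moreover have "norm (z - y) < 2"
      using yz dist_triangle2[of z y y1] by (simp add: h_def dist_norm norm_minus_commute)
    ultimately have "norm (z - y) ^ 2 \<le> 2 * (2 * h)"
      unfolding power2_eq_square by (intro mult_mono) auto
    then have "norm t \<le> norm a * (4 * h)"
      using h0(4)[of y z] yz mult_left_mono[of "norm (z - y) ^ 2" "4 * h" "norm a"]
      by (simp add: t_def h_def)
    moreover have "dist (z, t) (y1, 0) \<le> dist z y1 + norm t"
      using dist_norm[of t 0] by (simp add: dist_Pair_Pair sqrt_sum_squares_le_sum)
    moreover have "dist z y1 < h" using yz by (simp add: dist_commute)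
    ultimately have "dist (z, t) (y1, 0) < h * (2 + 4 * norm a)"
      using h by (simp add: algebra_simps)
    also have "\<dots> \<le> h1"
      by (subst pos_le_divide_eq[OF den, symmetric]) (simp add: h_def)
    finally have "dist (K (z, t)) (K (y1, 0)) < k / 2" by (rule h1(2))
    then show ?thesis
      unfolding t_def[symmetric] k_def dist_norm
      using norm_triangle_ineq2[of "K (y1, 0)" "K (z, t)"] norm_triangle_ineq2[of "K (z, t)" "K (y1, 0)"]
      by (auto simp: norm_minus_commute)
  qed
  show thesis
  proof (rule that[of h "norm a / 4 * (k / 2)" "norm a * (2 * k)"])
    show "ball y1 h \<subseteq> B" using h0(2) by (auto simp: h_def)
    show "norm a / 4 * (k / 2) > 0" using k y1(2) by (simp add: a_def)
    fix y z assume yz: "y \<in> ball y1 h" "z \<in> ball y1 h"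
    then have zB: "z \<in> B" and yz0: "y \<in> ball y1 h0" "z \<in> ball y1 h0" using h0(2) by (auto simp: h_def)
    define t where "t = s y + deriv s y * (z - y) - s z"
    have "norm a / 4 * norm (z - y) ^ 2 * (k / 2) \<le> norm t * norm (K (z, t))"
      using h0(3)[OF yz0] main[OF yz] k by (intro mult_mono) (auto simp: t_def)
    then show "norm a / 4 * (k / 2) * norm (z - y) ^ 2 \<le>
        norm (eval3 F (e1 + z *s e3 + (s y + deriv s y * (z - y)) *s e2))"
      unfolding ev[OF zB] norm_mult t_def[symmetric] by (simp add: mult_ac)
    have "norm t * norm (K (z, t)) \<le> norm a * norm (z - y) ^ 2 * (2 * k)"
      using h0(4)[OF yz0] main[OF yz] k by (intro mult_mono) (auto simp: t_def)
    then show "norm (eval3 F (e1 + z *s e3 + (s y + deriv s y * (z - y)) *s e2)) \<le>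
        norm a * (2 * k) * norm (z - y) ^ 2"
      unfolding ev[OF zB] norm_mult t_def[symmetric] by (simp add: mult_ac)
  qed (rule h)
qed

lemma open_nonzero_subset:
  assumes "open U" "continuous_on U f" "y \<in> U" "f y \<noteq> (0 :: complex)"
  shows "open {x \<in> U. f x \<noteq> 0}" "{x \<in> U. f x \<noteq> 0} \<noteq> {}"
proof -
  have "open (U \<inter> f -` (- {0}))" by (rule continuous_open_preimage[OF assms(2,1)]) auto
  moreover have "U \<inter> f -` (- {0}) = {x \<in> U. f x \<noteq> 0}" by auto
  ultimately show "open {x \<in> U. f x \<noteq> 0}" by simp
qed (use assms in auto)

text \<open>A moving tangent line turns about its point of contact, so it passes through a given point only
  at isolated times.\<close>

lemma tangents_avoid_finite:
  fixes T :: "(complex \<times> complex) set"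
  assumes "finite T" and s: "s holomorphic_on U" and U: "open U" "U \<noteq> {}"
    and curved: "\<And>y. y \<in> U \<Longrightarrow> deriv (deriv s) y \<noteq> 0"
  obtains V where "open V" "V \<noteq> {}" "V \<subseteq> U"
    "\<And>y x b. y \<in> V \<Longrightarrow> (x, b) \<in> T \<Longrightarrow> s y + deriv s y * (b - y) \<noteq> x"
proof -
  have "\<exists>V. open V \<and> V \<noteq> {} \<and> V \<subseteq> U \<and> (\<forall>y\<in>V. \<forall>(x, b)\<in>T. s y + deriv s y * (b - y) \<noteq> x)"
    using assms(1)
  proof (induction T)
    case empty
    then show ?case using U by blast
  next
    case (insert p T)
    then obtain V where V: "open V" "V \<noteq> {}" "V \<subseteq> U"
      "\<forall>y\<in>V. \<forall>(x, b)\<in>T. s y + deriv s y * (b - y) \<noteq> x" by blast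
    obtain x b where p: "p = (x, b)" by (cases p)
    define f where "f y = s y + deriv s y * (b - y) - x" for y
    have hol: "s holomorphic_on V" "deriv s holomorphic_on V"
      using s V(1,3) holomorphic_on_subset by (auto intro!: holomorphic_deriv)
    \<comment> \<open>The derivative of \<open>f\<close> is
      \<open>deriv (deriv s) y * (b - y)\<close>. Were \<open>f\<close> zero on \<open>V\<close>,
      then \<open>V\<close> would lie in \<open>{b}\<close>, which no nonempty open set
      does.\<close>
    have "\<exists>y\<in>V. f y \<noteq> 0"
    proof (rule ccontr)
      assume 0: "\<not> (\<exists>y\<in>V. f y \<noteq> 0)"
      have "y = b" if y: "y \<in> V" for y
      proof -
        have "(f has_field_derivative (deriv s y + (deriv (deriv s) y * (b - y) - deriv s y))) (at y)"
          unfolding f_def using V(1) y hol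
          by (auto intro!: derivative_eq_intros holomorphic_derivI simp: algebra_simps)
        moreover have "(f has_field_derivative 0) (at y)"
        proof (rule has_field_derivative_transform_within_open[of "\<lambda>_. 0" 0 y V])
          show "0 = f z" if "z \<in> V" for z using 0 that by auto
        qed (use V(1) y in auto)
        ultimately have "deriv (deriv s) y * (b - y) = 0" using DERIV_unique by fastforce
        then show ?thesis using curved y V(3) by auto
      qed
      then have "V \<subseteq> {b}" by blast
      then have "finite V" using finite_subset by blast
      then show False using V(1,2) finite_imp_not_open by blast
    qed
    then obtain y where y: "y \<in> V" "f y \<noteq> 0" by blast
    have "continuous_on V f"
      unfolding f_def by (intro continuous_intros holomorphic_on_imp_continuous_on hol)
    from open_nonzero_subset[OF V(1) this y]
    show ?case
      using V(3,4) by (intro exI[of _ "{x \<in> V. f x \<noteq> 0}"]) (auto simp: p f_def)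
  qed
  then obtain V where V: "open V" "V \<noteq> {}" "V \<subseteq> U"
      "\<forall>y\<in>V. \<forall>(x, b)\<in>T. s y + deriv s y * (b - y) \<noteq> x" by blast
  show thesis by (rule that[OF V(1-3)]) (use V(4) in fast)
qed

lemma finite_range_deriv_const:
  assumes f: "f holomorphic_on U" "open U" "U \<noteq> {}" and fin: "finite (f ` U)"
    and nz: "\<And>y. y \<in> U \<Longrightarrow> deriv f y \<noteq> 0"
  shows False
proof -
  obtain y where yU: "y \<in> U" using f(3) by blast
  obtain e where "e > 0" "ball y e \<subseteq> U" using openE[OF f(2) yU] .
  note y = yU this
  have "f constant_on ball y e"
  proof (rule continuous_finite_range_constant)
    show "continuous_on (ball y e) f"
      using holomorphic_on_imp_continuous_on[OF f(1)] y(3) continuous_on_subset by blast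
    show "finite (f ` ball y e)" using fin y(3) by (meson finite_subset image_mono)
  qed simp
  then obtain c where c: "\<And>x. x \<in> ball y e \<Longrightarrow> f x = c" by (auto simp: constant_on_def)
  have "(f has_field_derivative 0) (at y)"
    by (rule has_field_derivative_transform_within_open[of "\<lambda>_. c" 0 y "ball y e"])
       (use y(2) c in auto)
  then show False using nz[OF y(1)] DERIV_imp_deriv by blast
qed

text \<open>The frame of the line of slope \<open>b\<close> through the affine point
  \<open>(y, a)\<close>, chosen so that its parameter is the horizontal coordinate; roots on
  different tangents thus become comparable.\<close>

lemma restrict_tangent_eval:
  "poly (restrict_line F (e1 + (a - b * y) *s e2) (e3 + b *s e2)) z =
    eval3 F (e1 + z *s e3 + (a + b * (z - y)) *s e2)"
  unfolding poly_restrict_line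
  by (rule arg_cong[where f = "eval3 F"]) (simp add: vec_eq_iff algebra_simps)

text \<open>The logarithmic derivative of \<open>(z - a) ^ m * q\<close>, cleared of denominators.
  It compares \<open>f\<close> with its derivative near a root of unknown multiplicity.\<close>

lemma multiple_root_identity:
  fixes f :: "complex poly"
  assumes "f \<noteq> 0" "poly f a = 0"
  obtains m q where "m > 0" "poly q a \<noteq> 0"
    "\<And>z. poly f z * (of_nat m * poly q z + (z - a) * poly (pderiv q) z) =
       (z - a) * poly q z * poly (pderiv f) z"
proof -
  obtain q where q: "f = [:- a, 1:] ^ order a f * q" "\<not> [:- a, 1:] dvd q"
    using order_decomp[OF assms(1)] by blast
  have "order a f \<noteq> 0" using assms by (simp add: order_root)
  then obtain k where k: "order a f = Suc k" by (cases "order a f") auto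
  have f: "poly f z = (z - a) ^ Suc k * poly q z" for z
    by (subst q(1)) (simp add: k poly_power algebra_simps)
  have pd: "pderiv f = [:- a, 1:] ^ Suc k * pderiv q + smult (of_nat (Suc k)) ([:- a, 1:] ^ k) * pderiv [:- a, 1:] * q"
    by (subst q(1)) (simp only: k pderiv_mult pderiv_power_Suc ac_simps)
  have f': "poly (pderiv f) z = (z - a) ^ Suc k * poly (pderiv q) z + of_nat (Suc k) * (z - a) ^ k * poly q z" for z
  proof -
    have "poly [:- a, 1:] z = z - a" "pderiv [:- a, 1:] = 1" by (simp_all add: pderiv_pCons)
    then show ?thesis unfolding pd by (simp only: poly_add poly_mult poly_power poly_smult poly_1 mult_1_right)
  qed
  show thesis
  proof (rule that[of "Suc k" q])
    show "poly q a \<noteq> 0" using q(2) by (simp add: poly_eq_0_iff_dvd)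
    show "poly f z * (of_nat (Suc k) * poly q z + (z - a) * poly (pderiv q) z) =
       (z - a) * poly q z * poly (pderiv f) z" for z
      unfolding f f' by (simp add: algebra_simps)
  qed simp
qed

lemma card_roots_one_double:
  fixes f :: "complex poly"
  assumes "order y f = 2" "f \<noteq> 0"
    and "\<And>z. z \<noteq> y \<Longrightarrow> poly f z = 0 \<Longrightarrow> poly (pderiv f) z \<noteq> 0"
  shows "Suc (card (roots f)) = degree f"
proof -
  have fin: "finite (roots f)" using assms(2) by (rule poly_roots_finite)
  have y: "y \<in> roots f" using assms(1,2) by (simp add: order_root)
  have "order z f = 1" if z: "z \<in> roots f - {y}" for z
  proof -
    have fz: "poly f z = 0" "z \<noteq> y" using z by auto
    then have pz: "poly (pderiv f) z \<noteq> 0" "order z f \<noteq> 0"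
      using assms(2,3) order_root[of f z] by blast+
    then have "order z f = Suc (order z (pderiv f))"
      using assms(2) fz by (intro order_pderiv) auto
    then show ?thesis using order_0I[OF pz(1)] by simp
  qed
  then have "degree f = 2 + card (roots f - {y})"
    using degree_eq_sum_order[OF assms(2)] assms(1) by (simp add: sum.remove[OF fin y])
  then show ?thesis using fin y card_Suc_Diff1[OF fin y] by simp
qed

lemma poly_pderiv_sum:
  fixes p :: "complex poly"
  assumes "degree p \<le> n"
  shows "poly (pderiv p) z = (\<Sum>j<n. of_nat (Suc j) * coeff p (Suc j) * z ^ j)"
proof (cases n)
  case 0
  then obtain c where "p = [:c:]" using assms degree_eq_zeroE by auto
  then show ?thesis using 0 by (simp add: pderiv_pCons)
next
  case (Suc k)
  have "degree (pderiv p) \<le> k" using assms Suc by (simp add: degree_pderiv)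
  then have "poly (pderiv p) z = (\<Sum>j\<le>k. coeff (pderiv p) j * z ^ j)"
    unfolding poly_altdef by (intro sum.mono_neutral_left) (auto simp: coeff_eq_0)
  then show ?thesis by (simp only: Suc lessThan_Suc_atMost coeff_pderiv)
qed

text \<open>Otherwise there are tangents that converge to a tangent and have second multiple points that
  converge as well. Comparing the equations of these tangents to first order shows that the limiting
  tangent turns about the limit of the second multiple points, while it actually turns about its
  point of contact.\<close>

lemma simple_tangent_exists:
  assumes F: "homogeneous n F" "eval3 F e2 \<noteq> 0" and l0: "rsquarefree (restrict_line F e1 e2)"
    and s: "s holomorphic_on B" "open B" and y0: "y0 \<in> B" "deriv (deriv s) y0 \<noteq> 0"
    and curve: "\<And>y. y \<in> B \<Longrightarrow> eval3 F (e1 + y *s e3 + s y *s e2) = 0"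
    and simple: "\<And>y. y \<in> B \<Longrightarrow> rsquarefree (restrict_line F (e1 + y *s e3) e2)"
  obtains y where "y \<in> B" "eval3 F (e3 + deriv s y *s e2) \<noteq> 0"
    "Suc (card (roots (restrict_line F (e1 + (s y - deriv s y * y) *s e2) (e3 + deriv s y *s e2)))) = n"
proof -
  define P where "P y = restrict_line F (e1 + (s y - deriv s y * y) *s e2) (e3 + deriv s y *s e2)" for y
  have evP: "poly (P y) z = eval3 F (e1 + z *s e3 + (s y + deriv s y * (z - y)) *s e2)" for y z
    unfolding P_def by (rule restrict_tangent_eval)
  have ds: "deriv s holomorphic_on B" "deriv (deriv s) holomorphic_on B"
    using s by (auto intro: holomorphic_deriv)

  \<comment> \<open>Parameters with curvature, admissible direction and transversal
    verticals\<close>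
  define U1 where "U1 = {y \<in> B. deriv (deriv s) y \<noteq> 0}"
  have U1: "open U1" "U1 \<noteq> {}"
    unfolding U1_def by (rule open_nonzero_subset[OF s(2) holomorphic_on_imp_continuous_on[OF ds(2)] y0])+
  have dsU1: "deriv s holomorphic_on U1" using ds(1) by (rule holomorphic_on_subset) (auto simp: U1_def)
  \<comment> \<open>On a curved arc the slope takes infinitely many values, while only finitely many
    points \<open>e3 + x *s e2\<close> lie on the curve.\<close>
  have "\<exists>y\<in>U1. eval3 F (e3 + deriv s y *s e2) \<noteq> 0"
  proof (rule ccontr)
    assume "\<not> (\<exists>y\<in>U1. eval3 F (e3 + deriv s y *s e2) \<noteq> 0)"
    then have "deriv s ` U1 \<subseteq> roots (restrict_line F e3 e2)" by auto
    moreover have "restrict_line F e3 e2 \<noteq> 0" using restrict_line_top(2)[OF F(1), of e3 e2] F(2) by auto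
    ultimately have "finite (deriv s ` U1)" using poly_roots_finite finite_subset by blast
    then show False
      by (rule finite_range_deriv_const[OF dsU1 U1]) (simp add: U1_def)
  qed
  then obtain y2 where y2: "y2 \<in> U1" "eval3 F (e3 + deriv s y2 *s e2) \<noteq> 0" by blast
  define U2 where "U2 = {y \<in> U1. eval3 F (e3 + deriv s y *s e2) \<noteq> 0}"
  have "continuous_on U1 (\<lambda>y. poly (restrict_line F e3 e2) (deriv s y))"
    by (intro continuous_intros holomorphic_on_imp_continuous_on dsU1)
  then have "continuous_on U1 (\<lambda>y. eval3 F (e3 + deriv s y *s e2))" by simp
  from open_nonzero_subset[OF U1(1) this y2] have U2: "open U2" "U2 \<noteq> {}" by (simp_all add: U2_def)
  \<comment> \<open>\<open>D\<close> holds the vertical lines that are not transversal, and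
    \<open>T\<close> the curve points on them. Tangents over \<open>V\<close> avoid
    \<open>T\<close>, so the vertical direction is transversal to the curve wherever they meet it.
    The term \<open>b *s 0\<close> is there to match
    \<open>finite_degenerate_pencil\<close>.\<close>
  define D where "D = {b. \<not> (eval3 F (e2 + b *s 0) \<noteq> 0 \<and> rsquarefree (restrict_line F (e1 + b *s e3) (e2 + b *s 0)))}"
  have finD: "finite D" unfolding D_def by (rule finite_degenerate_pencil[OF F l0])
  define T where "T = (\<Union>b\<in>D. (\<lambda>x. (x, b)) ` roots (restrict_line F (e1 + b *s e3) e2))"
  have "restrict_line F (e1 + b *s e3) e2 \<noteq> 0" for b
    using restrict_line_top(2)[OF F(1), of "e1 + b *s e3" e2] F(2) by auto
  then have finT: "finite T" unfolding T_def using finD by (intro finite_UN_I finite_imageI poly_roots_finite)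
  have sU2: "s holomorphic_on U2" using s(1) by (rule holomorphic_on_subset) (auto simp: U2_def U1_def)
  obtain V where V: "open V" "V \<noteq> {}" "V \<subseteq> U2"
      "\<And>y x b. y \<in> V \<Longrightarrow> (x, b) \<in> T \<Longrightarrow> s y + deriv s y * (b - y) \<noteq> x"
    using tangents_avoid_finite[OF finT sU2 U2] by (auto simp: U2_def U1_def)
  have VB: "y \<in> B" and Vss: "deriv (deriv s) y \<noteq> 0" and VF: "eval3 F (e3 + deriv s y *s e2) \<noteq> 0" if "y \<in> V" for y
    using that V(3) by (auto simp: U2_def U1_def)
  have degP: "degree (P y) = n" if "y \<in> V" for y
    unfolding P_def by (rule degree_restrict_line[OF F(1) VF[OF that]])
  have degP': "degree (P y) \<le> n" for y unfolding P_def by (rule restrict_line_top(1)[OF F(1)])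
  have leadP: "coeff (P y) n = eval3 F (e3 + deriv s y *s e2)" for y
    unfolding P_def by (rule restrict_line_top(2)[OF F(1)])
  have P0: "P y \<noteq> 0" if "y \<in> V" for y using leadP[of y] VF[OF that] by auto
  have holP: "(\<lambda>y. coeff (P y) j) holomorphic_on V" for j
  proof -
    have "s holomorphic_on V" "deriv s holomorphic_on V"
      using s(1) ds(1) VB holomorphic_on_subset by blast+
    then show ?thesis
      unfolding P_def by (intro holomorphic_on_coeff_restrict_line) (auto intro!: holomorphic_intros)
  qed
  have contact: "\<exists>h c C. h > 0 \<and> c > 0 \<and> (\<forall>y z. y \<in> ball y1 h \<longrightarrow> z \<in> ball y1 h \<longrightarrow>
      c * norm (z - y) ^ 2 \<le> norm (poly (P y) z) \<and> norm (poly (P y) z) \<le> C * norm (z - y) ^ 2)"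
    if y1V: "y1 \<in> V" for y1
  proof (rule tangent_contact[OF F s VB[OF y1V] Vss[OF y1V] curve simple[OF VB[OF y1V]]])
    fix h c C :: real
    assume hc: "h > 0" "c > 0"
      and lower: "\<And>y z. y \<in> ball y1 h \<Longrightarrow> z \<in> ball y1 h \<Longrightarrow>
        c * norm (z - y) ^ 2 \<le> norm (eval3 F (e1 + z *s e3 + (s y + deriv s y * (z - y)) *s e2))"
      and upper: "\<And>y z. y \<in> ball y1 h \<Longrightarrow> z \<in> ball y1 h \<Longrightarrow>
        norm (eval3 F (e1 + z *s e3 + (s y + deriv s y * (z - y)) *s e2)) \<le> C * norm (z - y) ^ 2"
    show ?thesis
      unfolding evP by (intro exI[of _ h] exI[of _ c] exI[of _ C] conjI allI impI hc lower upper)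
  qed
  have order2: "order y (P y) = 2" if y: "y \<in> V" for y
  proof -
    obtain h c C where "h > 0" "c > 0" and *: "\<And>y' z. y' \<in> ball y h \<Longrightarrow> z \<in> ball y h \<Longrightarrow>
      c * norm (z - y') ^ 2 \<le> norm (poly (P y') z) \<and> norm (poly (P y') z) \<le> C * norm (z - y') ^ 2"
      using contact[OF y] by blast
    then show ?thesis
      using *[of y] by (intro order_eq_2_if_quadratic[of c h y "P y" C]) auto
  qed

  \<comment> \<open>A limit of tangents with a second multiple point\<close>
  have "\<exists>y\<in>V. \<forall>z. z \<noteq> y \<longrightarrow> poly (P y) z = 0 \<longrightarrow> poly (pderiv (P y)) z \<noteq> 0"
  proof (rule ccontr)
    assume "\<not> ?thesis"
    then have "\<forall>y\<in>V. \<exists>z. z \<noteq> y \<and> poly (P y) z = 0 \<and> poly (pderiv (P y)) z = 0" by blast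
    then obtain Z where Z: "\<And>y. y \<in> V \<Longrightarrow> Z y \<noteq> y \<and> poly (P y) (Z y) = 0 \<and> poly (pderiv (P y)) (Z y) = 0"
      by metis
    obtain y1 where y1V: "y1 \<in> V" using V(2) by blast
    obtain e where "e > 0" "ball y1 e \<subseteq> V" using openE[OF V(1) y1V] .
    note y1 = y1V this
    \<comment> \<open>Any sequence in \<open>V\<close> tending to \<open>y1\<close> would do,
      provided it avoids \<open>y1\<close>, since difference quotients follow.\<close>
    define Y0 where "Y0 k = y1 + of_real (e / 2 * inverse (real (Suc k)))" for k
    have Y0V: "Y0 k \<in> V" "Y0 k \<noteq> y1" for k
    proof -
      have pos: "0 < e / 2 * inverse (real (Suc k))" using y1(2) by simp
      have "e / 2 * inverse (real (Suc k)) \<le> e / 2 * 1"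
        using y1(2) by (intro mult_left_mono) (auto simp: inverse_le_1_iff)
      then have "e / 2 * inverse (real (Suc k)) < e" using y1(2) by simp
      moreover have d: "dist y1 (Y0 k) = \<bar>e / 2 * inverse (real (Suc k))\<bar>"
        unfolding Y0_def by (metis add_diff_cancel_left' dist_norm norm_minus_commute norm_of_real)
      ultimately have "Y0 k \<in> ball y1 e" using pos by simp
      then show "Y0 k \<in> V" using y1(3) by blast
      have "dist y1 (Y0 k) \<noteq> 0" unfolding d using pos by linarith
      then show "Y0 k \<noteq> y1" by auto
    qed
    have Y0lim: "Y0 \<longlonglongrightarrow> y1"
    proof -
      have "(\<lambda>k. y1 + of_real (e / 2 * inverse (real (Suc k)))) \<longlonglongrightarrow> y1 + of_real (e / 2 * 0)"
        by (intro tendsto_intros LIMSEQ_inverse_real_of_nat)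
      then show ?thesis unfolding Y0_def by simp
    qed
    have coeffcont: "isCont (\<lambda>y. coeff (P y) j) y1" for j
      using holomorphic_on_imp_continuous_on[OF holP] V(1) y1(1) by (simp add: continuous_on_eq_continuous_at)
    \<comment> \<open>By \<open>root_bound\<close>, because the leading coefficients tend to a
      nonzero limit.\<close>
    have bdd: "bounded (range (\<lambda>k. Z (Y0 k)))"
    proof -
      define N where "N k = (2 * norm (coeff (P (Y0 k)) n) + (\<Sum>i<n. norm (coeff (P (Y0 k)) i))) / norm (coeff (P (Y0 k)) n)" for k
      have "N \<longlonglongrightarrow> (2 * norm (coeff (P y1) n) + (\<Sum>i<n. norm (coeff (P y1) i))) / norm (coeff (P y1) n)"
        unfolding N_def
        by (intro tendsto_intros isCont_tendsto_compose[OF coeffcont Y0lim]) (use leadP VF[OF y1(1)] in auto)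
      then have "Bseq N" by (rule convergent_imp_Bseq[OF convergentI])
      then obtain K where K: "\<And>k. norm (N k) \<le> K" by (auto simp: Bseq_def)
      have "norm (Z (Y0 k)) \<le> K" for k
      proof -
        have pos: "norm (coeff (P (Y0 k)) n) > 0" using leadP[of "Y0 k"] VF[OF Y0V(1)] by simp
        have "norm (coeff (P (Y0 k)) n) * (1 + norm (Z (Y0 k))) \<le>
            2 * norm (coeff (P (Y0 k)) n) + (\<Sum>i<n. norm (coeff (P (Y0 k)) i))"
          using root_bound[of "P (Y0 k)" "Z (Y0 k)"] Z[OF Y0V(1)] P0[OF Y0V(1)] degP[OF Y0V(1)] by simp
        then have "1 + norm (Z (Y0 k)) \<le> N k"
          unfolding N_def by (subst pos_le_divide_eq[OF pos]) (simp add: mult.commute)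
        then show ?thesis using K[of k] by auto
      qed
      then show ?thesis by (auto simp: bounded_iff)
    qed
    obtain z1 r where r: "strict_mono r" "((\<lambda>k. Z (Y0 k)) \<circ> r) \<longlonglongrightarrow> z1"
      using bounded_imp_convergent_subsequence[OF bdd] by blast
    define Y where "Y k = Y0 (r k)" for k
    define W where "W k = Z (Y k)" for k
    have Ylim: "Y \<longlonglongrightarrow> y1" unfolding Y_def using LIMSEQ_subseq_LIMSEQ[OF Y0lim r(1)] by (simp add: o_def)
    have Wlim: "W \<longlonglongrightarrow> z1" unfolding W_def Y_def using r(2) by (simp add: o_def)
    have YV: "Y k \<in> V" "Y k \<noteq> y1" for k using Y0V by (simp_all add: Y_def)
    have W: "W k \<noteq> Y k" "poly (P (Y k)) (W k) = 0" "poly (pderiv (P (Y k))) (W k) = 0" for k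
      using Z[OF YV(1)] by (simp_all add: W_def)
    have Yat: "filterlim Y (at y1) sequentially" using Ylim YV(2) by (simp add: filterlim_at)
    have coefflim: "(\<lambda>k. coeff (P (Y k)) j) \<longlonglongrightarrow> coeff (P y1) j" for j
      by (rule isCont_tendsto_compose[OF coeffcont Ylim])
    have "(\<lambda>k. poly (P (Y k)) (W k)) \<longlonglongrightarrow> poly (P y1) z1"
      by (rule tendsto_poly_coeffs[OF coefflim _ degP' Wlim]) (simp add: degP')
    then have root: "poly (P y1) z1 = 0" using W(2) by (simp add: LIMSEQ_const_iff)
    \<comment> \<open>Near \<open>y1\<close> the contact estimate holds for all points of contact at
      once, so a tangent has no second zero there.\<close>
    have "z1 \<noteq> y1"
    proof
      assume eq: "z1 = y1"
      obtain h c where h: "h > 0" "c > 0" "\<And>y z. y \<in> ball y1 h \<Longrightarrow> z \<in> ball y1 h \<Longrightarrow> c * norm (z - y) ^ 2 \<le> norm (poly (P y) z)"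
        using contact[OF y1(1)] by blast
      have "eventually (\<lambda>k. Y k \<in> ball y1 h \<and> W k \<in> ball y1 h) sequentially"
        using tendstoD[OF Ylim h(1)] tendstoD[OF Wlim h(1)] unfolding eq
        by eventually_elim (simp add: dist_commute)
      then obtain k where k: "Y k \<in> ball y1 h" "W k \<in> ball y1 h" by (auto simp: eventually_sequentially)
      from h(3)[OF k] have "c * norm (W k - Y k) ^ 2 \<le> 0" using W(2) by simp
      then show False using h(2) W(1)[of k] by (simp add: mult_le_0_iff)
    qed

    \<comment> \<open>Comparing the tangents to first order\<close>
    define \<phi> where "\<phi> y z = s y + deriv s y * (z - y)" for y z
    define v where "v k = e1 + W k *s e3 + \<phi> (Y k) (W k) *s e2" for k
    define v1 where "v1 = e1 + z1 *s e3 + \<phi> y1 z1 *s e2"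
    \<comment> \<open>The vertical gap, at the second multiple point \<open>W k\<close>, between the
      limiting tangent and the one at \<open>Y k\<close>.\<close>
    define \<tau> where "\<tau> k = \<phi> y1 (W k) - \<phi> (Y k) (W k)" for k
    define K where "K k = (\<Sum>j<n. coeff (restrict_line F (v k) e2) (Suc j) * \<tau> k ^ j)" for k
    have scont: "isCont s y1" "isCont (deriv s) y1"
      using holomorphic_on_imp_continuous_on[OF s(1)] holomorphic_on_imp_continuous_on[OF ds(1)] s(2) VB[OF y1(1)]
      by (simp_all add: continuous_on_eq_continuous_at)
    note slim = isCont_tendsto_compose[OF scont(1) Ylim] isCont_tendsto_compose[OF scont(2) Ylim]
    have vlim: "v \<longlonglongrightarrow> v1"
      unfolding v_def v1_def \<phi>_def by (intro tendsto_intros slim Ylim Wlim)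
    have \<tau>0: "\<tau> \<longlonglongrightarrow> 0"
    proof -
      have "\<tau> \<longlonglongrightarrow> s y1 + deriv s y1 * (z1 - y1) - (s y1 + deriv s y1 * (z1 - y1))"
        unfolding \<tau>_def \<phi>_def by (intro tendsto_intros slim Ylim Wlim)
      then show ?thesis by simp
    qed
    have npos: "n > 0" using degP[OF y1(1)] root P0[OF y1(1)]
      by (metis degree_eq_zeroE gr0I mult_zero_right pCons_0_0 poly_pCons add.right_neutral poly_0)
    have Klim: "K \<longlonglongrightarrow> coeff (restrict_line F v1 e2) 1"
    proof -
      have "K \<longlonglongrightarrow> (\<Sum>j<n. coeff (restrict_line F v1 e2) (Suc j) * 0 ^ j)"
        unfolding K_def by (intro tendsto_intros tendsto_coeff_restrict_line vlim \<tau>0)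
      then show ?thesis using npos by (cases n) (simp_all add: sum.lessThan_Suc_shift del: sum.lessThan_Suc)
    qed
    have Fv1: "eval3 F v1 = 0" using root by (simp only: evP v1_def \<phi>_def)
    \<comment> \<open>This is what the avoidance of \<open>T\<close> is for: it makes the limit of
      \<open>K\<close> nonzero.\<close>
    have "z1 \<notin> D"
    proof
      assume "z1 \<in> D"
      then have "(\<phi> y1 z1, z1) \<in> T" unfolding T_def using Fv1 by (auto simp: v1_def)
      then show False using V(4)[OF y1(1)] by (auto simp: \<phi>_def)
    qed
    then have "rsquarefree (restrict_line F (e1 + z1 *s e3) e2)" by (auto simp: D_def)
    then have K1: "coeff (restrict_line F v1 e2) 1 \<noteq> 0"
      unfolding v1_def by (rule coeff_1_nonzero_if_simple[OF F]) (use Fv1 in \<open>simp only: v1_def\<close>)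
    have PW: "poly (P y1) (W k) = \<tau> k * K k" for k
    proof -
      have "eval3 F (v k) = 0" using W(2)[of k] by (simp only: evP v_def \<phi>_def)
      moreover have "e1 + W k *s e3 + \<phi> y1 (W k) *s e2 = v k + \<tau> k *s e2"
        by (simp add: v_def \<tau>_def vec_eq_iff algebra_simps)
      ultimately show ?thesis
        unfolding evP \<phi>_def[symmetric] K_def by (simp only: eval3_shift[OF F(1)] add_0)
    qed
    define a where "a = deriv (deriv s) y1"
    have der: "((\<lambda>y. (s y - s y1) / (y - y1)) \<longlongrightarrow> deriv s y1) (at y1)"
      "((\<lambda>y. (deriv s y - deriv s y1) / (y - y1)) \<longlongrightarrow> a) (at y1)"
      using holomorphic_derivI[OF s(1,2) VB[OF y1(1)]] holomorphic_derivI[OF ds(1) s(2) VB[OF y1(1)]]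
      by (simp_all add: has_field_derivative_iff a_def)
    note der' = filterlim_compose[OF der(1) Yat] filterlim_compose[OF der(2) Yat]
    \<comment> \<open>The derivative of \<open>\<phi> y z\<close> in \<open>y\<close> is
      \<open>deriv (deriv s) y * (z - y)\<close>: to first order the tangent turns about its point
      of contact.\<close>
    have \<tau>lim: "(\<lambda>k. \<tau> k / (Y k - y1)) \<longlonglongrightarrow> a * (y1 - z1)"
    proof -
      have "(\<lambda>k. deriv s y1 - (s (Y k) - s y1) / (Y k - y1) - (deriv s (Y k) - deriv s y1) / (Y k - y1) * (W k - Y k))
          \<longlonglongrightarrow> deriv s y1 - deriv s y1 - a * (z1 - y1)"
        by (intro tendsto_intros der' Wlim Ylim)
      moreover have "deriv s y1 - (s (Y k) - s y1) / (Y k - y1) - (deriv s (Y k) - deriv s y1) / (Y k - y1) * (W k - Y k)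
          = \<tau> k / (Y k - y1)" for k
      proof -
        have "Y k - y1 \<noteq> 0" using YV(2)[of k] by simp
        then show ?thesis by (simp add: \<tau>_def \<phi>_def divide_simps) (simp add: algebra_simps)
      qed
      moreover have "deriv s y1 - deriv s y1 - a * (z1 - y1) = a * (y1 - z1)"
        by (simp add: algebra_simps)
      ultimately show ?thesis by (simp only:)
    qed
    have "\<exists>E. \<forall>j. ((\<lambda>y. (coeff (P y) j - coeff (P y1) j) / (y - y1)) \<longlongrightarrow> E j) (at y1)"
    proof (intro choice allI)
      fix j
      show "\<exists>E. ((\<lambda>y. (coeff (P y) j - coeff (P y1) j) / (y - y1)) \<longlongrightarrow> E) (at y1)"
        using holomorphic_derivI[OF holP V(1) y1(1), of j] unfolding has_field_derivative_iff by (rule exI)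
    qed
    then obtain E where E: "\<And>j. ((\<lambda>y. (coeff (P y) j - coeff (P y1) j) / (y - y1)) \<longlongrightarrow> E j) (at y1)" by blast
    define C where "C = (\<Sum>j<n. of_nat (Suc j) * - E (Suc j) * z1 ^ j)"
    \<comment> \<open>\<open>W k\<close> is a root of the derivative for the tangent at
      \<open>Y k\<close>, so the derivative for \<open>y1\<close> is of first order in
      \<open>Y k - y1\<close> there.\<close>
    have Clim: "(\<lambda>k. poly (pderiv (P y1)) (W k) / (Y k - y1)) \<longlonglongrightarrow> C"
    proof -
      have "(\<lambda>k. \<Sum>j<n. of_nat (Suc j) * - ((coeff (P (Y k)) (Suc j) - coeff (P y1) (Suc j)) / (Y k - y1)) * W k ^ j) \<longlonglongrightarrow> C"
        unfolding C_def by (intro tendsto_intros Wlim filterlim_compose[OF E Yat])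
      moreover have "(\<Sum>j<n. of_nat (Suc j) * - ((coeff (P (Y k)) (Suc j) - coeff (P y1) (Suc j)) / (Y k - y1)) * W k ^ j)
          = poly (pderiv (P y1)) (W k) / (Y k - y1)" for k
      proof -
        have "poly (pderiv (P y1)) (W k) = poly (pderiv (P y1)) (W k) - poly (pderiv (P (Y k))) (W k)"
          using W(3) by simp
        also have "\<dots> = (\<Sum>j<n. of_nat (Suc j) * (coeff (P y1) (Suc j) - coeff (P (Y k)) (Suc j)) * W k ^ j)"
          unfolding poly_pderiv_sum[OF degP'] sum_subtractf[symmetric] by (simp only: right_diff_distrib left_diff_distrib)
        finally show ?thesis
          by (simp only: sum_divide_distrib) (auto intro!: sum.cong simp: minus_divide_left)
      qed
      ultimately show ?thesis by simp
    qed
    obtain m q where mq: "m > 0" "poly q z1 \<noteq> 0"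
      "\<And>z. poly (P y1) z * (of_nat m * poly q z + (z - z1) * poly (pderiv q) z) = (z - z1) * poly q z * poly (pderiv (P y1)) z"
      using multiple_root_identity[OF P0[OF y1(1)] root] by metis
    \<comment> \<open>The identity at \<open>W k\<close>, divided by \<open>Y k - y1\<close>: the
      left side has a nonzero limit, while the right side carries the extra factor
      \<open>W k - z1\<close> and tends to 0.\<close>
    have lim1: "(\<lambda>k. \<tau> k / (Y k - y1) * K k * (of_nat m * poly q (W k) + (W k - z1) * poly (pderiv q) (W k)))
        \<longlonglongrightarrow> a * (y1 - z1) * coeff (restrict_line F v1 e2) 1 * (of_nat m * poly q z1 + (z1 - z1) * poly (pderiv q) z1)"
      by (intro tendsto_intros \<tau>lim Klim Wlim)
    have lim2: "(\<lambda>k. (W k - z1) * poly q (W k) * (poly (pderiv (P y1)) (W k) / (Y k - y1)))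
        \<longlonglongrightarrow> (z1 - z1) * poly q z1 * C"
      by (intro tendsto_intros Clim Wlim)
    have eq: "\<tau> k / (Y k - y1) * K k * (of_nat m * poly q (W k) + (W k - z1) * poly (pderiv q) (W k)) =
        (W k - z1) * poly q (W k) * (poly (pderiv (P y1)) (W k) / (Y k - y1))" for k
      using mq(3)[of "W k"] unfolding PW by (simp add: mult_ac)
    have "a * (y1 - z1) * coeff (restrict_line F v1 e2) 1 * (of_nat m * poly q z1) = 0"
      using LIMSEQ_unique[OF lim1[unfolded eq] lim2] by simp
    then show False
      using K1 mq(1,2) \<open>z1 \<noteq> y1\<close> Vss[OF y1(1)] by (simp add: a_def)
  qed
  then obtain y where y: "y \<in> V" "\<And>z. z \<noteq> y \<Longrightarrow> poly (P y) z = 0 \<Longrightarrow> poly (pderiv (P y)) z \<noteq> 0" by blast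
  show thesis
  proof (rule that[of y])
    show "y \<in> B" "eval3 F (e3 + deriv s y *s e2) \<noteq> 0" using VB VF y(1) by blast+
    show "Suc (card (roots (restrict_line F (e1 + (s y - deriv s y * y) *s e2) (e3 + deriv s y *s e2)))) = n"
      using card_roots_one_double[OF order2[OF y(1)] P0[OF y(1)] y(2)] degP[OF y(1)] by (simp add: P_def)
  qed
qed

lemma continuous_on_vector_smult [continuous_intros]:
  fixes e :: "complex ^ 3"
  assumes "continuous_on S f"
  shows "continuous_on S (\<lambda>x. f x *s e)"
  using assms unfolding continuous_on_def by (intro ballI tendsto_intros) blast

section \<open>Exchanging two neighbouring points of the arc\<close>

lemma cross_product_frame_nonzero:
  assumes "(\<Sum>i\<in>UNIV. cross_product e1 e2 $ i * e3 $ i) \<noteq> 0"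
  shows "cross_product (e1 + b *s e2) (e3 + a *s e2) \<noteq> 0"
proof
  assume 0: "cross_product (e1 + b *s e2) (e3 + a *s e2) = 0"
  have "(\<Sum>i\<in>UNIV. cross_product e1 e2 $ i * e3 $ i) =
      - (\<Sum>i\<in>UNIV. cross_product (e1 + b *s e2) (e3 + a *s e2) $ i * e2 $ i)"
    by (simp add: sum_3 algebra_simps)
  then show False using assms by (simp add: 0)
qed

text \<open>The value on the diagonal is the continuous extension, so that secants tend to the
  tangent.\<close>

definition secant_slope :: "(complex \<Rightarrow> complex) \<Rightarrow> complex \<times> complex \<Rightarrow> complex" where
  "secant_slope s = (\<lambda>(y, z). if y = z then deriv s y else (s y - s z) / (y - z))"

lemma tendsto_secant_slope:
  assumes s: "s holomorphic_on B" "open B" "y \<in> B"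
  shows "(secant_slope s \<longlongrightarrow> deriv s y) (nhds (y, y))"
proof (rule tendstoI)
  fix e :: real assume e: "e > 0"
  have "isCont (deriv s) y"
    using holomorphic_on_imp_continuous_on[OF holomorphic_deriv[OF s(1,2)]] s(2,3)
    by (simp add: continuous_on_eq_continuous_at)
  then obtain h1 where h1: "h1 > 0" "\<And>x. dist x y < h1 \<Longrightarrow> dist (deriv s x) (deriv s y) < e / 2"
    using e unfolding continuous_at_eps_delta by (metis half_gt_zero)
  obtain h2 where h2: "h2 > 0" "ball y h2 \<subseteq> B" using openE[OF s(2,3)] .
  define h where "h = min h1 h2"
  have "dist (secant_slope s (y1, y2)) (deriv s y) < e" if y12: "y1 \<in> ball y h" "y2 \<in> ball y h" for y1 y2
  proof (cases "y1 = y2")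
    case True
    then show ?thesis using h1(2)[of y1] y12 e by (simp add: secant_slope_def h_def dist_commute)
  next
    case False
    \<comment> \<open>Mean value inequality for \<open>s\<close> minus its linear part at
      \<open>y\<close>, whose derivative is small near \<open>y\<close>.\<close>
    have "norm ((s y1 - deriv s y * y1) - (s y2 - deriv s y * y2)) \<le> e / 2 * norm (y1 - y2)"
    proof (rule field_differentiable_bound[where S = "ball y h"])
      fix w assume w: "w \<in> ball y h"
      then have "w \<in> B" using h2(2) by (auto simp: h_def)
      note d = holomorphic_derivI[OF s(1,2) this]
      show "((\<lambda>x. s x - deriv s y * x) has_field_derivative deriv s w - deriv s y) (at w within ball y h)"
        by (rule has_field_derivative_at_within) (auto intro!: derivative_eq_intros d)
      show "norm (deriv s w - deriv s y) \<le> e / 2"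
        using h1(2)[of w] w by (simp add: h_def dist_norm norm_minus_commute)
    qed (use y12 in auto)
    moreover have "(s y1 - deriv s y * y1) - (s y2 - deriv s y * y2) =
        (secant_slope s (y1, y2) - deriv s y) * (y1 - y2)"
      using False by (simp add: secant_slope_def field_simps)
    ultimately have "norm (secant_slope s (y1, y2) - deriv s y) * norm (y1 - y2) \<le> e / 2 * norm (y1 - y2)"
      by (simp only: norm_mult)
    then have "norm (secant_slope s (y1, y2) - deriv s y) \<le> e / 2" using False by simp
    then show ?thesis using e by (simp add: dist_norm)
  qed
  moreover have "y1 \<in> ball y h \<and> y2 \<in> ball y h" if "dist (y1, y2) (y, y) < h" for y1 y2
    using that dist_fst_le[of "(y1, y2)" "(y, y)"] dist_snd_le[of "(y1, y2)" "(y, y)"]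
    by (auto simp: dist_commute)
  ultimately show "eventually (\<lambda>x. dist (secant_slope s x) (deriv s y) < e) (nhds (y, y))"
    unfolding eventually_nhds_metric using h1(1) h2(1)
    by (intro exI[of _ h]) (auto simp: h_def)
qed

text \<open>The two points of the arc near a simple point of tangency are the only points of the curve there,
  so the secants through them are transversal and a half turn of the two points about their midpoint
  exchanges them.\<close>

lemma secant_swap:
  assumes F: "homogeneous n F" and basis: "(\<Sum>i\<in>UNIV. cross_product e1 e2 $ i * e3 $ i) \<noteq> 0"
    and s: "s holomorphic_on B" "open B" and ys: "ys \<in> B"
    and curve: "\<And>y. y \<in> B \<Longrightarrow> eval3 F (e1 + y *s e3 + s y *s e2) = 0"
    and w: "eval3 F (e3 + deriv s ys *s e2) \<noteq> 0"
    and card: "Suc (card (roots (restrict_line F (e1 + (s ys - deriv s ys * ys) *s e2) (e3 + deriv s ys *s e2)))) = n"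
  obtains y2 a b l where "y2 \<in> B" "y2 \<noteq> ys" "b + a * ys = s ys" "b + a * y2 = s y2"
    "eval3 F (e3 + a *s e2) \<noteq> 0" "rsquarefree (restrict_line F (e1 + b *s e2) (e3 + a *s e2))"
    "path l" "pathstart l = line_through (e1 + b *s e2) (e3 + a *s e2)"
    "pathfinish l = line_through (e1 + b *s e2) (e3 + a *s e2)"
    "path_image l \<subseteq> transversal_lines n (zero_locus F)"
    "has_monodromy (zero_locus F) l (Transposition.transpose
      (proj_point (e1 + ys *s e3 + s ys *s e2)) (proj_point (e1 + y2 *s e3 + s y2 *s e2)))"
proof -
  \<comment> \<open>Restriction to the line of slope \<open>a\<close> and intercept
    \<open>b\<close>, again parametrised by the horizontal coordinate.\<close>
  define P where "P = (\<lambda>(a, b). restrict_line F (e1 + b *s e2) (e3 + a *s e2))"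
  have evP: "poly (P (a, b)) z = eval3 F (e1 + z *s e3 + (b + a * z) *s e2)" for a b z
    unfolding P_def prod.case poly_restrict_line
    by (rule arg_cong[where f = "eval3 F"]) (simp add: vec_eq_iff algebra_simps)
  define a0 where "a0 = deriv s ys"
  define b0 where "b0 = s ys - a0 * ys"
  define R where "R = roots (P (a0, b0))"
  have degP: "degree (P x) \<le> n" and leadP: "coeff (P (a, b)) n = eval3 F (e3 + a *s e2)" for x a b
    unfolding P_def using restrict_line_top[OF F] by (simp_all split: prod.split)
  have nz: "P (a0, b0) \<noteq> 0" using leadP[of a0 b0] w by (auto simp: a0_def)
  have deg0: "degree (P (a0, b0)) = n"
    using degP[of "(a0, b0)"] le_degree[of "P (a0, b0)" n] leadP[of a0 b0] w by (simp add: a0_def)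
  have finR: "finite R" unfolding R_def using nz by (rule poly_roots_finite)
  have cardR: "Suc (card R) = n" using card by (simp add: R_def P_def a0_def b0_def)
  have ysR: "ys \<in> R" using curve[OF ys] by (simp add: R_def evP b0_def)
  obtain e where e: "e > 0" "\<And>x y z. x \<in> R \<Longrightarrow> y \<in> R \<Longrightarrow> dist x z < e \<Longrightarrow> dist y z < e \<Longrightarrow> x = y"
    using separating_radius[OF finR] by blast
  have "eventually (\<lambda>x. coeff (P x) n \<noteq> 0 \<and> (\<forall>\<zeta>\<in>R. \<exists>z. poly (P x) z = 0 \<and> dist \<zeta> z < e)) (nhds (a0, b0))"
  proof -
    have lim: "((\<lambda>x. coeff (P x) j) \<longlongrightarrow> coeff (P (a0, b0)) j) (nhds (a0, b0))" for j
    proof -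
      have "continuous_on UNIV (\<lambda>x. coeff (P x) j)"
        unfolding P_def case_prod_beta'
        by (intro continuous_on_coeff_restrict_line continuous_intros)
      then have "isCont (\<lambda>x. coeff (P x) j) (a0, b0)" by (simp add: continuous_on_eq_continuous_at)
      then show ?thesis 
        unfolding isCont_def by (subst tendsto_at_iff_tendsto_nhds[symmetric])
    qed
    have ev: "eventually (\<lambda>x. coeff (P x) n \<noteq> 0 \<and> (\<exists>z. poly (P x) z = 0 \<and> dist \<zeta> z < e)) (nhds (a0, b0))"
      if "\<zeta> \<in> R" for \<zeta>
      by (rule eventually_root_near[OF lim _ deg0 nz _ e(1)]) (use that degP in \<open>auto simp: R_def\<close>)
    have "eventually (\<lambda>x. \<forall>\<zeta>\<in>R. coeff (P x) n \<noteq> 0 \<and> (\<exists>z. poly (P x) z = 0 \<and> dist \<zeta> z < e)) (nhds (a0, b0))"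
      using ev by (intro eventually_ball_finite[OF finR]) blast
    then show ?thesis by (rule eventually_mono) (use ysR in blast)
  qed
  \<comment> \<open>Slope and intercept of the secant through two arc points; they tend to
    \<open>(a0, b0)\<close> as both points tend to \<open>ys\<close>.\<close>
  moreover define S where "S x = (secant_slope s x, s (fst x) - secant_slope s x * fst x)" for x
  have limS: "(S \<longlongrightarrow> (a0, b0)) (nhds (ys, ys))"
  proof -
    have fc: "(fst \<longlongrightarrow> ys) (nhds (ys, ys))"
      using tendsto_fst[OF filterlim_ident[of "nhds (ys, ys)"]] by simp
    have "isCont s ys"
      using holomorphic_on_imp_continuous_on[OF s(1)] s(2) ys by (simp add: continuous_on_eq_continuous_at)
    from isCont_tendsto_compose[OF this fc] show ?thesis
      unfolding S_def a0_def b0_def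
      by (intro tendsto_intros tendsto_secant_slope[OF s ys] fc)
  qed
  ultimately have "eventually (\<lambda>x. coeff (P (S x)) n \<noteq> 0 \<and> (\<forall>\<zeta>\<in>R. \<exists>z. poly (P (S x)) z = 0 \<and> dist \<zeta> z < e)) (nhds (ys, ys))"
    by (rule eventually_compose_filterlim)
  then obtain h0 where h0: "h0 > 0" "\<And>x. dist x (ys, ys) < h0 \<Longrightarrow>
      coeff (P (S x)) n \<noteq> 0 \<and> (\<forall>\<zeta>\<in>R. \<exists>z. poly (P (S x)) z = 0 \<and> dist \<zeta> z < e)"
    by (auto simp: eventually_nhds_metric)
  obtain h1 where h1: "h1 > 0" "ball ys h1 \<subseteq> B" using openE[OF s(2) ys] .
  \<comment> \<open>Half of \<open>h0\<close>, as the distance of the pair is bounded by the sum of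
    both distances; at most \<open>e\<close>, so that both arc points stay in the ball reserved for
    the double root \<open>ys\<close>.\<close>
  define h where "h = min (h0 / 2) (min h1 e)"
  have h: "h > 0" using h0 h1 e by (simp add: h_def)
  have hB: "ball ys h \<subseteq> B" using h1(2) by (auto simp: h_def)
  have secant: "rsquarefree (P (S (y1, y2))) \<and> degree (P (S (y1, y2))) = n \<and> coeff (P (S (y1, y2))) n \<noteq> 0 \<and>
      poly (P (S (y1, y2))) y1 = 0 \<and> poly (P (S (y1, y2))) y2 = 0 \<and>
      (\<forall>z. poly (P (S (y1, y2))) z = 0 \<longrightarrow> z = y1 \<or> z = y2 \<or> (\<exists>\<zeta>\<in>R - {ys}. dist \<zeta> z < e)) \<and>
      (\<forall>\<zeta>\<in>R - {ys}. \<forall>z z'. poly (P (S (y1, y2))) z = 0 \<longrightarrow> poly (P (S (y1, y2))) z' = 0 \<longrightarrow>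
          dist \<zeta> z < e \<longrightarrow> dist \<zeta> z' < e \<longrightarrow> z = z')"
    if y12: "y1 \<in> ball ys h" "y2 \<in> ball ys h" "y1 \<noteq> y2" for y1 y2
  proof -
    define p where "p = P (S (y1, y2))"
    have "dist (y1, y2) (ys, ys) \<le> dist y1 ys + dist y2 ys"
      by (simp add: dist_Pair_Pair sqrt_sum_squares_le_sum)
    also have "\<dots> < h0 / 2 + h0 / 2"
      using y12 by (intro add_strict_mono) (auto simp: h_def dist_commute)
    finally have *: "coeff p n \<noteq> 0" "\<forall>\<zeta>\<in>R. \<exists>z. poly p z = 0 \<and> dist \<zeta> z < e"
      using h0(2)[of "(y1, y2)"] by (auto simp: p_def)
    then obtain f where f: "\<And>\<zeta>. \<zeta> \<in> R \<Longrightarrow> poly p (f \<zeta>) = 0 \<and> dist \<zeta> (f \<zeta>) < e" by metis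
    have p0: "p \<noteq> 0" using * by auto
    have degp: "degree p = n" using degP[of "S (y1, y2)"] *(1) le_degree[of p n] by (simp add: p_def)
    define a where "a = secant_slope s (y1, y2)"
    have S: "S (y1, y2) = (a, s y1 - a * y1)" by (simp add: S_def a_def)
    have a: "s y1 - a * y1 + a * y2 = s y2"
    proof -
      have "a * (y1 - y2) = s y1 - s y2" using y12(3) by (simp add: a_def secant_slope_def)
      then show ?thesis by algebra
    qed
    have r1: "poly p y1 = 0" using curve[of y1] y12(1) hB by (auto simp: p_def S evP)
    have r2: "poly p y2 = 0" using curve[of y2] y12(2) hB by (auto simp: p_def S evP a)
    have near: "dist ys y1 < e" "dist ys y2 < e" using y12 by (auto simp: h_def)
    \<comment> \<open>Two arc points near \<open>ys\<close> and one root near each of the other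
      \<open>n - 2\<close> roots of the tangent: \<open>n\<close> distinct roots, hence all of
      them.\<close>
    define A where "A = insert y1 (insert y2 (f ` (R - {ys})))"
    have injf: "inj_on f (R - {ys})" using f e(2) by (intro inj_onI) (metis DiffD1)
    have far: "y \<notin> f ` (R - {ys})" if "dist ys y < e" for y
    proof
      assume "y \<in> f ` (R - {ys})"
      then obtain \<zeta> where "\<zeta> \<in> R" "\<zeta> \<noteq> ys" "y = f \<zeta>" by blast
      then show False using e(2)[of \<zeta> ys y] f[of \<zeta>] ysR that by blast
    qed
    have "card (f ` (R - {ys})) = card R - 1"
      using card_image[OF injf] finR ysR by simp
    moreover have "card R > 0" using finR ysR card_gt_0_iff by blast
    ultimately have cardA: "card A = n"
      using cardR y12(3) far[OF near(1)] far[OF near(2)] finR by (simp add: A_def)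
    have "A \<subseteq> roots p" using f r1 r2 by (auto simp: A_def)
    moreover have "degree p \<le> card A" "finite A" using cardA degp finR by (simp_all add: A_def)
    ultimately have roots: "roots p = A" "rsquarefree p"
      using roots_eq_image_if_inj[OF p0, of A "\<lambda>x. x"] by simp_all
    have in_ball: "z = f \<zeta>" if \<zeta>: "\<zeta> \<in> R - {ys}" and z: "poly p z = 0" "dist \<zeta> z < e" for \<zeta> z
    proof -
      have "z \<in> A" using z(1) roots(1) by blast
      moreover have "z \<noteq> y1" "z \<noteq> y2" using e(2)[of \<zeta> ys] \<zeta> z(2) near ysR by blast+
      ultimately obtain \<zeta>' where "\<zeta>' \<in> R - {ys}" "z = f \<zeta>'" by (auto simp: A_def)
      then show ?thesis using e(2)[of \<zeta> \<zeta>' z] f[of \<zeta>'] \<zeta> z(2) by blast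
    qed
    have "z = y1 \<or> z = y2 \<or> (\<exists>\<zeta>\<in>R - {ys}. dist \<zeta> z < e)" if "poly p z = 0" for z
    proof -
      have "z \<in> A" using that roots(1) by blast
      then show ?thesis using f by (auto simp: A_def)
    qed
    then show ?thesis
      unfolding p_def[symmetric] using roots(2) degp *(1) r1 r2 in_ball by blast
  qed
  \<comment> \<open>Radius of the half turn about \<open>ys + q\<close>; both points stay within
    \<open>2 * norm q = h / 2\<close> of \<open>ys\<close>.\<close>
  define q :: complex where "q = of_real (h / 4)"
  have q: "norm q = h / 4" "q \<noteq> 0" using h by (simp_all add: q_def)
  define y2 where "y2 = ys + 2 * q"
  define Y where "Y t = ys + q - q * cis (pi * t)" for t
  define Y' where "Y' t = ys + q + q * cis (pi * t)" for t
  have Yb: "Y t \<in> ball ys h" "Y' t \<in> ball ys h" "Y t \<noteq> Y' t" for t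
  proof -
    have n: "norm (q * cis (pi * t)) = h / 4" using q by (simp add: norm_mult)
    have "norm (q - q * cis (pi * t)) \<le> h / 4 + h / 4"
      using norm_triangle_ineq4[of q "q * cis (pi * t)"] n q by simp
    then show "Y t \<in> ball ys h" using h by (simp add: Y_def dist_norm norm_minus_commute)
    have "norm (- q - q * cis (pi * t)) \<le> h / 4 + h / 4"
      using norm_triangle_ineq4[of "- q" "q * cis (pi * t)"] n q by simp
    then show "Y' t \<in> ball ys h" using h by (simp add: Y'_def dist_norm algebra_simps)
    have "Y' t - Y t = 2 * (q * cis (pi * t))" by (simp add: Y_def Y'_def)
    moreover have "2 * (q * cis (pi * t)) \<noteq> 0" using q(2) by simp
    ultimately show "Y t \<noteq> Y' t" by auto
  qed
  have Yends: "Y 0 = ys" "Y' 0 = y2" "Y 1 = y2" "Y' 1 = ys"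
    by (simp_all add: Y_def Y'_def y2_def)
  have contY: "continuous_on {0..1} Y" "continuous_on {0..1} Y'"
    unfolding Y_def Y'_def by (intro continuous_intros)+
  define a where "a t = secant_slope s (Y t, Y' t)" for t
  define b where "b t = s (Y t) - a t * Y t" for t
  have ba: "b t + a t * Y t = s (Y t)" "b t + a t * Y' t = s (Y' t)" for t
  proof -
    have "a t * (Y t - Y' t) = s (Y t) - s (Y' t)" using Yb(3)[of t] by (simp add: a_def secant_slope_def)
    then have "a t * Y t - a t * Y' t = s (Y t) - s (Y' t)" by (simp only: right_diff_distrib)
    then show "b t + a t * Y' t = s (Y' t)" unfolding b_def by (simp add: algebra_simps)
    show "b t + a t * Y t = s (Y t)" unfolding b_def by simp
  qed
  have PS: "P (S (Y t, Y' t)) = restrict_line F (e1 + b t *s e2) (e3 + a t *s e2)" for t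
    by (simp add: P_def S_def a_def b_def)
  note sec = secant[OF Yb(1,2,3), unfolded PS]
  have contsY: "continuous_on {0..1} (\<lambda>t. s (Y t))" "continuous_on {0..1} (\<lambda>t. s (Y' t))"
    using Yb hB by (auto intro!: continuous_on_compose2[OF holomorphic_on_imp_continuous_on[OF s(1)]] contY)
  have conta: "continuous_on {0..1} a"
  proof -
    have "a t = (s (Y t) - s (Y' t)) / (Y t - Y' t)" for t
      using Yb(3)[of t] by (simp add: a_def secant_slope_def)
    moreover have "continuous_on {0..1} (\<lambda>t. (s (Y t) - s (Y' t)) / (Y t - Y' t))"
      using Yb(3) by (intro continuous_intros contsY contY) auto
    ultimately show ?thesis by simp
  qed
  have contb: "continuous_on {0..1} b" unfolding b_def by (intro continuous_intros contsY conta contY)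
  \<comment> \<open>The secant does not depend on the order of its two points, so the path of lines
    closes up after a half turn.\<close>
  have ab01: "a 1 = a 0" "b 1 = b 0"
  proof -
    show a01: "a 1 = a 0"
      using Yb(3)[of 0] minus_divide_divide[of "s ys - s y2" "ys - y2"]
      by (simp add: a_def secant_slope_def Yends)
    show "b 1 = b 0" using ba(2)[of 1] ba(1)[of 0] unfolding a01 Yends by (metis add_right_cancel)
  qed
  define u where "u t = e1 + b t *s e2" for t
  define v where "v t = e3 + a t *s e2" for t
  define l where "l = (\<lambda>t. line_through (u t) (v t))"
  have contuv: "continuous_on {0..1} u" "continuous_on {0..1} v"
    unfolding u_def v_def by (intro continuous_intros conta contb)+
  have frame: "cross_product (u t) (v t) \<noteq> 0" for t
    unfolding u_def v_def by (rule cross_product_frame_nonzero[OF basis])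
  have Fv: "eval3 F (v t) \<noteq> 0" for t
    using sec[of t] restrict_line_top(2)[OF F, of "u t" "v t"] by (simp add: u_def v_def)
  define Q where "Q t = restrict_line F (u t) (v t)" for t
  have sec': "rsquarefree (Q t)" "degree (Q t) = n" "poly (Q t) (Y t) = 0" "poly (Q t) (Y' t) = 0"
    "\<And>z. poly (Q t) z = 0 \<Longrightarrow> z = Y t \<or> z = Y' t \<or> (\<exists>\<zeta>\<in>R - {ys}. dist \<zeta> z < e)"
    "\<And>\<zeta> z z'. \<zeta> \<in> R - {ys} \<Longrightarrow> poly (Q t) z = 0 \<Longrightarrow> poly (Q t) z' = 0 \<Longrightarrow>
        dist \<zeta> z < e \<Longrightarrow> dist \<zeta> z' < e \<Longrightarrow> z = z'" for t
    using sec[of t] unfolding Q_def u_def v_def by blast+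
  note framed = framed_path[OF F contuv frame Fv sec'(1)[unfolded Q_def]]
  obtain r where r: "root_motion Q 0 1 r" using framed(3) unfolding Q_def by blast
  have uv01: "u 1 = u 0" "v 1 = v 0" by (simp_all add: u_def v_def ab01)
  have Q01: "Q 1 = Q 0" by (simp add: Q_def uv01)
  have rY: "r ys 1 = y2" "r y2 1 = ys"
    using root_motion_unique[OF r sec'(2,1) contY(1) sec'(3), of 1]
      root_motion_unique[OF r sec'(2,1) contY(2) sec'(4), of 1] by (simp_all add: Yends)
  \<comment> \<open>At all times the roots lie in the disjoint \<open>e\<close>-balls about
    \<open>R\<close>, so a root path cannot leave the ball in which it starts; a ball not about
    \<open>ys\<close> holds only one root at a time.\<close>
  have rest: "r x 1 = x" if x: "poly (Q 0) x = 0" "x \<noteq> ys" "x \<noteq> y2" for x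
  proof -
    obtain \<zeta> where \<zeta>: "\<zeta> \<in> R - {ys}" "dist \<zeta> x < e" using sec'(5)[OF x(1)] x(2,3) Yends by auto
    have xr: "x \<in> roots (Q 0)" using x(1) by simp
    note rx = root_motionD(1,2)[OF r xr]
    have root: "poly (Q t) (r x t) = 0" if "t \<in> {0..1}" for t
      using root_motionD(3)[OF r that] xr by blast
    have "connected (r x ` {0..1})" by (rule connected_continuous_image[OF rx(1)]) simp
    moreover have "open (ball \<zeta> e)" "open (\<Union>\<xi>\<in>R - {\<zeta>}. ball \<xi> e)" by auto
    moreover have "ball \<zeta> e \<inter> (\<Union>\<xi>\<in>R - {\<zeta>}. ball \<xi> e) \<inter> r x ` {0..1} = {}"
      using e(2) \<zeta>(1) by (auto simp: mem_ball)
    moreover have "r x ` {0..1} \<subseteq> ball \<zeta> e \<union> (\<Union>\<xi>\<in>R - {\<zeta>}. ball \<xi> e)"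
    proof (rule image_subsetI)
      fix t :: real assume t: "t \<in> {0..1}"
      have "\<exists>\<xi>\<in>R. r x t \<in> ball \<xi> e"
        using sec'(5)[OF root[OF t]] Yb(1,2)[of t] ysR by (force simp: h_def)
      then show "r x t \<in> ball \<zeta> e \<union> (\<Union>\<xi>\<in>R - {\<zeta>}. ball \<xi> e)" by blast
    qed
    moreover have "ball \<zeta> e \<inter> r x ` {0..1} \<noteq> {}"
      using \<zeta>(2) rx(2) by (metis IntI atLeastAtMost_iff empty_iff imageI mem_ball order_refl zero_le_one)
    ultimately have "(\<Union>\<xi>\<in>R - {\<zeta>}. ball \<xi> e) \<inter> r x ` {0..1} = {}"
      unfolding connected_def by blast
    moreover have "r x 1 \<in> r x ` {0..1}" by (rule imageI) simp
    ultimately have b1: "dist \<zeta> (r x 1) < e"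
      unfolding mem_ball[symmetric]
      using \<open>r x ` {0..1} \<subseteq> ball \<zeta> e \<union> (\<Union>\<xi>\<in>R - {\<zeta>}. ball \<xi> e)\<close> by blast
    have "poly (Q 0) (r x 1) = 0" using root[of 1] by (simp add: Q01)
    then show ?thesis using b1 \<zeta>(2) by (intro sec'(6)[OF \<zeta>(1) _ x(1)])
  qed
  have pt: "u 0 + ys *s v 0 = e1 + ys *s e3 + s ys *s e2" "u 0 + y2 *s v 0 = e1 + y2 *s e3 + s y2 *s e2"
  proof -
    have "u 0 + z *s v 0 = e1 + z *s e3 + (b 0 + a 0 * z) *s e2" for z
      by (simp add: u_def v_def vec_eq_iff algebra_simps)
    then show "u 0 + ys *s v 0 = e1 + ys *s e3 + s ys *s e2" "u 0 + y2 *s v 0 = e1 + y2 *s e3 + s y2 *s e2"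
      using ba[of 0] unfolding Yends by (simp_all only:)
  qed
  have mono: "has_monodromy (zero_locus F) l (Transposition.transpose
      (proj_point (e1 + ys *s e3 + s ys *s e2)) (proj_point (e1 + y2 *s e3 + s y2 *s e2)))"
    unfolding l_def
  proof (rule framed(4))
    show "root_motion (\<lambda>t. restrict_line F (u t) (v t)) 0 1 r" using r by (simp add: Q_def[abs_def])
    fix x assume x: "eval3 F (u 0 + x *s v 0) = 0"
    define pp where "pp x = proj_point (u 0 + x *s v 0)" for x
    have inj: "pp x = pp y \<longleftrightarrow> x = y" for x y
      using inj_frame_points[OF frame[of 0]] unfolding pp_def by (auto dest: injD)
    have "Transposition.transpose (pp ys) (pp y2) (pp x) = pp (r x 1)"
      using rest[of x] x rY by (auto simp: Transposition.transpose_def inj Q_def)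
    then show "Transposition.transpose (proj_point (e1 + ys *s e3 + s ys *s e2))
        (proj_point (e1 + y2 *s e3 + s y2 *s e2)) (proj_point (u 0 + x *s v 0)) =
        proj_point (u 1 + r x 1 *s v 1)"
      unfolding pp_def pt uv01 .
  qed
  show thesis
  proof (rule that[of y2 "b 0" "a 0" l])
    show "y2 \<in> B" using Yb(2)[of 0] hB Yends by auto
    show "y2 \<noteq> ys" using Yb(3)[of 0] Yends by simp
    show "b 0 + a 0 * ys = s ys" "b 0 + a 0 * y2 = s y2" using ba[of 0] by (simp_all add: Yends)
    show "eval3 F (e3 + a 0 *s e2) \<noteq> 0" using Fv[of 0] by (simp add: v_def)
    show "rsquarefree (restrict_line F (e1 + b 0 *s e2) (e3 + a 0 *s e2))"
      using sec'(1)[of 0] by (simp add: Q_def u_def v_def)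
    show "path l" "path_image l \<subseteq> transversal_lines n (zero_locus F)"
      unfolding l_def by (rule framed(1), rule framed(2))
    show "pathstart l = line_through (e1 + b 0 *s e2) (e3 + a 0 *s e2)"
      "pathfinish l = line_through (e1 + b 0 *s e2) (e3 + a 0 *s e2)"
      by (simp_all add: l_def pathstart_def pathfinish_def uv01) (simp_all add: u_def v_def)
  qed (rule mono)
qed

section \<open>The loop\<close>

text \<open>The lines through the fixed point \<open>e2\<close>, parallel in the affine coordinates,
  stay transversal near the initial one. Squarefreeness passes from \<open>F\<close> to its factor
  \<open>G\<close>, so the points of \<open>G\<close> move along holomorphic branches.\<close>

lemma simultaneous_arcs:
  assumes F: "homogeneous n F" "eval3 F e2 \<noteq> 0" "rsquarefree (restrict_line F e1 e2)"
    and G: "G dvd F" "homogeneous d G"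
  obtains \<rho> r where "\<rho> > 0"
    "\<And>\<zeta>. eval3 G (e1 + \<zeta> *s e2) = 0 \<Longrightarrow> r \<zeta> holomorphic_on ball 0 \<rho> \<and> r \<zeta> 0 = \<zeta>"
    "\<And>\<zeta> y. eval3 G (e1 + \<zeta> *s e2) = 0 \<Longrightarrow> y \<in> ball 0 \<rho> \<Longrightarrow> eval3 G (e1 + y *s e3 + r \<zeta> y *s e2) = 0"
    "\<And>\<zeta> \<xi> y. eval3 G (e1 + \<zeta> *s e2) = 0 \<Longrightarrow> eval3 G (e1 + \<xi> *s e2) = 0 \<Longrightarrow> y \<in> ball 0 \<rho> \<Longrightarrow>
      r \<zeta> y = r \<xi> y \<Longrightarrow> \<zeta> = \<xi>"
    "\<And>y. y \<in> ball 0 \<rho> \<Longrightarrow> rsquarefree (restrict_line F (e1 + y *s e3) e2)"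
proof -
  obtain H where FH: "F = G * H" using G(1) by (elim dvdE)
  define U where "U = - {b. \<not> (eval3 F (e2 + b *s 0) \<noteq> 0 \<and> rsquarefree (restrict_line F (e1 + b *s e3) (e2 + b *s 0)))}"
  have "open U"
    unfolding U_def using finite_degenerate_pencil[OF F, where u' = e3 and w' = 0]
    by (intro open_Compl finite_imp_closed)
  have F_U: "rsquarefree (restrict_line F (e1 + y *s e3) e2)" if "y \<in> U" for y using that by (simp add: U_def)
  have "0 \<in> U" using F(2,3) by (simp add: U_def)
  define P where "P y = restrict_line G (e1 + y *s e3) e2" for y
  have evP: "poly (P y) x = eval3 G (e1 + y *s e3 + x *s e2)" for x y by (simp add: P_def)
  have simpleP: "rsquarefree (P y)" if "y \<in> U" for y
    using F_U[OF that] unfolding FH restrict_line_mult P_def by (rule rsquarefree_mult_left)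
  have degP: "degree (P y) = d" for y
    unfolding P_def by (rule degree_restrict_line[OF G(2)]) (use F(2) in \<open>simp add: FH\<close>)
  have holP: "(\<lambda>y. coeff (P y) j) holomorphic_on S" for j S
    unfolding P_def by (intro holomorphic_on_coeff_restrict_line) (auto intro!: holomorphic_intros)
  obtain W r where W: "open W" "0 \<in> W"
    and r: "\<And>\<zeta>. \<zeta> \<in> roots (P 0) \<Longrightarrow> continuous_on (U \<inter> W) (r \<zeta>)"
      "\<And>\<zeta>. \<zeta> \<in> roots (P 0) \<Longrightarrow> r \<zeta> 0 = \<zeta>"
      "\<And>y. y \<in> U \<inter> W \<Longrightarrow> roots (P y) = (\<lambda>\<zeta>. r \<zeta> y) ` roots (P 0)"
      "\<And>y. y \<in> U \<inter> W \<Longrightarrow> inj_on (\<lambda>\<zeta>. r \<zeta> y) (roots (P 0))"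
    by (rule local_root_sections[OF holomorphic_on_imp_continuous_on[OF holP] degP simpleP \<open>0 \<in> U\<close>]) blast+
  obtain \<rho> where \<rho>: "\<rho> > 0" "ball 0 \<rho> \<subseteq> U \<inter> W"
    using openE[of "U \<inter> W" 0] \<open>open U\<close> \<open>0 \<in> U\<close> W by blast
  have mem: "\<zeta> \<in> roots (P 0)" if "eval3 G (e1 + \<zeta> *s e2) = 0" for \<zeta>
    using that by (simp add: evP)
  have root: "poly (P y) (r \<zeta> y) = 0" if "\<zeta> \<in> roots (P 0)" "y \<in> ball 0 \<rho>" for \<zeta> y
    using r(3)[of y] that \<rho>(2) by blast
  show thesis
  proof (rule that[of \<rho> r])
    fix \<zeta> assume "eval3 G (e1 + \<zeta> *s e2) = 0"
    then have \<zeta>: "\<zeta> \<in> roots (P 0)" by (rule mem)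
    have "r \<zeta> holomorphic_on ball 0 \<rho>"
    proof (rule holomorphic_on_simple_root[OF holP open_ball])
      show "continuous_on (ball 0 \<rho>) (r \<zeta>)" using continuous_on_subset[OF r(1)[OF \<zeta>] \<rho>(2)] .
      fix y :: complex assume y: "y \<in> ball 0 \<rho>"
      show "degree (P y) \<le> d" using degP by simp
      show "poly (P y) (r \<zeta> y) = 0" by (rule root[OF \<zeta> y])
      then show "poly (pderiv (P y)) (r \<zeta> y) \<noteq> 0"
        using simpleP[of y] y \<rho>(2) unfolding rsquarefree_roots by blast
    qed
    then show "r \<zeta> holomorphic_on ball 0 \<rho> \<and> r \<zeta> 0 = \<zeta>" using r(2)[OF \<zeta>] by blast
    fix y :: complex assume y: "y \<in> ball 0 \<rho>"
    show "eval3 G (e1 + y *s e3 + r \<zeta> y *s e2) = 0" using root[OF \<zeta> y] by (simp only: evP)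
    fix \<xi> assume "eval3 G (e1 + \<xi> *s e2) = 0" "r \<zeta> y = r \<xi> y"
    then show "\<zeta> = \<xi>" using inj_onD[OF r(4)] y \<rho>(2) \<zeta> mem by blast
  next
    show "rsquarefree (restrict_line F (e1 + y *s e3) e2)" if "y \<in> ball 0 \<rho>" for y
      using F_U that \<rho>(2) by blast
  qed (rule \<rho>(1))
qed

text \<open>A straight arc would put infinitely many points of a line on the curve of
  \<open>G\<close>, against \<open>restrict_line_irreducible_nonzero\<close>.\<close>

lemma arc_curved:
  assumes G: "irreducible G" "homogeneous d G" "d \<ge> 2"
    and basis: "(\<Sum>i\<in>UNIV. cross_product e1 e2 $ i * e3 $ i) \<noteq> 0"
    and s: "s holomorphic_on ball 0 \<rho>" "\<rho> > 0"
    and curve: "\<And>y. y \<in> ball 0 \<rho> \<Longrightarrow> eval3 G (e1 + y *s e3 + s y *s e2) = 0"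
  shows "\<exists>y\<in>ball 0 \<rho>. deriv (deriv s) y \<noteq> 0"
proof (rule ccontr)
  assume "\<not> ?thesis"
  then have 0: "deriv (deriv s) y = 0" if "y \<in> ball 0 \<rho>" for y using that by blast
  have d: "(s has_field_derivative deriv s y) (at y)" "(deriv s has_field_derivative 0) (at y)" if y: "y \<in> ball 0 \<rho>" for y
    using holomorphic_derivI[OF s(1) open_ball y] holomorphic_derivI[OF holomorphic_deriv[OF s(1) open_ball] open_ball y]
    by (simp_all add: 0[OF y])
  have "\<exists>a. \<forall>y\<in>ball 0 \<rho>. deriv s y = a"
    by (rule has_field_derivative_zero_constant[OF convex_ball]) (rule has_field_derivative_at_within[OF d(2)])
  then obtain a where a: "\<And>y. y \<in> ball 0 \<rho> \<Longrightarrow> deriv s y = a" by blast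
  have "((\<lambda>y. s y - a * y) has_field_derivative 0) (at y within ball 0 \<rho>)" if y: "y \<in> ball 0 \<rho>" for y
    by (rule has_field_derivative_at_within) (auto intro!: derivative_eq_intros d(1)[OF y] simp: a[OF y])
  then have "\<exists>b. \<forall>y\<in>ball 0 \<rho>. s y - a * y = b"
    by (rule has_field_derivative_zero_constant[OF convex_ball])
  then obtain b where b: "\<And>y. y \<in> ball 0 \<rho> \<Longrightarrow> s y - a * y = b" by blast
  have "restrict_line G (e1 + b *s e2) (e3 + a *s e2) = 0"
  proof (rule poly_eq_0_if_infinite_roots)
    show "infinite (ball 0 \<rho> :: complex set)"
      using s(2) finite_imp_not_open[of "ball 0 \<rho> :: complex set"] by auto
    fix y :: complex assume y: "y \<in> ball 0 \<rho>"
    have "e1 + b *s e2 + y *s (e3 + a *s e2) = e1 + y *s e3 + s y *s e2"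
      unfolding b[OF y, symmetric] by (simp add: vec_eq_iff algebra_simps)
    then show "poly (restrict_line G (e1 + b *s e2) (e3 + a *s e2)) y = 0"
      using curve[OF y] by (simp only: poly_restrict_line)
  qed
  then show False
    using restrict_line_irreducible_nonzero[OF G cross_product_frame_nonzero[OF basis]] by blast
qed

theorem corollary1:
  fixes F G :: poly3 and n d :: nat
    and l\<^sub>0 :: dual_plane and P\<^sub>1 P\<^sub>2 :: proj_plane
  assumes "homogeneous n F" and "squarefree F"
    and "irreducible G" and "G dvd F"
    and "homogeneous d G" and "d \<ge> 2"
    and "l\<^sub>0 \<in> transversal_lines n (zero_locus F)"
    and "P\<^sub>1 \<in> zero_locus G \<inter> line_points l\<^sub>0" and "P\<^sub>2 \<in> zero_locus G \<inter> line_points l\<^sub>0"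
    and "P\<^sub>1 \<noteq> P\<^sub>2"
  shows "\<exists>l. path l \<and> pathstart l = l\<^sub>0 \<and> pathfinish l = l\<^sub>0 \<and>
    path_image l \<subseteq> transversal_lines n (zero_locus F) \<and>
    has_monodromy (zero_locus F) l (Transposition.transpose P\<^sub>1 P\<^sub>2)"
proof -

  \<comment> \<open>A frame for the initial line\<close>
  note F = assms(1) and G = assms(3,5,6)
  define T where "T = transversal_lines n (zero_locus F)"
  obtain H where FH: "F = G * H" using assms(4) by (elim dvdE)
  have GF: "eval3 F v = 0" if "eval3 G v = 0" for v using that by (simp add: FH)
  obtain p1 where p1: "p1 \<noteq> 0" "P\<^sub>1 = proj_point p1" by (rule proj_point_cases)
  obtain p2 where p2: "p2 \<noteq> 0" "P\<^sub>2 = proj_point p2" by (rule proj_point_cases)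
  have Gp: "eval3 G p1 = 0" "eval3 G p2 = 0"
    using assms(8,9) proj_point_in_zero_locus_iff[OF G(2)] p1 p2 by auto
  have cp: "cross_product p1 p2 \<noteq> 0"
  proof
    assume "cross_product p1 p2 = 0"
    then obtain k where k: "p1 = k *s p2" using parallel_if_cross_product_eq_0[OF _ p2(1)] by blast
    then have "k \<noteq> 0" using p1(1) by auto
    then have "P\<^sub>1 = P\<^sub>2" unfolding p1 p2 using p1(1) p2(1) k by (subst proj_point_eq_iff) auto
    then show False using assms(10) by simp
  qed
  have l0p: "l\<^sub>0 = line_through p1 p2"
    using assms(8,9) by (intro line_eq_line_through p1 p2 cp) (auto simp: p1 p2)
  \<comment> \<open>The initial line has only finitely many points in common with the curve, so it
    is not contained in it.\<close>
  have "restrict_line F p1 p2 \<noteq> 0"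
  proof
    assume 0: "restrict_line F p1 p2 = 0"
    have "proj_point (p1 + s *s p2) \<in> line_points l\<^sub>0 \<inter> zero_locus F" for s
    proof -
      have nz: "p1 + s *s p2 \<noteq> 0" by (rule frame_point_nonzero[OF cp])
      have "eval3 F (p1 + s *s p2) = poly (restrict_line F p1 p2) s" by simp
      then have "proj_point (p1 + s *s p2) \<in> zero_locus F"
        unfolding proj_point_in_zero_locus_iff[OF F nz] 0 by simp
      moreover have "proj_point (p1 + s *s p2) \<in> line_points l\<^sub>0"
        unfolding l0p line_points_line_through[OF cp] mem_Collect_eq
        using nz by (intro exI[of _ 1] exI[of _ s]) simp
      ultimately show ?thesis by blast
    qed
    then have "range (\<lambda>s. proj_point (p1 + s *s p2)) \<subseteq> line_points l\<^sub>0 \<inter> zero_locus F" by blast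
    moreover have "finite (line_points l\<^sub>0 \<inter> zero_locus F)"
      using assms(7) by (simp add: transversal_lines_def)
    ultimately have "finite (range (\<lambda>s. proj_point (p1 + s *s p2)))" by (rule finite_subset)
    then have "finite (UNIV :: complex set)" by (rule finite_imageD) (rule inj_frame_points[OF cp])
    then show False using infinite_UNIV_char_0 by blast
  qed
  from poly_roots_finite[OF this] have "finite (insert 0 (roots (restrict_line F p1 p2)))" by (rule finite.insertI)
  from ex_new_if_finite[OF infinite_UNIV_char_0 this]
  obtain k where k: "k \<noteq> 0" "eval3 F (p1 + k *s p2) \<noteq> 0" by auto
  \<comment> \<open>The frame consists of \<open>P\<^sub>1\<close> and a point of the line off the
    curve, so \<open>P\<^sub>1\<close> has parameter 0. As \<open>e1 - e2\<close> is a multiple of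
    \<open>p2\<close>, the parameter of \<open>P\<^sub>2\<close> is -1.\<close>
  define e1 where "e1 = p1"
  define e2 where "e2 = p1 + k *s p2"
  have ce: "cross_product e1 e2 = k *s cross_product p1 p2"
    by (simp add: e1_def e2_def vec_eq_iff forall_3 algebra_simps)
  then have c12: "cross_product e1 e2 \<noteq> 0" using k(1) cp by simp
  have l0: "l\<^sub>0 = line_through e1 e2"
    using line_through_combination[of 1 k 0 1 p1 p2] k(1) cp by (simp add: l0p e1_def e2_def)
  have Fe2: "eval3 F e2 \<noteq> 0" using k(2) by (simp add: e2_def)
  have good0: "rsquarefree (restrict_line F e1 e2)"
    using assms(7) transversal_frame_iff[OF F c12 Fe2] by (simp add: l0)
  have P1: "P\<^sub>1 = proj_point (e1 + 0 *s e2)" by (simp add: p1 e1_def)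
  have e12: "e1 + (-1) *s e2 = (- k) *s p2" by (simp add: e1_def e2_def vec_eq_iff)
  have P2: "P\<^sub>2 = proj_point (e1 + (-1) *s e2)"
    unfolding p2 e12 using k(1) p2(1) by (subst proj_point_eq_iff) (auto intro!: exI[of _ "- 1 / k"] simp: vec_eq_iff)
  have G1: "eval3 G (e1 + 0 *s e2) = 0" using Gp(1) by (simp add: e1_def)
  have G2: "eval3 G (e1 + (-1) *s e2) = 0" unfolding e12 eval3_scale[OF G(2)] by (simp add: Gp(2))
  obtain e3 where basis: "(\<Sum>i\<in>UNIV. cross_product e1 e2 $ i * e3 $ i) \<noteq> 0"
    using triple_product_nonzero_exists[OF c12] by blast

  \<comment> \<open>The arcs, a simple tangent and a nearby secant\<close>
  obtain \<rho> r where \<rho>: "\<rho> > 0"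
    and rhol: "\<And>\<zeta>. eval3 G (e1 + \<zeta> *s e2) = 0 \<Longrightarrow> r \<zeta> holomorphic_on ball 0 \<rho> \<and> r \<zeta> 0 = \<zeta>"
    and rG: "\<And>\<zeta> y. eval3 G (e1 + \<zeta> *s e2) = 0 \<Longrightarrow> y \<in> ball 0 \<rho> \<Longrightarrow> eval3 G (e1 + y *s e3 + r \<zeta> y *s e2) = 0"
    and rinj: "\<And>\<zeta> \<xi> y. eval3 G (e1 + \<zeta> *s e2) = 0 \<Longrightarrow> eval3 G (e1 + \<xi> *s e2) = 0 \<Longrightarrow> y \<in> ball 0 \<rho> \<Longrightarrow>
      r \<zeta> y = r \<xi> y \<Longrightarrow> \<zeta> = \<xi>"
    and rF: "\<And>y. y \<in> ball 0 \<rho> \<Longrightarrow> rsquarefree (restrict_line F (e1 + y *s e3) e2)"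
    by (rule simultaneous_arcs[OF F Fe2 good0 assms(4) G(2)]) blast
  define s where "s = r 0"
  define s' where "s' = r (-1)"
  have shol: "s holomorphic_on ball 0 \<rho>" "s' holomorphic_on ball 0 \<rho>" "s 0 = 0" "s' 0 = -1"
    using rhol[OF G1] rhol[OF G2] by (simp_all add: s_def s'_def)
  have sG: "eval3 G (e1 + y *s e3 + s y *s e2) = 0" "eval3 G (e1 + y *s e3 + s' y *s e2) = 0" "s y \<noteq> s' y"
    if "y \<in> ball 0 \<rho>" for y
    using rG[OF G1 that] rG[OF G2 that] rinj[OF G1 G2 that] by (auto simp: s_def s'_def)
  obtain y0 where y0: "y0 \<in> ball 0 \<rho>" "deriv (deriv s) y0 \<noteq> 0"
    using arc_curved[OF G basis shol(1) \<rho> sG(1)] by blast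
  obtain y1 where y1: "y1 \<in> ball 0 \<rho>" "eval3 F (e3 + deriv s y1 *s e2) \<noteq> 0"
    "Suc (card (roots (restrict_line F (e1 + (s y1 - deriv s y1 * y1) *s e2) (e3 + deriv s y1 *s e2)))) = n"
    by (rule simple_tangent_exists[OF F Fe2 good0 shol(1) open_ball y0 GF[OF sG(1)] rF])
  obtain y2 a b \<mu> where y2: "y2 \<in> ball 0 \<rho>" "y2 \<noteq> y1" "b + a * y1 = s y1" "b + a * y2 = s y2"
    and Fw: "eval3 F (e3 + a *s e2) \<noteq> 0" and sec: "rsquarefree (restrict_line F (e1 + b *s e2) (e3 + a *s e2))"
    and \<mu>: "path \<mu>" "pathstart \<mu> = line_through (e1 + b *s e2) (e3 + a *s e2)"
      "pathfinish \<mu> = line_through (e1 + b *s e2) (e3 + a *s e2)" "path_image \<mu> \<subseteq> T"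
    and swap: "has_monodromy (zero_locus F) \<mu> (Transposition.transpose
      (proj_point (e1 + y1 *s e3 + s y1 *s e2)) (proj_point (e1 + y2 *s e3 + s y2 *s e2)))"
    unfolding T_def
    by (rule secant_swap[OF F basis shol(1) open_ball y1(1) GF[OF sG(1)] y1(2,3)])

  \<comment> \<open>Moving the line parallel to itself\<close>
  define u1 where "u1 t = e1 + (of_real t * y1) *s e3" for t :: real
  have in_ball: "of_real t * y1 \<in> ball 0 \<rho>" if "t \<in> {0..1}" for t :: real
  proof -
    have "norm (of_real t * y1) \<le> 1 * norm y1" unfolding norm_mult using that by (intro mult_right_mono) auto
    then show ?thesis using y1(1) by simp
  qed
  have cu1: "cross_product (u1 t) e2 \<noteq> 0" for t
  proof
    assume "cross_product (u1 t) e2 = 0"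
    moreover have "(\<Sum>i\<in>UNIV. cross_product (u1 t) e2 $ i * e3 $ i) = (\<Sum>i\<in>UNIV. cross_product e1 e2 $ i * e3 $ i)"
      by (simp add: u1_def sum_3 algebra_simps)
    ultimately show False using basis by simp
  qed
  have contu1: "continuous_on {0..1} u1" unfolding u1_def by (intro continuous_intros)
  have sq1: "rsquarefree (restrict_line F (u1 t) e2)" if "t \<in> {0..1}" for t
    unfolding u1_def by (rule rF[OF in_ball[OF that]])
  note framed1 = framed_path[OF F contu1 continuous_on_const[of _ e2] cu1 Fe2 sq1]
  define \<kappa>1 where "\<kappa>1 = (\<lambda>t. line_through (u1 t) e2)"
  obtain q1 where q1: "root_motion (\<lambda>t. restrict_line F (u1 t) e2) 0 1 q1" using framed1(3) by blast
  have deg1: "degree (restrict_line F (u1 t) e2) = n" for t by (rule degree_restrict_line[OF F Fe2])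
  have path1: "q1 0 1 = s y1" "q1 (-1) 1 = s' y1"
  proof -
    have cs: "continuous_on {0..1} (\<lambda>t :: real. s (of_real t * y1))" "continuous_on {0..1} (\<lambda>t :: real. s' (of_real t * y1))"
      by (rule continuous_on_compose2[OF holomorphic_on_imp_continuous_on[OF shol(1)]]
            continuous_on_compose2[OF holomorphic_on_imp_continuous_on[OF shol(2)]],
          intro continuous_intros, use in_ball in blast)+
    have z: "poly (restrict_line F (u1 t) e2) (s (of_real t * y1)) = 0"
      "poly (restrict_line F (u1 t) e2) (s' (of_real t * y1)) = 0" if "t \<in> {0..1}" for t
      unfolding poly_restrict_line u1_def using sG[OF in_ball[OF that]] by (auto intro: GF)
    show "q1 0 1 = s y1" "q1 (-1) 1 = s' y1"
      using root_motion_unique[OF q1 deg1 sq1 cs(1) z(1), of 1] root_motion_unique[OF q1 deg1 sq1 cs(2) z(2), of 1]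
      by (simp_all add: shol)
  qed
  define X where "X = zero_locus F"
  define g1 where "g1 = (\<lambda>x. proj_point (u1 0 + x *s e2))"
  \<comment> \<open>A total function is required; its values matter only at the intersection points,
    where \<open>inv g1\<close> returns the frame parameter.\<close>
  define \<sigma>1 where "\<sigma>1 P = proj_point (u1 1 + q1 (inv g1 P) 1 *s e2)" for P
  have inj1: "inj g1" unfolding g1_def by (rule inj_frame_points[OF cu1])
  have \<sigma>1: "\<sigma>1 (proj_point (u1 0 + x *s e2)) = proj_point (u1 1 + q1 x 1 *s e2)" for x
    using inv_f_f[OF inj1, of x] by (simp add: \<sigma>1_def g1_def)
  have mono1: "has_monodromy X \<kappa>1 \<sigma>1"
    unfolding X_def \<kappa>1_def by (rule framed1(4)[OF _ q1]) (assumption | rule \<sigma>1)+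
  have u10: "u1 0 = e1" by (simp add: u1_def)

  \<comment> \<open>Turning the line about the arc point\<close>
  define u where "u = e1 + y1 *s e3 + s y1 *s e2"
  have u11: "u1 1 = e1 + y1 *s e3" by (simp add: u1_def)
  \<comment> \<open>Chosen so that the pencil \<open>e2 + c *s v\<close> runs from the vertical
    direction at 0 to the direction of the secant at 1.\<close>
  define v where "v = e3 + a *s e2 - e2"
  have ev: "e2 + v = e3 + a *s e2" by (simp add: v_def)
  have uW: "u = (e1 + b *s e2) + y1 *s (e3 + a *s e2)"
    unfolding u_def y2(3)[symmetric] by (simp add: vec_eq_iff algebra_simps)
  have lu: "line_through u e2 = line_through (u1 1) e2"
    using line_through_combination[of 1 1 "s y1" 0 "u1 1" e2, OF _ cu1] by (simp add: u_def u11)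
  have luW: "line_through u (e3 + a *s e2) = line_through (e1 + b *s e2) (e3 + a *s e2)"
    using line_through_combination[of 1 1 y1 0 "e1 + b *s e2" "e3 + a *s e2",
      OF _ cross_product_frame_nonzero[OF basis]] unfolding uW by simp
  have indep: "(\<Sum>i\<in>UNIV. cross_product e2 v $ i * u $ i) \<noteq> 0"
  proof -
    have "(\<Sum>i\<in>UNIV. cross_product e2 v $ i * u $ i) = (\<Sum>i\<in>UNIV. cross_product e1 e2 $ i * e3 $ i)"
      by (simp add: v_def u_def sum_3 algebra_simps)
    then show ?thesis using basis by simp
  qed
  have g0: "rsquarefree (restrict_line F u e2)"
    unfolding u_def by (rule rsquarefree_restrict_line_shift[OF F Fe2 rF[OF y1(1)]])
  have g1': "rsquarefree (restrict_line F u (e2 + v))"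
    unfolding ev uW by (rule rsquarefree_restrict_line_shift[OF F Fw sec])
  have Gu: "eval3 G u = 0" unfolding u_def by (rule sG(1)[OF y1(1)])
  \<comment> \<open>\<open>s' y1 - s y1\<close> is the parameter, counted from \<open>u\<close>, of
    the moved \<open>P\<^sub>2\<close> on the vertical line; \<open>y2 - y1\<close> is that of the
    target on the secant.\<close>
  have r0: "s' y1 - s y1 \<noteq> 0" using sG(3)[OF y1(1)] by auto
  have pt0: "u + (s' y1 - s y1) *s e2 = e1 + y1 *s e3 + s' y1 *s e2" by (simp add: u_def vec_eq_iff algebra_simps)
  have pt1: "u + (y2 - y1) *s (e3 + a *s e2) = e1 + y2 *s e3 + s y2 *s e2"
    unfolding uW y2(4)[symmetric] by (simp add: vec_eq_iff algebra_simps)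
  have Fev: "eval3 F (e2 + v) \<noteq> 0" unfolding ev by (rule Fw)
  have Gr0: "eval3 G (u + (s' y1 - s y1) *s e2) = 0" unfolding pt0 by (rule sG(2)[OF y1(1)])
  have r1: "y2 - y1 \<noteq> 0" using y2(2) by simp
  have Gr1: "eval3 G (u + (y2 - y1) *s (e2 + v)) = 0" unfolding ev pt1 by (rule sG(1)[OF y2(1)])
  obtain c q :: "real \<Rightarrow> complex" where c: "continuous_on {0..1} c" and q: "continuous_on {0..1} q"
    and ends: "c 0 = 0" "c 1 = 1" "q 0 = s' y1 - s y1" "q 1 = y2 - y1"
    and Fc: "\<And>t. t \<in> {0..1} \<Longrightarrow> eval3 F (e2 + c t *s v) \<noteq> 0"
    and sq2: "\<And>t. t \<in> {0..1} \<Longrightarrow> rsquarefree (restrict_line F u (e2 + c t *s v))"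
    and qroot: "\<And>t. t \<in> {0..1} \<Longrightarrow> eval3 F (u + q t *s (e2 + c t *s v)) = 0"
    by (rule pencil_root_path[OF F G(1) assms(4) G(2) indep Fe2 g0 Fev g1' Gu r0 Gr0 r1 Gr1]) blast
  define w where "w t = e2 + c t *s v" for t
  have contw: "continuous_on {0..1} w" unfolding w_def by (intro continuous_intros c)
  have cw: "cross_product u (w t) \<noteq> 0" for t
  proof
    assume 0: "cross_product u (w t) = 0"
    have "(\<Sum>i\<in>UNIV. cross_product e2 v $ i * u $ i) = (\<Sum>i\<in>UNIV. cross_product u (w t) $ i * v $ i)"
      by (simp add: w_def sum_3 algebra_simps)
    then show False using indep 0 by simp
  qed
  note framed2 = framed_path[OF F continuous_on_const[of _ u] contw cw Fc[folded w_def] sq2[folded w_def]]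
  define \<kappa>2 where "\<kappa>2 = (\<lambda>t. line_through u (w t))"
  obtain q2 where q2: "root_motion (\<lambda>t. restrict_line F u (w t)) 0 1 q2" using framed2(3) by blast
  have deg2: "degree (restrict_line F u (w t)) = n" if "t \<in> {0..1}" for t
    unfolding w_def by (rule degree_restrict_line[OF F Fc[OF that]])
  have path2: "q2 0 1 = 0" "q2 (s' y1 - s y1) 1 = y2 - y1"
    using root_motion_unique[OF q2 deg2 sq2[folded w_def] continuous_on_const[of _ 0], of 1]
      root_motion_unique[OF q2 deg2 sq2[folded w_def] q, of 1] GF[OF Gu] qroot[folded w_def]
    by (simp_all add: ends)
  define g2 where "g2 = (\<lambda>x. proj_point (u + x *s w 0))"
  define \<sigma>2 where "\<sigma>2 P = proj_point (u + q2 (inv g2 P) 1 *s w 1)" for P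
  have inj2: "inj g2" unfolding g2_def by (rule inj_frame_points[OF cw])
  have \<sigma>2: "\<sigma>2 (proj_point (u + x *s w 0)) = proj_point (u + q2 x 1 *s w 1)" for x
    using inv_f_f[OF inj2, of x] by (simp add: \<sigma>2_def g2_def)
  have mono2: "has_monodromy X \<kappa>2 \<sigma>2"
    unfolding X_def \<kappa>2_def by (rule framed2(4)[OF _ _ q2]) (assumption | rule \<sigma>2)+
  have w01: "w 0 = e2" "w 1 = e3 + a *s e2" by (simp_all add: w_def ends ev)

  \<comment> \<open>Conjugating the half turn\<close>
  define \<kappa> where "\<kappa> = \<kappa>1 +++ \<kappa>2"
  define \<sigma> where "\<sigma> = \<sigma>2 \<circ> \<sigma>1"
  have join: "pathfinish \<kappa>1 = pathstart \<kappa>2"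
    by (simp add: \<kappa>1_def \<kappa>2_def pathstart_def pathfinish_def w01 lu)
  have mono: "has_monodromy X \<kappa> \<sigma>"
    unfolding \<kappa>_def \<sigma>_def by (rule has_monodromy_join[OF mono1 mono2 join])
  have \<kappa>path: "path \<kappa>" "path_image \<kappa> \<subseteq> T"
    using framed1(1,2) framed2(1,2) join
    unfolding \<kappa>_def T_def \<kappa>1_def[symmetric] \<kappa>2_def[symmetric]
    by (auto intro: path_join_imp simp: path_image_join)
  have \<kappa>start: "pathstart \<kappa> = l\<^sub>0" by (simp add: \<kappa>_def l0) (simp add: \<kappa>1_def pathstart_def u10)
  have \<kappa>fin: "pathfinish \<kappa> = line_through (e1 + b *s e2) (e3 + a *s e2)"
    by (simp add: \<kappa>_def) (simp add: \<kappa>2_def pathfinish_def w01 luW)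
  have \<sigma>P1: "\<sigma> P\<^sub>1 = proj_point (e1 + y1 *s e3 + s y1 *s e2)"
  proof -
    have "\<sigma>1 P\<^sub>1 = proj_point (u + 0 *s w 0)"
      unfolding P1 using \<sigma>1[of 0] by (simp add: u10 path1 u11 u_def)
    then show ?thesis using \<sigma>2[of 0] by (simp add: \<sigma>_def path2 u_def)
  qed
  have \<sigma>P2: "\<sigma> P\<^sub>2 = proj_point (e1 + y2 *s e3 + s y2 *s e2)"
  proof -
    have "\<sigma>1 P\<^sub>2 = proj_point (u + (s' y1 - s y1) *s w 0)"
      unfolding P2 w01 pt0 using \<sigma>1[of "-1"] unfolding u10 path1 u11 .
    then show ?thesis
      unfolding \<sigma>_def comp_def using \<sigma>2[of "s' y1 - s y1"] by (simp only: path2 w01 pt1)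
  qed
  have inT: "\<kappa> t \<in> T" if "t \<in> {0..1}" for t using \<kappa>path(2) that by (auto simp: path_image_def)
  have "has_monodromy X (\<kappa> +++ (\<mu> +++ reversepath \<kappa>)) (Transposition.transpose P\<^sub>1 P\<^sub>2)"
  proof (rule has_monodromy_conjugate_transposition[OF mono])
    show "has_monodromy X \<mu> (Transposition.transpose (\<sigma> P\<^sub>1) (\<sigma> P\<^sub>2))"
      unfolding \<sigma>P1 \<sigma>P2 X_def by (rule swap)
    show "pathstart \<mu> = pathfinish \<kappa>" "pathfinish \<mu> = pathfinish \<kappa>" by (simp_all add: \<mu> \<kappa>fin)
    show "finite (line_points (\<kappa> 0) \<inter> X)" "card (line_points (\<kappa> 1) \<inter> X) = card (line_points (\<kappa> 0) \<inter> X)"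
      using inT[of 0] inT[of 1] by (simp_all add: T_def transversal_lines_def X_def)
    have "P\<^sub>1 \<in> zero_locus F" "P\<^sub>2 \<in> zero_locus F"
      unfolding p1 p2 proj_point_in_zero_locus_iff[OF F p1(1)] proj_point_in_zero_locus_iff[OF F p2(1)]
      by (rule GF[OF Gp(1)], rule GF[OF Gp(2)])
    then show "P\<^sub>1 \<in> line_points (\<kappa> 0) \<inter> X" "P\<^sub>2 \<in> line_points (\<kappa> 0) \<inter> X"
      using assms(8,9) \<kappa>start by (auto simp: X_def pathstart_def)
  qed
  moreover have "path (\<kappa> +++ (\<mu> +++ reversepath \<kappa>))" "path_image (\<kappa> +++ (\<mu> +++ reversepath \<kappa>)) \<subseteq> T"
    using \<kappa>path \<mu> \<kappa>fin by (auto simp: path_image_join)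
  moreover have "pathstart (\<kappa> +++ (\<mu> +++ reversepath \<kappa>)) = l\<^sub>0" "pathfinish (\<kappa> +++ (\<mu> +++ reversepath \<kappa>)) = l\<^sub>0"
    using \<kappa>start by simp_all
  ultimately show ?thesis unfolding T_def X_def by blast
qed

end
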